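(* Let $d\ge1$. For each of the three models (walk, bridge, Wendel), let $U_2,U_3,\dots$ be independent random variables with $U_m\sim\mathrm{Bern}(1/T_m)$, where $T_m=2m$ for the walk, $T_m=m$ for the bridge and $T_m=2$ for Wendel. Then, for $n\ge d+1$ in the walk and Wendel models and $n\ge d+2$ in the bridge model, $$p_{\mathrm{walk}}(n,d)=\mathbb{P}\Big(\sum_{m=2}^nU_m\ge d\Big),\qquad p_{\mathrm{br}}(n,d)=\mathbb{P}\Big(\sum_{m=3}^nU_m\ge d\Big)$$ (the sum for the bridge starting at $m=3$), and $$p_{\mathrm{Wend}}(n,d)=\mathbb{P}\Big(\sum_{m=2}^nU_m\ge d\Big)=\mathbb{P}\big(\mathrm{Bin}(n-1,\tfrac12)\ge d\big).$$
   Context: $\mathrm{Bern}(p)$ is the Bernoulli distribution on $\{0,1\}$ with success probability $p$; $\mathrm{Bin}(N,p)$ is a binomial random variable. For a matrix $X=(x_1|\dots|x_n)$ with columns in $\mathbb{R}^d$ write $s_k(X)=x_1+\dots+x_k$. The absorption probabilities are the following quotients; in each model the count is the same for every regular configuration $X$. Wendel ($n\ge d+1$): $X\in\mathbb{R}^{d\times n}$ is regular if any $d$ of its columns are linearly independent; $p_{\mathrm{Wend}}(n,d)=2^{-n}\,|\{\varepsilon\in\{\pm1\}^n: 0\in\operatorname{Conv}(\varepsilon_1x_1,\dots,\varepsilon_nx_n)\}|$. Walk ($n\ge d+1$): $\mathfrak B_n$ is the group of signed permutations $g=(\sigma,\varepsilon)$, $\sigma$ a permutation of $\{1,\dots,n\}$,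 $\varepsilon\in\{\pm1\}^n$, acting by $gX=(\varepsilon_1x_{\sigma(1)}|\dots|\varepsilon_nx_{\sigma(n)})$; $X\in\mathbb{R}^{d\times n}$ is regular if for every $g\in\mathfrak B_n$ any $d$ of $s_1(gX),\dots,s_n(gX)$ are linearly independent; $p_{\mathrm{walk}}(n,d)=\frac{1}{2^nn!}|\{g\in\mathfrak B_n:0\in\operatorname{Conv}(s_1(gX),\dots,s_n(gX))\}|$. Bridge ($n\ge d+2$): configurations are $X=(x_1|\dots|x_n)\in\mathbb{R}^{d\times n}$ with $x_1+\dots+x_n=0$, with the symmetric group $\mathfrak S_n$ acting by $\sigma X=(x_{\sigma(1)}|\dots|x_{\sigma(n)})$; $X$ is regular if for every $\sigma\in\mathfrak S_n$ any $d$ of $s_1(\sigma X),\dots,s_{n-1}(\sigma X)$ are linearly independent; $p_{\mathrm{br}}(n,d)=\frac{1}{n!}|\{\sigma\in\mathfrak S_n:0\in\operatorname{Conv}(s_1(\sigma X),\dots,s_{n-1}(\sigma X))\}|$. *)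

theory Defs
  imports "HOL-Probability.Probability" "HOL-Combinatorics.Permutations"
begin

text \<open>
  A configuration with columns \<open>x\<^sub>1, \<dots>, x\<^sub>n\<close> in \<open>\<real>\<^sup>d\<close> is a function \<open>X :: nat \<Rightarrow> real ^ 'd\<close>,
  where \<open>d = CARD('d) \<ge> 1\<close>. Only the values of \<open>X\<close> on \<open>{1..n}\<close> are relevant.
\<close>

definition partial_sum :: "(nat \<Rightarrow> real ^ 'd) \<Rightarrow> nat \<Rightarrow> real ^ 'd" where
  "partial_sum X k = (\<Sum>i = 1..k. X i)"

text \<open>
  Any \<open>d\<close> of \<open>v\<^sub>1, \<dots>, v\<^sub>n\<close> are linearly independent as a family: vectors with different indices
  must in particular be distinct, hence the injectivity requirement.
\<close>

definition general_position :: "nat \<Rightarrow> (nat \<Rightarrow> real ^ 'd) \<Rightarrow> bool" where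
  "general_position n v \<longleftrightarrow>
     (\<forall>J. J \<subseteq> {1..n} \<and> card J = CARD('d) \<longrightarrow> inj_on v J \<and> independent (v ` J))"

definition sign_vectors :: "nat \<Rightarrow> (nat \<Rightarrow> real) set" where
  "sign_vectors n = {1..n} \<rightarrow>\<^sub>E {- 1, 1}"

definition perms :: "nat \<Rightarrow> (nat \<Rightarrow> nat) set" where
  "perms n = {\<sigma>. \<sigma> permutes {1..n}}"

definition signed_perms :: "nat \<Rightarrow> ((nat \<Rightarrow> nat) \<times> (nat \<Rightarrow> real)) set" where
  "signed_perms n = perms n \<times> sign_vectors n"

definition sign_act :: "(nat \<Rightarrow> real) \<Rightarrow> (nat \<Rightarrow> real ^ 'd) \<Rightarrow> nat \<Rightarrow> real ^ 'd" where
  "sign_act \<epsilon> X i = \<epsilon> i *\<^sub>R X i"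

definition perm_act :: "(nat \<Rightarrow> nat) \<Rightarrow> (nat \<Rightarrow> real ^ 'd) \<Rightarrow> nat \<Rightarrow> real ^ 'd" where
  "perm_act \<sigma> X i = X (\<sigma> i)"

definition signed_perm_act ::
    "(nat \<Rightarrow> nat) \<times> (nat \<Rightarrow> real) \<Rightarrow> (nat \<Rightarrow> real ^ 'd) \<Rightarrow> nat \<Rightarrow> real ^ 'd" where
  "signed_perm_act g X i = snd g i *\<^sub>R X (fst g i)"

definition wendel_regular :: "nat \<Rightarrow> (nat \<Rightarrow> real ^ 'd) \<Rightarrow> bool" where
  "wendel_regular n X \<longleftrightarrow> general_position n X"

definition walk_regular :: "nat \<Rightarrow> (nat \<Rightarrow> real ^ 'd) \<Rightarrow> bool" where
  "walk_regular n X \<longleftrightarrow>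
     (\<forall>g \<in> signed_perms n. general_position n (partial_sum (signed_perm_act g X)))"

definition bridge_configuration :: "nat \<Rightarrow> (nat \<Rightarrow> real ^ 'd) \<Rightarrow> bool" where
  "bridge_configuration n X \<longleftrightarrow> (\<Sum>i = 1..n. X i) = 0"

definition bridge_regular :: "nat \<Rightarrow> (nat \<Rightarrow> real ^ 'd) \<Rightarrow> bool" where
  "bridge_regular n X \<longleftrightarrow>
     (\<forall>\<sigma> \<in> perms n. general_position (n - 1) (partial_sum (perm_act \<sigma> X)))"

text \<open>
  The absorption probabilities are given as functions of the configuration \<open>X\<close>. They are to be used
  for regular configurations, where their values do not depend on \<open>X\<close>.
\<close>

definition p_wendel :: "nat \<Rightarrow> (nat \<Rightarrow> real ^ 'd) \<Rightarrow> real" where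
  "p_wendel n X =
     real (card {\<epsilon> \<in> sign_vectors n. 0 \<in> convex hull (sign_act \<epsilon> X ` {1..n})}) / 2 ^ n"

definition p_walk :: "nat \<Rightarrow> (nat \<Rightarrow> real ^ 'd) \<Rightarrow> real" where
  "p_walk n X =
     real (card {g \<in> signed_perms n.
                   0 \<in> convex hull (partial_sum (signed_perm_act g X) ` {1..n})})
       / (2 ^ n * fact n)"

definition p_bridge :: "nat \<Rightarrow> (nat \<Rightarrow> real ^ 'd) \<Rightarrow> real" where
  "p_bridge n X =
     real (card {\<sigma> \<in> perms n.
                   0 \<in> convex hull (partial_sum (perm_act \<sigma> X) ` {1..n - 1})})
       / fact n"

text \<open>
  \<open>U\<^sub>2, U\<^sub>3, \<dots>\<close> are independent random variables on \<open>M\<close> and \<open>U\<^sub>m\<close> has the Bernoulli distribution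
  on \<open>{0, 1}\<close> with success probability \<open>1 / T\<^sub>m\<close>. The library's \<open>bernoulli_pmf\<close> lives on \<open>bool\<close>.
\<close>

definition indep_bernoulli_seq ::
    "'a measure \<Rightarrow> (nat \<Rightarrow> real) \<Rightarrow> (nat \<Rightarrow> 'a \<Rightarrow> nat) \<Rightarrow> bool" where
  "indep_bernoulli_seq M T U \<longleftrightarrow>
     prob_space M \<and>
     prob_space.indep_vars M (\<lambda>_. count_space UNIV) U {2..} \<and>
     (\<forall>m\<ge>2. distr M (count_space UNIV) (U m) =
              measure_pmf (map_pmf of_bool (bernoulli_pmf (1 / T m))))"

end

theory Submission
  imports Defs
begin

text \<open>
  The origin lies in the convex hull of \<open>n > d\<close> vectors in general position iff some combination of
  them with strictly positive coefficients vanishes. Rewritten by summation by parts, such a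
  combination of the partial sums of \<open>g X\<close> is a linear relation \<open>\<Sum> \<mu>\<^sub>i x\<^sub>i = 0\<close> whose coefficient vector
  lies in the open chamber of \<open>g\<close> in the arrangement \<open>\<mu>\<^sub>m = 0, \<mu>\<^sub>m = \<plusminus> \<mu>\<^sub>i\<close> (walk), \<open>\<mu>\<^sub>m = \<mu>\<^sub>i\<close> (bridge) or
  \<open>\<mu>\<^sub>m = 0\<close> (Wendel). So the absorbing \<open>g\<close> are counted by the chambers that the space of relations meets.

  These are counted by adding one coordinate. Inside a chamber of the first \<open>n\<close> coordinates the walls
  for \<open>\<mu>\<close> at \<open>n + 1\<close> are linearly ordered, so a convex set is cut into one more piece than it meets
  walls. The chambers met before cutting are those of the relations modulo \<open>x\<close> at \<open>n + 1\<close>, in codimension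
  \<open>d - 1\<close>; the pieces on the wall \<open>\<mu>\<^sub>n\<^sub>+\<^sub>1 = c \<mu>\<^sub>i\<close> are those of the configuration in which
  \<open>c x\<^sub>n\<^sub>+\<^sub>1\<close> is merged into \<open>x\<^sub>i\<close>. With \<open>T - 1\<close> walls this gives
  \<open>N(n + 1, d) = N(n, d - 1) + (T - 1) N(n, d)\<close>, which after normalization is the recursion for the tail
  of a sum of independent Bernoulli variables with parameters \<open>1 / T\<close>.
\<close>

text \<open>The induction leaves the original configurations: it passes to quotients and merges
  columns, so general position must be kept in a form that survives both. The form used is dual: a
  relation on a face of dimension at most d, modulo the lineality space, lies in the lineality
  space. On a wall the degree is no larger than that of the first n coordinates, and in general a
  new coordinate raises it by at most one; hence merging keeps d and projection lowers it to d - 1.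
  Quotients are taken by enlarging a subspace S of a fixed space, with d its codimension.

  The relations must cross each wall transversally. Let b be the dimension of the lineality space.
  For n + 1 coordinates and d \<le> n - b, regularity supplies enough independent columns. For d = n
  + 1 - b all relations lie in the lineality space and no chamber is met; at the first step, n = b
  and d = 1, the recursion would not give this zero. This is why the variable with index b + 1 drops
  out and the sums start at b + 2: at 2 for the walk and Wendel (b = 0), at 3 for the bridge (b =
  1).\<close>

section \<open>Tails of Bernoulli sums\<close>

text \<open>Probability that independent Bernoulli variables with parameters \<open>p a\<close>,
  ..., \<open>p (a + k - 1)\<close> have sum at least \<open>d\<close>, by conditioning on the last
  one. At \<open>d = 0\<close> truncated subtraction makes both recursive calls coincide, as it
  should: the event is certain.\<close>

primrec bernoulli_tail :: "(nat \<Rightarrow> real) \<Rightarrow> nat \<Rightarrow> nat \<Rightarrow> nat \<Rightarrow> real" where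
  "bernoulli_tail p a 0 d = of_bool (d = 0)"
| "bernoulli_tail p a (Suc k) d = (1 - p (a + k)) * bernoulli_tail p a k d + p (a + k) * bernoulli_tail p a k (d - 1)"

lemma tail_eq_0: "k < d \<Longrightarrow> bernoulli_tail p a k d = 0"
  by (induction k arbitrary: d) auto

lemma tail_cong: "(\<And>i. a \<le> i \<Longrightarrow> i < a + k \<Longrightarrow> p i = q i) \<Longrightarrow> bernoulli_tail p a k d = bernoulli_tail q a k d"
  by (induction k arbitrary: d) auto

lemma binomial_tail:
  assumes "0 \<le> p" "p \<le> 1"
  shows "measure_pmf.prob (binomial_pmf k p) {x. x \<ge> d} = bernoulli_tail (\<lambda>_. p) a k d"
proof (induction k arbitrary: d)
  case 0
  then show ?case using assms by (simp add: binomial_pmf_0 measure_return_pmf)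
next
  case (Suc k)
  have "measure_pmf.prob (binomial_pmf (Suc k) p) {x. x \<ge> d} =
     measure_pmf.prob (bernoulli_pmf p \<bind> (\<lambda>b. map_pmf (\<lambda>x. of_bool b + x) (binomial_pmf k p))) {x. x \<ge> d}"
    using assms
    by (simp add: binomial_pmf_Suc map_pmf_def pair_pmf_def bind_assoc_pmf bind_return_pmf of_bool_def add.commute)
  also have "\<dots> = p * measure_pmf.prob (binomial_pmf k p) {x. x \<ge> d - 1}
                 + (1 - p) * measure_pmf.prob (binomial_pmf k p) {x. x \<ge> d}"
  proof -
    have "{x. d \<le> Suc x} = {x. d - 1 \<le> x}" by auto
    moreover have "measure_pmf.prob (bernoulli_pmf p \<bind> g) A
         = measure_pmf.expectation (bernoulli_pmf p) (\<lambda>b. measure_pmf.prob (g b) A)"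
      for g :: "bool \<Rightarrow> nat pmf" and A
      unfolding measure_pmf_bind
      by (rule measure_pmf.measure_bind[where N = "count_space UNIV"])
        (auto simp: measure_pmf_in_subprob_algebra)
    ultimately show ?thesis
      using assms by (simp add: vimage_def)
  qed
  also have "\<dots> = bernoulli_tail (\<lambda>_. p) a (Suc k) d"
    by (simp add: Suc)
  finally show ?case .
qed

text \<open>Conditioning on the last variable reproduces the recursion of
  \<open>bernoulli_tail\<close>. Only the distribution of \<open>U m\<close> is given, so its values
  are 0 and 1 almost surely rather than surely, and the event is split up to a null set.\<close>

lemma prob_tail:
  assumes "indep_bernoulli_seq M T U" and "2 \<le> a" and T: "\<And>m. a \<le> m \<Longrightarrow> T m \<ge> 1"
  shows "\<P>(\<omega> in M. (\<Sum>m = a..<a + k. U m \<omega>) \<ge> d) = bernoulli_tail (\<lambda>m. 1 / T m) a k d"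
proof -
  interpret prob_space M using assms by (simp add: indep_bernoulli_seq_def)
  have ind: "indep_vars (\<lambda>_. count_space UNIV) U {2..}"
    and U: "\<And>m. m \<ge> 2 \<Longrightarrow> distr M (count_space UNIV) (U m) =
              measure_pmf (map_pmf of_bool (bernoulli_pmf (1 / T m)))"
    using assms by (auto simp: indep_bernoulli_seq_def)
  have meas: "U m \<in> measurable M (count_space UNIV)" if "m \<ge> 2" for m
    using ind that by (auto simp: indep_vars_def2)
  show ?thesis
  proof (induction k arbitrary: d)
    case 0
    then show ?case by (simp add: prob_space)
  next
    case (Suc k)
    define m where "m = a + k"
    \<comment> \<open>The independence of the last variable from the sum of the earlier ones is
      taken from a result on real-valued variables, hence the casts.\<close>
    define V where "V = (\<lambda>\<omega>. real (U m \<omega>))"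
    define R where "R = (\<lambda>\<omega>. \<Sum>i = a..<m. real (U i \<omega>))"
    have m2: "m \<ge> 2" "T m \<ge> 1" using \<open>2 \<le> a\<close> T by (auto simp: m_def)
    have "indep_vars (\<lambda>_. borel) (\<lambda>i \<omega>. real (U i \<omega>)) {2..}"
      by (rule indep_vars_compose2[OF ind]) auto
    then have "indep_vars (\<lambda>_. borel) (\<lambda>i \<omega>. real (U i \<omega>)) (insert m {a..<m})"
      by (rule indep_vars_subset) (use \<open>2 \<le> a\<close> m2 in auto)
    then have indep: "indep_var borel V borel R"
      unfolding V_def R_def by (intro indep_vars_sum) auto
    have [measurable]: "V \<in> borel_measurable M" "R \<in> borel_measurable M"
      using indep_var_rv1[OF indep] indep_var_rv2[OF indep] by auto
    have U_prob: "prob (U m -` A \<inter> space M)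
        = measure_pmf.prob (bernoulli_pmf (1 / T m)) (of_bool -` A)" for A
      unfolding measure_map_pmf[symmetric] U[OF m2(1), symmetric]
      by (rule measure_distr[symmetric]) (use meas m2 in auto)
    have split: "prob {\<omega> \<in> space M. V \<omega> = c \<and> R \<omega> \<ge> e}
        = prob {\<omega> \<in> space M. V \<omega> = c} * prob {\<omega> \<in> space M. R \<omega> \<ge> e}" for c e
      using indep_varD[OF indep, of "{c}" "{e..}"]
      by (simp add: vimage_def Int_def conj_commute)
    have VR: "{\<omega> \<in> space M. V \<omega> = real c} = U m -` {c} \<inter> space M" for c
      by (auto simp: V_def)
    have vim: "of_bool -` {1 :: nat} = {True}" "of_bool -` {0 :: nat} = {False}"
      by (auto simp: of_bool_def split: if_splits)
    have 1: "prob {\<omega> \<in> space M. V \<omega> = 1} = 1 / T m"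
      using VR[of 1] U_prob[of "{1}"] m2
      by (simp add: vim measure_pmf_single del: One_nat_def)
    have 0: "prob {\<omega> \<in> space M. V \<omega> = 0} = 1 - 1 / T m"
      using VR[of 0] U_prob[of "{0}"] m2
      by (simp add: vim measure_pmf_single del: One_nat_def)
    have IH: "prob {\<omega> \<in> space M. R \<omega> \<ge> real e} = bernoulli_tail (\<lambda>m. 1 / T m) a k e" for e
      using Suc[of e] by (simp add: R_def m_def flip: of_nat_sum)
    have disj: "{\<omega> \<in> space M. V \<omega> = 0} \<inter> {\<omega> \<in> space M. V \<omega> = 1} = {}" by auto
    \<comment> \<open>The atoms 0 and 1 carry all the mass, so the other natural numbers form a null
      set.\<close>
    have "prob ({\<omega> \<in> space M. V \<omega> = 0} \<union> {\<omega> \<in> space M. V \<omega> = 1}) = 1"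
      using finite_measure_Union[OF _ _ disj] 0 1 by simp
    then have "AE \<omega> in M. V \<omega> = 0 \<or> V \<omega> = 1"
      using prob_eq_1[of "{\<omega> \<in> space M. V \<omega> = 0} \<union> {\<omega> \<in> space M. V \<omega> = 1}"]
      by (auto elim!: AE_mp)
    then have "\<P>(\<omega> in M. (\<Sum>i = a..<a + Suc k. U i \<omega>) \<ge> d)
        = prob ({\<omega> \<in> space M. V \<omega> = 0 \<and> R \<omega> \<ge> real d} \<union> {\<omega> \<in> space M. V \<omega> = 1 \<and> R \<omega> \<ge> real (d - 1)})"
    proof (intro finite_measure_eq_AE)
      have *: "(\<Sum>i = a..<a + Suc k. U i \<omega>) \<ge> d \<longleftrightarrow> R \<omega> + V \<omega> \<ge> real d" for \<omega>
        unfolding R_def V_def m_def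
        by (simp flip: of_nat_sum of_nat_add)
      show "{\<omega> \<in> space M. (\<Sum>i = a..<a + Suc k. U i \<omega>) \<ge> d} \<in> sets M"
        unfolding * by measurable
      \<comment> \<open>The thresholds differ only for \<open>d = 0\<close>, where both are met
        because \<open>R\<close> is nonnegative.\<close>
      have **: "R \<omega> \<ge> real d - 1 \<longleftrightarrow> R \<omega> \<ge> real (d - 1)" for \<omega>
        by (cases d) (auto simp: R_def intro: order_trans[OF _ sum_nonneg])
      assume "AE \<omega> in M. V \<omega> = 0 \<or> V \<omega> = 1"
      then show "AE \<omega> in M. (\<omega> \<in> {\<omega> \<in> space M. (\<Sum>i = a..<a + Suc k. U i \<omega>) \<ge> d}) \<longleftrightarrow>
         (\<omega> \<in> {\<omega> \<in> space M. V \<omega> = 0 \<and> R \<omega> \<ge> real d} \<union> {\<omega> \<in> space M. V \<omega> = 1 \<and> R \<omega> \<ge> real (d - 1)})"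
        unfolding * **[symmetric] by eventually_elim auto
    qed measurable
    also have "\<dots> = prob {\<omega> \<in> space M. V \<omega> = 0 \<and> R \<omega> \<ge> real d}
                  + prob {\<omega> \<in> space M. V \<omega> = 1 \<and> R \<omega> \<ge> real (d - 1)}"
      by (rule finite_measure_Union) auto
    also have "\<dots> = bernoulli_tail (\<lambda>m. 1 / T m) a (Suc k) d"
      unfolding split 0 1 IH by (simp add: m_def)
    finally show ?case .
  qed
qed

section \<open>Cutting a convex set by ordered walls\<close>

text \<open>All points of \<open>D\<close> see the walls in the same linear order, so the sets of
  walls below \<open>f\<close> are initial segments of one chain, hence nested. Every attained
  segment except the least is given by its top wall, and that wall is hit on the way from the least
  segment. Conversely a hit wall \<open>w\<close> yields two segments, with and without
  \<open>w\<close>, by moving off it to either side. So the hit walls correspond to the attained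
  segments other than the least. Convexity enters only through \<open>crossing\<close>,
  transversality through \<open>below\<close> and \<open>above\<close>.\<close>

lemma card_cuts:
  fixes f :: "'m \<Rightarrow> real" and h :: "'w \<Rightarrow> 'm \<Rightarrow> real"
  assumes W: "finite W" and D: "D \<noteq> {}"
    and order: "\<And>x y v w. \<lbrakk>x \<in> D; y \<in> D; v \<in> W; w \<in> W; h v x < h w x\<rbrakk> \<Longrightarrow> h v y < h w y"
    and distinct: "\<And>x v w. \<lbrakk>x \<in> D; v \<in> W; w \<in> W; h v x = h w x\<rbrakk> \<Longrightarrow> v = w"
    and crossing: "\<And>x y w. \<lbrakk>x \<in> D; y \<in> D; w \<in> W; h w x < f x; f y < h w y\<rbrakk>
                      \<Longrightarrow> \<exists>z\<in>D. h w z = f z"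
    and below: "\<And>x w. \<lbrakk>x \<in> D; w \<in> W; h w x = f x\<rbrakk> \<Longrightarrow>
        \<exists>y\<in>D. f y < h w y \<and> (\<forall>v\<in>W - {w}. h v y \<noteq> f y \<and> (h v y < f y \<longleftrightarrow> h v x < f x))"
    and above: "\<And>x w. \<lbrakk>x \<in> D; w \<in> W; h w x = f x\<rbrakk> \<Longrightarrow>
        \<exists>y\<in>D. h w y < f y \<and> (\<forall>v\<in>W - {w}. h v y \<noteq> f y \<and> (h v y < f y \<longleftrightarrow> h v x < f x))"
  shows "card ((\<lambda>x. {w \<in> W. h w x < f x}) ` {x \<in> D. \<forall>w\<in>W. h w x \<noteq> f x})
          = 1 + card {w \<in> W. \<exists>x\<in>D. h w x = f x}" (is "card ?A = 1 + card ?B")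
proof -
  define cut where "cut = (\<lambda>x. {w \<in> W. h w x < f x})"
  define A where "A = ?A"
  define B where "B = ?B"
  have A: "A = cut ` {x \<in> D. \<forall>w\<in>W. h w x \<noteq> f x}"
    by (simp add: A_def cut_def)
  have memB: "w \<in> B \<longleftrightarrow> w \<in> W \<and> (\<exists>x\<in>D. h w x = f x)" for w
    by (simp add: B_def)
  obtain x0 where x0: "x0 \<in> D" using D by blast
  \<comment> \<open>The initial segment with top wall \<open>w\<close>. Comparing heights at the
    single point \<open>x0\<close> suffices because the order is constant on
    \<open>D\<close>.\<close>
  define down where "down w = {v \<in> W. h v x0 \<le> h w x0}" for w
  have order_iff: "h v x < h w x \<longleftrightarrow> h v y < h w y"
    if "x \<in> D" "y \<in> D" "v \<in> W" "w \<in> W" for x y v w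
    using order that by blast
  have order_le: "h v x \<le> h w x \<longleftrightarrow> h v y \<le> h w y"
    if "x \<in> D" "y \<in> D" "v \<in> W" "w \<in> W" for x y v w
    using order_iff[OF that(1,2,4,3)] by linarith
  have cut_closed: "v \<in> cut x" if "w \<in> cut x" "v \<in> W" "h v x0 \<le> h w x0" "x \<in> D" for v w x
    using that order_le[OF x0 \<open>x \<in> D\<close>, of v w] by (auto simp: cut_def)
  have finA: "finite A"
    by (rule finite_subset[of _ "Pow W"]) (use W in \<open>auto simp: A cut_def\<close>)
  have memA: "cut y \<in> A" if "y \<in> D" "\<And>v. v \<in> W \<Longrightarrow> h v y \<noteq> f y" for y
    unfolding A using that by blast
  have down_mem: "down w \<in> A \<and> down w - {w} \<in> A" if hit: "w \<in> B" for w
  proof -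
    obtain x where x: "x \<in> D" "w \<in> W" "h w x = f x" using hit memB by blast
    have dw: "down w - {w} = {v \<in> W - {w}. h v x < f x}"
    proof -
      have "h v x0 \<le> h w x0 \<longleftrightarrow> h v x < f x" if "v \<in> W" "v \<noteq> w" for v
        using order_le[OF x0 x(1) that(1) x(2)] distinct[OF x(1) that(1) x(2)] that(2) x(3)
        by force
      then show ?thesis by (auto simp: down_def)
    qed
    obtain y where y: "y \<in> D" "f y < h w y"
        "\<forall>v\<in>W - {w}. h v y \<noteq> f y \<and> (h v y < f y \<longleftrightarrow> h v x < f x)"
      using below[OF x] by blast
    have "cut y = down w - {w}" unfolding dw using y by (auto simp: cut_def)
    moreover have "h v y \<noteq> f y" if "v \<in> W" for v
      using y that by (cases "v = w") auto
    ultimately have 1: "down w - {w} \<in> A" using memA[OF y(1)] by simp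
    obtain z where z: "z \<in> D" "h w z < f z"
        "\<forall>v\<in>W - {w}. h v z \<noteq> f z \<and> (h v z < f z \<longleftrightarrow> h v x < f x)"
      using above[OF x] by blast
    have "w \<in> down w" using x by (simp add: down_def)
    moreover have "cut z - {w} = down w - {w}" unfolding dw using z by (auto simp: cut_def)
    moreover have "w \<in> cut z" using x z by (simp add: cut_def)
    ultimately have "cut z = down w" by blast
    moreover have "h v z \<noteq> f z" if "v \<in> W" for v
      using z that by (cases "v = w") auto
    ultimately have 2: "down w \<in> A" using memA[OF z(1)] by simp
    show ?thesis using 1 2 by blast
  qed
  \<comment> \<open>If \<open>x0\<close> lies on a wall it yields no segment itself, but a point
    pushed off that wall does.\<close>
  have "A \<noteq> {}"
  proof (cases "\<exists>w\<in>W. h w x0 = f x0")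
    case True
    then show ?thesis using down_mem x0 memB by blast
  next
    case False
    then show ?thesis using x0 memA by blast
  qed
  \<comment> \<open>In a nested family a member of minimal cardinality is the least one.\<close>
  then obtain a0 where a0: "a0 \<in> A" "\<And>a. a \<in> A \<Longrightarrow> card a0 \<le> card a"
    using ex_is_arg_min_if_finite[OF finA, of card] unfolding is_arg_min_linorder by blast
  have finW: "finite a" if "a \<in> A" for a
    using that W by (auto simp: A cut_def)
  obtain y0 where y0: "y0 \<in> D" "\<forall>w\<in>W. h w y0 \<noteq> f y0" "a0 = cut y0"
    using a0(1) unfolding A by blast
  have least: "a0 \<subseteq> c" if c: "c \<in> A" for c
  proof (rule ccontr)
    assume neg: "\<not> a0 \<subseteq> c"
    obtain x where x: "x \<in> D" "c = cut x" using c unfolding A by blast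
    obtain v where v: "v \<in> a0" "v \<notin> c" using neg by blast
    have "c \<subset> a0"
    proof -
      have "u \<in> a0" if "u \<in> c" for u
      proof -
        have "u \<in> W" "v \<in> W" using that v x y0 by (auto simp: cut_def)
        moreover have "\<not> h v x0 \<le> h u x0"
          using cut_closed[of u x v] that v x \<open>v \<in> W\<close> by blast
        ultimately show ?thesis using cut_closed[of v y0 u] v y0 by auto
      qed
      then show ?thesis using v by blast
    qed
    then have "card c < card a0" using finW[OF a0(1)] by (simp add: psubset_card_mono)
    then show False using a0(2)[OF c] by simp
  qed
  have "bij_betw down B (A - {a0})"
    unfolding bij_betw_def
  proof
    show "inj_on down B"
    proof (rule inj_onI)
      fix v w assume vw: "v \<in> B" "w \<in> B" "down v = down w"
      then have "v \<in> down w" "w \<in> down v" by (auto simp: down_def memB)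
      then have "h v x0 = h w x0" by (simp add: down_def)
      then show "v = w" using distinct[OF x0] vw memB by blast
    qed
    show "down ` B = A - {a0}"
    proof
      show "down ` B \<subseteq> A - {a0}"
      proof
        fix c assume "c \<in> down ` B"
        then obtain w where w: "w \<in> B" "c = down w" by blast
        have "w \<in> down w" using w memB by (simp add: down_def)
        then have "down w \<noteq> a0" using least down_mem[OF w(1)] by blast
        then show "c \<in> A - {a0}" using down_mem[OF w(1)] w by blast
      qed
      show "A - {a0} \<subseteq> down ` B"
      proof
        fix c assume c: "c \<in> A - {a0}"
        then obtain x where x: "x \<in> D" "c = cut x" unfolding A by blast
        have "finite c" "a0 \<subseteq> c" "c \<noteq> a0" using c finW least by blast+
        then have "c \<noteq> {}" by blast
        \<comment> \<open>The top wall of \<open>c\<close>, found as a minimum of the negated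
          height.\<close>
        then obtain w where w: "w \<in> c" "\<And>v. v \<in> c \<Longrightarrow> h v x0 \<le> h w x0"
          using ex_is_arg_min_if_finite[OF \<open>finite c\<close>, of "\<lambda>v. - h v x0"]
          unfolding is_arg_min_linorder by auto
        have wW: "w \<in> W" using w x by (simp add: cut_def)
        have cd: "c = down w"
          using w x cut_closed[of w x] by (auto simp: down_def cut_def)
        have "w \<notin> a0"
        proof
          assume "w \<in> a0"
          then have "c \<subseteq> a0" using cut_closed[of w y0] y0 cd by (auto simp: down_def)
          then show False using \<open>a0 \<subseteq> c\<close> \<open>c \<noteq> a0\<close> by blast
        qed
        \<comment> \<open>\<open>f\<close> is below the wall at \<open>y0\<close> and above it at
          \<open>x\<close>, so the wall is hit in between.\<close>
        then have "f y0 < h w y0" using y0 wW unfolding cut_def by force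
        moreover have "h w x < f x" using w x by (simp add: cut_def)
        ultimately have "w \<in> B" using crossing[OF x(1) y0(1) wW] wW memB by blast
        then show "c \<in> down ` B" using cd by blast
      qed
    qed
  qed
  then have "card B = card (A - {a0})" by (rule bij_betw_same_card)
  moreover have "card A = Suc (card (A - {a0}))" by (rule card.remove[OF finA a0(1)])
  ultimately show ?thesis by (simp add: A_def B_def)
qed

section \<open>Relations and wall arrangements\<close>

text \<open>
  The pair \<open>(c, i) \<in> walls m\<close> stands for the hyperplane \<open>\<mu> m = c * \<mu> i\<close>. The hyperplane \<open>\<mu> m = 0\<close> is
  encoded as \<open>(0, 0)\<close>, since coordinates are numbered from \<open>1\<close>.
\<close>

definition wall_value :: "real \<times> nat \<Rightarrow> (nat \<Rightarrow> real) \<Rightarrow> real" where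
  "wall_value w \<mu> = fst w * \<mu> (snd w)"

definition generic :: "(nat \<Rightarrow> (real \<times> nat) set) \<Rightarrow> nat \<Rightarrow> (nat \<Rightarrow> real) \<Rightarrow> bool" where
  "generic walls n \<mu> \<longleftrightarrow> (\<forall>m\<in>{1..n}. \<forall>w\<in>walls m. wall_value w \<mu> \<noteq> \<mu> m)"

text \<open>A sign vector: at a generic point it records the side of every wall and so names the
  open chamber.\<close>

definition pattern :: "(nat \<Rightarrow> (real \<times> nat) set) \<Rightarrow> nat \<Rightarrow> (nat \<Rightarrow> real) \<Rightarrow> (nat \<times> real \<times> nat) set" where
  "pattern walls n \<mu> = {(m, w). m \<in> {1..n} \<and> w \<in> walls m \<and> wall_value w \<mu> < \<mu> m}"

text \<open>Membership in \<open>S\<close> stands for vanishing in the quotient by \<open>S\<close>,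
  so dividing out columns one after another never changes the type.\<close>

definition relation_mod :: "nat \<Rightarrow> (nat \<Rightarrow> 'v::real_vector) \<Rightarrow> 'v set \<Rightarrow> (nat \<Rightarrow> real) \<Rightarrow> bool" where
  "relation_mod n X S \<mu> \<longleftrightarrow> (\<Sum>i = 1..n. \<mu> i *\<^sub>R X i) \<in> S"

definition patterns :: "(nat \<Rightarrow> (real \<times> nat) set) \<Rightarrow> nat \<Rightarrow> (nat \<Rightarrow> 'v::real_vector) \<Rightarrow> 'v set
    \<Rightarrow> (nat \<times> real \<times> nat) set set" where
  "patterns walls n X S = pattern walls n ` {\<mu>. generic walls n \<mu> \<and> relation_mod n X S \<mu>}"

text \<open>On the wall \<open>\<mu> n = c * \<mu> i\<close> the last column occurs with coefficient
  \<open>c * \<mu> i\<close>, so \<open>c\<close> times that column can be added to column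
  \<open>i\<close>. For \<open>(0, 0)\<close> no column of the configuration changes, and merging
  amounts to deleting column \<open>n\<close>.\<close>

definition merge_vector :: "real \<times> nat \<Rightarrow> nat \<Rightarrow> (nat \<Rightarrow> 'v::real_vector) \<Rightarrow> nat \<Rightarrow> 'v" where
  "merge_vector w n X = X(snd w := X (snd w) + fst w *\<^sub>R X n)"

definition nonzero_count :: "nat \<Rightarrow> (nat \<Rightarrow> real) \<Rightarrow> nat" where
  "nonzero_count n \<mu> = card {i \<in> {1..n}. \<mu> i \<noteq> 0}"

text \<open>
  General position, dually and without permutations. The function \<open>deg\<close> gives the least dimension of a
  face of the arrangement, modulo its lineality space, that contains \<open>\<mu>\<close>.
\<close>

definition regular_mod :: "(nat \<Rightarrow> (nat \<Rightarrow> real) \<Rightarrow> nat) \<Rightarrow> nat \<Rightarrow> nat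
    \<Rightarrow> (nat \<Rightarrow> 'v::real_vector) \<Rightarrow> 'v set \<Rightarrow> bool" where
  "regular_mod deg n d X S \<longleftrightarrow> (\<forall>\<mu>. relation_mod n X S \<mu> \<and> deg n \<mu> \<le> d \<longrightarrow> deg n \<mu> = 0)"

section \<open>Spans modulo a subspace, and relations with one more coordinate\<close>

lemma span_insert_subspace:
  assumes "subspace S"
  shows "u \<in> span (insert x S) \<longleftrightarrow> (\<exists>t. u - t *\<^sub>R x \<in> S)"
  using assms by (simp add: span_insert span_eq_iff[THEN iffD2])

lemma span_image_mod:
  fixes X :: "nat \<Rightarrow> 'v::real_vector"
  assumes "subspace S"
  shows "u \<in> span (S \<union> X ` {1..k}) \<longleftrightarrow> (\<exists>a. u - (\<Sum>i = 1..k. a i *\<^sub>R X i) \<in> S)"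
proof (induction k arbitrary: u)
  case 0
  then show ?case using assms by (simp add: span_eq_iff[THEN iffD2])
next
  case (Suc k)
  have "S \<union> X ` {1..Suc k} = insert (X (Suc k)) (S \<union> X ` {1..k})"
    by (auto simp: atLeastAtMostSuc_conv)
  then have "u \<in> span (S \<union> X ` {1..Suc k}) \<longleftrightarrow> (\<exists>t a. u - t *\<^sub>R X (Suc k) - (\<Sum>i = 1..k. a i *\<^sub>R X i) \<in> S)"
    by (simp only: span_insert Suc mem_Collect_eq)
  also have "\<dots> \<longleftrightarrow> (\<exists>a. u - (\<Sum>i = 1..Suc k. a i *\<^sub>R X i) \<in> S)"
  proof safe
    fix t a assume "u - t *\<^sub>R X (Suc k) - (\<Sum>i = 1..k. a i *\<^sub>R X i) \<in> S"
    moreover have "(\<Sum>i = 1..k. (a(Suc k := t)) i *\<^sub>R X i) = (\<Sum>i = 1..k. a i *\<^sub>R X i)"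
      by (intro sum.cong) auto
    ultimately show "\<exists>a. u - (\<Sum>i = 1..Suc k. a i *\<^sub>R X i) \<in> S"
      by (intro exI[of _ "a(Suc k := t)"]) (simp add: algebra_simps)
  next
    fix a assume "u - (\<Sum>i = 1..Suc k. a i *\<^sub>R X i) \<in> S"
    then show "\<exists>t a. u - t *\<^sub>R X (Suc k) - (\<Sum>i = 1..k. a i *\<^sub>R X i) \<in> S"
      by (intro exI[of _ "a (Suc k)"] exI[of _ a]) (simp add: algebra_simps)
  qed
  finally show ?case .
qed

text \<open>Each column is independent of \<open>S\<close> and the earlier columns, so the dimension
  grows by one \<open>k\<close> times and reaches that of the space.\<close>

lemma span_eq_UNIV_mod:
  fixes X :: "nat \<Rightarrow> 'v::euclidean_space"
  assumes S: "subspace S" and dim: "dim S + k = DIM('v)"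
    and indep: "\<And>a. (\<Sum>i = 1..k. a i *\<^sub>R X i) \<in> S \<Longrightarrow> \<forall>i\<in>{1..k}. a i = 0"
  shows "span (S \<union> X ` {1..k}) = UNIV"
proof -
  have "j \<le> k \<Longrightarrow> dim (S \<union> X ` {1..j}) = dim S + j" for j
  proof (induction j)
    case (Suc j)
    have "X (Suc j) \<notin> span (S \<union> X ` {1..j})"
    proof
      assume "X (Suc j) \<in> span (S \<union> X ` {1..j})"
      then obtain a where a: "X (Suc j) - (\<Sum>i = 1..j. a i *\<^sub>R X i) \<in> S"
        using span_image_mod[OF S] by blast
      \<comment> \<open>A dependence of the next column on the earlier ones, read as a relation with
        coefficient 1 at \<open>Suc j\<close>.\<close>
      define c where "c i = (if i \<le> j then - a i else of_bool (i = Suc j))" for i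
      have "(\<Sum>i = 1..k. c i *\<^sub>R X i) = (\<Sum>i = 1..Suc j. c i *\<^sub>R X i)"
        by (rule sum.mono_neutral_right) (use Suc.prems in \<open>auto simp: c_def\<close>)
      also have "\<dots> = X (Suc j) - (\<Sum>i = 1..j. a i *\<^sub>R X i)"
        by (simp add: c_def sum_negf)
      finally have "c (Suc j) = 0"
        using indep[of c] a Suc.prems by auto
      then show False by (simp add: c_def)
    qed
    moreover have "S \<union> X ` {1..Suc j} = insert (X (Suc j)) (S \<union> X ` {1..j})"
      by (auto simp: atLeastAtMostSuc_conv)
    ultimately show ?case using Suc by (simp add: dim_insert)
  qed simp
  from this[of k] have "dim (S \<union> X ` {1..k}) = DIM('v)" using dim by simp
  then show ?thesis using dim_eq_full by blast
qed

lemma pattern_Suc: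
  "pattern walls (Suc n) \<mu>
     = pattern walls n \<mu> \<union> {Suc n} \<times> {w \<in> walls (Suc n). wall_value w \<mu> < \<mu> (Suc n)}"
  by (auto simp: pattern_def le_Suc_eq)

lemma generic_Suc:
  "generic walls (Suc n) \<mu> \<longleftrightarrow> generic walls n \<mu> \<and> (\<forall>w\<in>walls (Suc n). wall_value w \<mu> \<noteq> \<mu> (Suc n))"
  by (auto simp: generic_def atLeastAtMostSuc_conv)

lemma pattern_subset: "pattern walls n \<mu> \<subseteq> {1..n} \<times> UNIV"
  by (auto simp: pattern_def)

lemma pattern_mem:
  "\<lbrakk>m \<in> {1..n}; w \<in> walls m\<rbrakk> \<Longrightarrow> (m, w) \<in> pattern walls n \<mu> \<longleftrightarrow> wall_value w \<mu> < \<mu> m"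
  by (auto simp: pattern_def)

text \<open>This is projection along the last coordinate: a suitable last coefficient exists exactly
  if the rest of the sum is a multiple of the last column modulo \<open>S\<close>.\<close>

lemma relation_mod_span_insert:
  assumes "subspace S"
  shows "relation_mod n X (span (insert (X (Suc n)) S)) \<mu>
     \<longleftrightarrow> (\<exists>t. relation_mod (Suc n) X S (\<mu>(Suc n := t)))"
proof -
  have *: "(\<Sum>i = 1..n. (\<mu>(Suc n := t)) i *\<^sub>R X i) = (\<Sum>i = 1..n. \<mu> i *\<^sub>R X i)" for t
    by (intro sum.cong) auto
  show ?thesis
    unfolding relation_mod_def span_insert_subspace[OF assms]
  proof safe
    fix t assume "(\<Sum>i = 1..n. \<mu> i *\<^sub>R X i) - t *\<^sub>R X (Suc n) \<in> S"
    then show "\<exists>t. (\<Sum>i = 1..Suc n. (\<mu>(Suc n := t)) i *\<^sub>R X i) \<in> S"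
      by (intro exI[of _ "- t"]) (simp add: *)
  next
    fix t assume "(\<Sum>i = 1..Suc n. (\<mu>(Suc n := t)) i *\<^sub>R X i) \<in> S"
    then show "\<exists>t. (\<Sum>i = 1..n. \<mu> i *\<^sub>R X i) - t *\<^sub>R X (Suc n) \<in> S"
      by (intro exI[of _ "- t"]) (simp add: *)
  qed
qed

lemma sum_merge:
  assumes "snd w \<le> n" "fst w = 0 \<or> 1 \<le> snd w"
  shows "(\<Sum>i = 1..n. \<mu> i *\<^sub>R merge_vector w (Suc n) X i)
      = (\<Sum>i = 1..n. \<mu> i *\<^sub>R X i) + wall_value w \<mu> *\<^sub>R X (Suc n)"
proof -
  have "(\<Sum>i = 1..n. \<mu> i *\<^sub>R merge_vector w (Suc n) X i)
      = (\<Sum>i = 1..n. \<mu> i *\<^sub>R X i + (if i = snd w then wall_value w \<mu> *\<^sub>R X (Suc n) else 0))"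
    by (intro sum.cong) (auto simp: merge_vector_def wall_value_def algebra_simps)
  also have "\<dots> = (\<Sum>i = 1..n. \<mu> i *\<^sub>R X i) + wall_value w \<mu> *\<^sub>R X (Suc n)"
    using assms by (auto simp: sum.distrib wall_value_def)
  finally show ?thesis .
qed

lemma relation_mod_merge:
  assumes "snd w \<le> n" "fst w = 0 \<or> 1 \<le> snd w"
  shows "relation_mod n (merge_vector w (Suc n) X) S \<mu>
     \<longleftrightarrow> relation_mod (Suc n) X S (\<mu>(Suc n := wall_value w \<mu>))"
proof -
  have "(\<Sum>i = 1..n. (\<mu>(Suc n := t)) i *\<^sub>R X i) = (\<Sum>i = 1..n. \<mu> i *\<^sub>R X i)" for t
    by (intro sum.cong) auto
  then show ?thesis
    by (simp add: relation_mod_def sum_merge[OF assms] del: One_nat_def)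
qed

text \<open>Agreement is required at index 0 as well, since the encoded wall \<open>(0, 0)\<close>
  formally reads that coordinate.\<close>

lemma pattern_cong:
  assumes "\<And>i. i \<le> n \<Longrightarrow> \<mu> i = \<nu> i" "\<And>m w. w \<in> walls m \<Longrightarrow> snd w < m"
  shows "pattern walls n \<mu> = pattern walls n \<nu>" "generic walls n \<mu> \<longleftrightarrow> generic walls n \<nu>"
proof -
  have "wall_value w \<mu> = wall_value w \<nu>" "\<mu> m = \<nu> m" if "m \<in> {1..n}" "w \<in> walls m" for m w
    using that assms(2)[OF that(2)] assms(1)[of m] assms(1)[of "snd w"] by (auto simp: wall_value_def)
  then show "pattern walls n \<mu> = pattern walls n \<nu>" "generic walls n \<mu> \<longleftrightarrow> generic walls n \<nu>"
    by (auto simp: pattern_def generic_def)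
qed

lemma wall_value_add:
  "wall_value w (\<lambda>i. a * \<mu> i + b * \<nu> i) = a * wall_value w \<mu> + b * wall_value w \<nu>"
  by (simp add: wall_value_def algebra_simps)

lemma relation_mod_add:
  assumes "subspace S" "relation_mod n X S \<mu>" "relation_mod n X S \<nu>"
  shows "relation_mod n X S (\<lambda>i. a * \<mu> i + b * \<nu> i)"
proof -
  have "(\<Sum>i = 1..n. (a * \<mu> i + b * \<nu> i) *\<^sub>R X i)
      = a *\<^sub>R (\<Sum>i = 1..n. \<mu> i *\<^sub>R X i) + b *\<^sub>R (\<Sum>i = 1..n. \<nu> i *\<^sub>R X i)"
    by (simp add: algebra_simps sum.distrib scaleR_sum_right)
  then show ?thesis
    using assms by (simp add: relation_mod_def subspace_add subspace_scale)
qed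

text \<open>\<open>b\<close> is the dimension of the lineality space of the arrangement.\<close>

locale wall_model =
  fixes walls :: "nat \<Rightarrow> (real \<times> nat) set" and deg :: "nat \<Rightarrow> (nat \<Rightarrow> real) \<Rightarrow> nat" and b :: nat
  assumes finite_walls: "finite (walls m)"
    and walls_le: "m \<le> b \<Longrightarrow> walls m = {}"
    and snd_wall: "w \<in> walls m \<Longrightarrow> snd w < m"
    and fst_wall: "w \<in> walls m \<Longrightarrow> fst w = 0 \<or> 1 \<le> snd w"
    and walls_distinct: "\<lbrakk>generic walls n \<mu>; v \<in> walls (Suc n); w \<in> walls (Suc n);
          wall_value v \<mu> = wall_value w \<mu>\<rbrakk> \<Longrightarrow> v = w"
    and walls_order: "\<lbrakk>generic walls n \<mu>; generic walls n \<nu>; pattern walls n \<mu> = pattern walls n \<nu>;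
          v \<in> walls (Suc n); w \<in> walls (Suc n); wall_value v \<mu> < wall_value w \<mu>\<rbrakk>
          \<Longrightarrow> wall_value v \<nu> < wall_value w \<nu>"
    and deg_merge: "\<lbrakk>w \<in> walls (Suc n); \<mu> (Suc n) = wall_value w \<mu>\<rbrakk> \<Longrightarrow> deg (Suc n) \<mu> \<le> deg n \<mu>"
    and deg_mono: "deg n \<mu> \<le> deg (Suc n) \<mu>"
    and deg_Suc: "deg (Suc n) \<mu> \<le> deg n \<mu> + 1"
    and deg_cong: "(\<And>i. i \<in> {1..n} \<Longrightarrow> \<mu> i = \<nu> i) \<Longrightarrow> deg n \<mu> = deg n \<nu>"
    and deg_le_nonzero: "deg n \<mu> \<le> nonzero_count n \<mu>"
    and deg_eq_0: "\<lbrakk>deg n \<mu> = 0; nonzero_count n \<mu> \<le> n - b; b \<le> n; i \<in> {1..n}\<rbrakk> \<Longrightarrow> \<mu> i = 0"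
    and deg_le: "b \<le> n \<Longrightarrow> deg n \<mu> \<le> n - b"
    and deg_generic: "\<lbrakk>generic walls n \<mu>; b < n\<rbrakk> \<Longrightarrow> deg n \<mu> \<noteq> 0"
begin

section \<open>Regularity under quotients and merging\<close>

lemmas pattern_cong' = pattern_cong[OF _ snd_wall]

lemma finite_patterns: "finite (patterns walls n X S)"
proof (rule finite_subset)
  show "patterns walls n X S \<subseteq> Pow (SIGMA m:{1..n}. walls m)"
    by (auto simp: patterns_def pattern_def)
  show "finite (Pow (SIGMA m:{1..n}. walls m))"
    by (simp add: finite_walls)
qed

text \<open>A relation modulo the last column lifts to a relation with one more coordinate, whose
  degree is larger by at most one. This is why the bound has to drop to \<open>d - 1\<close>;
  monotonicity of the degree carries the conclusion back.\<close>

lemma regular_mod_span_insert: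
  assumes reg: "regular_mod deg (Suc n) d X S" and "1 \<le> d" "subspace S"
  shows "regular_mod deg n (d - 1) X (span (insert (X (Suc n)) S))"
  unfolding regular_mod_def
proof (intro allI impI, elim conjE)
  fix \<mu> assume "relation_mod n X (span (insert (X (Suc n)) S)) \<mu>" and deg: "deg n \<mu> \<le> d - 1"
  then obtain t where t: "relation_mod (Suc n) X S (\<mu>(Suc n := t))"
    using relation_mod_span_insert \<open>subspace S\<close> by blast
  have eq: "deg n (\<mu>(Suc n := t)) = deg n \<mu>"
    by (rule deg_cong) auto
  then have "deg (Suc n) (\<mu>(Suc n := t)) \<le> d"
    using deg deg_Suc[of n "\<mu>(Suc n := t)"] \<open>1 \<le> d\<close> by simp
  then have "deg (Suc n) (\<mu>(Suc n := t)) = 0"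
    using reg t by (simp add: regular_mod_def)
  then show "deg n \<mu> = 0"
    using deg_mono[of n "\<mu>(Suc n := t)"] eq by simp
qed

lemma relation_mod_merge_wall:
  assumes "w \<in> walls (Suc n)"
  shows "relation_mod n (merge_vector w (Suc n) X) S \<mu>
     \<longleftrightarrow> relation_mod (Suc n) X S (\<mu>(Suc n := wall_value w \<mu>))"
  using relation_mod_merge[of w n X S \<mu>] snd_wall[OF assms] fst_wall[OF assms] by simp

text \<open>The lifted relation lies on the wall \<open>w\<close>, where the last coordinate adds
  nothing to the degree, so the bound \<open>d\<close> is kept.\<close>

lemma regular_mod_merge:
  assumes reg: "regular_mod deg (Suc n) d X S" and w: "w \<in> walls (Suc n)"
  shows "regular_mod deg n d (merge_vector w (Suc n) X) S"
  unfolding regular_mod_def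
proof (intro allI impI, elim conjE)
  fix \<mu> assume rel: "relation_mod n (merge_vector w (Suc n) X) S \<mu>" and deg: "deg n \<mu> \<le> d"
  define \<mu>' where "\<mu>' = \<mu>(Suc n := wall_value w \<mu>)"
  have "\<mu>' (Suc n) = wall_value w \<mu>'"
    using snd_wall[OF w] by (simp add: \<mu>'_def wall_value_def)
  then have "deg (Suc n) \<mu>' \<le> deg n \<mu>'"
    by (rule deg_merge[OF w])
  moreover have eq: "deg n \<mu>' = deg n \<mu>"
    unfolding \<mu>'_def by (rule deg_cong) auto
  ultimately have "deg (Suc n) \<mu>' = 0"
    using reg rel deg by (simp add: regular_mod_def relation_mod_merge_wall[OF w] \<mu>'_def)
  then show "deg n \<mu> = 0"
    using deg_mono[of n \<mu>'] eq by simp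
qed

text \<open>The source of transversality. A relation supported on the first \<open>d\<close> columns
  has degree at most \<open>d\<close>, so regularity makes these columns independent modulo
  \<open>S\<close>, and \<open>d\<close> is the codimension of \<open>S\<close>.\<close>

lemma regular_mod_spans:
  fixes X :: "nat \<Rightarrow> 'v::euclidean_space"
  assumes reg: "regular_mod deg n d X S" and S: "subspace S" "dim S + d = DIM('v)"
    and d: "d \<le> n - b" "b \<le> n"
  shows "\<exists>a. u - (\<Sum>i = 1..n. a i *\<^sub>R X i) \<in> S"
proof -
  have "span (S \<union> X ` {1..d}) = UNIV"
  proof (rule span_eq_UNIV_mod[OF S])
    fix a assume a: "(\<Sum>i = 1..d. a i *\<^sub>R X i) \<in> S"
    define c where "c i = (if i \<le> d then a i else 0)" for i
    have "(\<Sum>i = 1..n. c i *\<^sub>R X i) = (\<Sum>i = 1..d. a i *\<^sub>R X i)"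
      by (rule sum.mono_neutral_cong_right) (use d in \<open>auto simp: c_def\<close>)
    then have rel: "relation_mod n X S c"
      using a by (simp add: relation_mod_def)
    have "nonzero_count n c \<le> card {1..d}"
      unfolding nonzero_count_def by (rule card_mono) (auto simp: c_def split: if_splits)
    then have nz: "nonzero_count n c \<le> d" by simp
    then have "deg n c = 0"
      using reg rel deg_le_nonzero[of n c] by (simp add: regular_mod_def)
    \<comment> \<open>Degree 0 alone only places \<open>c\<close> in the lineality space; a vector
      with at most \<open>n - b\<close> nonzero entries in that space is zero.\<close>
    then have "c i = 0" if "i \<in> {1..n}" for i
      using deg_eq_0 nz d that by (meson order_trans)
    then show "\<forall>i\<in>{1..d}. a i = 0"
      using d by (fastforce simp: c_def)
  qed
  moreover have "S \<union> X ` {1..d} \<subseteq> S \<union> X ` {1..n}"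
    using d by auto
  ultimately have "u \<in> span (S \<union> X ` {1..n})"
    using span_mono by blast
  then show ?thesis using span_image_mod[OF S(1)] by blast
qed

text \<open>If the last column lay in \<open>S\<close>, its unit coefficient vector would be a
  relation of degree at most 1, contradicting regularity for \<open>d \<ge> 1\<close>.\<close>

lemma dim_span_insert:
  fixes X :: "nat \<Rightarrow> 'v::euclidean_space"
  assumes reg: "regular_mod deg (Suc n) d X S" and "1 \<le> d" "subspace S" "b \<le> n"
  shows "dim (span (insert (X (Suc n)) S)) = dim S + 1"
proof -
  have "X (Suc n) \<notin> S"
  proof
    assume X: "X (Suc n) \<in> S"
    define e where "e i = (of_bool (i = Suc n) :: real)" for i
    have "(\<Sum>i = 1..n. e i *\<^sub>R X i) = 0"
      by (rule sum.neutral) (auto simp: e_def)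
    then have rel: "relation_mod (Suc n) X S e"
      using X by (simp add: relation_mod_def e_def)
    have "{i \<in> {1..Suc n}. e i \<noteq> 0} = {Suc n}"
      by (auto simp: e_def)
    then have nz: "nonzero_count (Suc n) e = 1"
      by (simp add: nonzero_count_def)
    then have "deg (Suc n) e = 0"
      using reg rel deg_le_nonzero[of "Suc n" e] \<open>1 \<le> d\<close> by (simp add: regular_mod_def)
    then have "e (Suc n) = 0"
      using deg_eq_0[of "Suc n" e "Suc n"] nz \<open>b \<le> n\<close> by simp
    then show False by (simp add: e_def)
  qed
  then show ?thesis
    using \<open>subspace S\<close> by (simp add: dim_insert span_eq_iff[THEN iffD2])
qed

end

section \<open>Cells, small perturbations and cuts\<close>

lemma eventually_sign:
  fixes r s :: real
  assumes "r \<noteq> 0"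
  shows "\<forall>\<^sub>F t in at 0. r + t * s \<noteq> 0 \<and> (0 < r + t * s \<longleftrightarrow> 0 < r)"
proof -
  have lim: "((\<lambda>t. r + t * s) \<longlongrightarrow> r) (at 0)"
    by (auto intro!: tendsto_eq_intros)
  show ?thesis
  proof (cases "0 < r")
    case True
    then show ?thesis using order_tendstoD(1)[OF lim, of 0] by (auto elim: eventually_mono)
  next
    case False
    then show ?thesis using order_tendstoD(2)[OF lim, of 0] assms by (auto elim: eventually_mono)
  qed
qed

context wall_model
begin

text \<open>Chamber and genericity concern the first \<open>n\<close> coordinates, the relation all
  \<open>n + 1\<close>. This is the convex set that the walls of the new coordinate cut.\<close>

definition cell :: "nat \<Rightarrow> (nat \<Rightarrow> 'v::real_vector) \<Rightarrow> 'v set \<Rightarrow> (nat \<times> real \<times> nat) set \<Rightarrow> (nat \<Rightarrow> real) set" where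
  "cell n X S p = {\<mu>. generic walls n \<mu> \<and> relation_mod (Suc n) X S \<mu> \<and> pattern walls n \<mu> = p}"

text \<open>Convexity: both points give each linear form \<open>\<mu> m - wall_value w \<mu>\<close>
  the same strict sign, and the combination inherits it.\<close>

lemma cell_combination:
  assumes "subspace S" "\<mu> \<in> cell n X S p" "\<nu> \<in> cell n X S p" and ab: "0 \<le> r" "0 \<le> s" "r + s = 1"
  shows "(\<lambda>i. r * \<mu> i + s * \<nu> i) \<in> cell n X S p" (is "?\<kappa> \<in> _")
proof -
  have pos: "0 < r * u + s * v" if "0 < u" "0 < v" for u v
    using that ab by (cases "r = 0") (auto intro: add_pos_nonneg)
  have sign: "wall_value w ?\<kappa> \<noteq> ?\<kappa> m \<and> (wall_value w ?\<kappa> < ?\<kappa> m \<longleftrightarrow> wall_value w \<mu> < \<mu> m)"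
    if mw: "m \<in> {1..n}" "w \<in> walls m" for m w
  proof -
    define x where "x = \<mu> m - wall_value w \<mu>"
    define y where "y = \<nu> m - wall_value w \<nu>"
    have 1: "?\<kappa> m - wall_value w ?\<kappa> = r * x + s * y"
      by (simp add: wall_value_add x_def y_def algebra_simps)
    have "wall_value w \<mu> \<noteq> \<mu> m" "wall_value w \<nu> \<noteq> \<nu> m"
      using assms(2,3) mw unfolding cell_def generic_def by blast+
    then have "x \<noteq> 0" "y \<noteq> 0"
      by (simp_all add: x_def y_def)
    moreover have "0 < x \<longleftrightarrow> 0 < y"
      using assms(2,3) pattern_mem[of m n w walls \<mu>] pattern_mem[of m n w walls \<nu>] mw
      by (simp add: cell_def x_def y_def)
    ultimately consider "0 < x" "0 < y" | "x < 0" "y < 0" by linarith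
    then have "r * x + s * y \<noteq> 0 \<and> (0 < r * x + s * y \<longleftrightarrow> 0 < x)"
    proof cases
      case 1
      then show ?thesis using pos[of x y] by simp
    next
      case 2
      then show ?thesis using pos[of "- x" "- y"] by simp
    qed
    then show ?thesis using 1 unfolding x_def by linarith
  qed
  have "generic walls n ?\<kappa>"
    using sign by (auto simp: generic_def)
  moreover have "pattern walls n ?\<kappa> = pattern walls n \<mu>"
    using sign by (auto simp: pattern_def)
  moreover have "relation_mod (Suc n) X S ?\<kappa>"
    using assms by (intro relation_mod_add) (auto simp: cell_def)
  ultimately show ?thesis
    using assms(2) by (simp add: cell_def)
qed

text \<open>Move from \<mu> in the direction \<nu>. The form of \<open>w\<close> vanishes at \<mu>
  and is 1 at \<nu>, so it equals \<open>t\<close> along the path; the finitely many other forms are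
  nonzero at \<mu> and keep their signs for small \<open>t\<close>.\<close>

lemma cell_perturb:
  assumes S: "subspace S" and \<mu>: "\<mu> \<in> cell n X S p" and w: "w \<in> walls (Suc n)"
    and hit: "wall_value w \<mu> = \<mu> (Suc n)"
    and \<nu>: "relation_mod (Suc n) X S \<nu>" "\<nu> (Suc n) - wall_value w \<nu> = 1"
  shows "\<exists>e>0. \<forall>t. t \<noteq> 0 \<and> \<bar>t\<bar> < e \<longrightarrow> (\<exists>\<kappa>\<in>cell n X S p. \<kappa> (Suc n) - wall_value w \<kappa> = t \<and>
      (\<forall>v\<in>walls (Suc n) - {w}. wall_value v \<kappa> \<noteq> \<kappa> (Suc n) \<and>
         (wall_value v \<kappa> < \<kappa> (Suc n) \<longleftrightarrow> wall_value v \<mu> < \<mu> (Suc n))))"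
proof -
  \<comment> \<open>The factor 1 gives the path the shape of \<open>wall_value_add\<close> and
    \<open>relation_mod_add\<close>.\<close>
  define \<kappa> where "\<kappa> t = (\<lambda>i. 1 * \<mu> i + t * \<nu> i)" for t
  \<comment> \<open>All walls of the first \<open>n + 1\<close> coordinates except \<open>w\<close>.
    None of their forms vanishes at \<mu>: the old ones by genericity, the new ones because distinct
    new walls never agree at a generic point.\<close>
  define I where "I = (SIGMA m:{1..Suc n}. walls m) - {(Suc n, w)}"
  have diff: "\<kappa> t m - wall_value v (\<kappa> t) = (\<mu> m - wall_value v \<mu>) + t * (\<nu> m - wall_value v \<nu>)" for t m v
    unfolding \<kappa>_def wall_value_add by (simp add: algebra_simps)
  have fin: "finite I"
    unfolding I_def by (intro finite_Diff finite_SigmaI finite_walls) auto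
  have "\<forall>\<^sub>F t in at 0. \<forall>(m, v)\<in>I. \<kappa> t m - wall_value v (\<kappa> t) \<noteq> 0 \<and>
     (0 < \<kappa> t m - wall_value v (\<kappa> t) \<longleftrightarrow> 0 < \<mu> m - wall_value v \<mu>)"
  proof (rule eventually_ball_finite[OF fin], rule ballI)
    fix mv assume mv: "mv \<in> I"
    obtain m v where [simp]: "mv = (m, v)" by (cases mv)
    have "\<mu> m \<noteq> wall_value v \<mu>"
    proof (cases "m = Suc n")
      case True
      then have "v \<in> walls (Suc n)" "v \<noteq> w" using mv by (auto simp: I_def)
      then show ?thesis
        using walls_distinct[of n \<mu> v w] w hit True \<mu> by (auto simp: cell_def)
    next
      case False
      then show ?thesis
        using mv \<mu> by (force simp: I_def cell_def generic_def)
    qed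
    then show "\<forall>\<^sub>F t in at 0. case mv of (m, v) \<Rightarrow> \<kappa> t m - wall_value v (\<kappa> t) \<noteq> 0 \<and>
       (0 < \<kappa> t m - wall_value v (\<kappa> t) \<longleftrightarrow> 0 < \<mu> m - wall_value v \<mu>)"
      unfolding diff using eventually_sign[of "\<mu> m - wall_value v \<mu>"] by simp
  qed
  then obtain e where e: "e > 0" and sign: "\<And>t m v. \<lbrakk>t \<noteq> 0; \<bar>t\<bar> < e; (m, v) \<in> I\<rbrakk> \<Longrightarrow>
      wall_value v (\<kappa> t) \<noteq> \<kappa> t m \<and> (wall_value v (\<kappa> t) < \<kappa> t m \<longleftrightarrow> wall_value v \<mu> < \<mu> m)"
    unfolding eventually_at by (fastforce simp: dist_real_def)
  show ?thesis
  proof (intro exI[of _ e] conjI allI impI, rule e, elim conjE)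
    fix t :: real assume t: "t \<noteq> 0" "\<bar>t\<bar> < e"
    have old: "(m, v) \<in> I" if "m \<in> {1..n}" "v \<in> walls m" for m v
      using that by (auto simp: I_def)
    have "generic walls n (\<kappa> t)"
      using sign[OF t old] unfolding generic_def by blast
    moreover have "pattern walls n (\<kappa> t) = pattern walls n \<mu>"
      using sign[OF t old] unfolding pattern_def by blast
    moreover have "relation_mod (Suc n) X S (\<kappa> t)"
      unfolding \<kappa>_def using S \<mu> \<nu> by (intro relation_mod_add) (auto simp: cell_def)
    ultimately have "\<kappa> t \<in> cell n X S p"
      using \<mu> by (simp add: cell_def)
    moreover have "\<kappa> t (Suc n) - wall_value w (\<kappa> t) = t"
      unfolding diff using \<nu> hit by simp
    moreover have "wall_value v (\<kappa> t) \<noteq> \<kappa> t (Suc n) \<and>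
         (wall_value v (\<kappa> t) < \<kappa> t (Suc n) \<longleftrightarrow> wall_value v \<mu> < \<mu> (Suc n))"
      if "v \<in> walls (Suc n) - {w}" for v
      using sign[OF t, of "Suc n" v] that by (simp add: I_def)
    ultimately show "\<exists>\<kappa>\<in>cell n X S p. \<kappa> (Suc n) - wall_value w \<kappa> = t \<and>
      (\<forall>v\<in>walls (Suc n) - {w}. wall_value v \<kappa> \<noteq> \<kappa> (Suc n) \<and>
         (wall_value v \<kappa> < \<kappa> (Suc n) \<longleftrightarrow> wall_value v \<mu> < \<mu> (Suc n)))"
      by blast
  qed
qed

text \<open>Convexity of the cell yields the crossing condition, and a transversal relation moves a
  point on a wall to either side without touching the other walls.\<close>

lemma card_cell_cuts:
  assumes S: "subspace S" and p: "cell n X S p \<noteq> {}"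
    and transversal: "\<And>w. w \<in> walls (Suc n) \<Longrightarrow>
      \<exists>\<nu>. relation_mod (Suc n) X S \<nu> \<and> \<nu> (Suc n) - wall_value w \<nu> = 1"
  shows "card ((\<lambda>\<mu>. {w \<in> walls (Suc n). wall_value w \<mu> < \<mu> (Suc n)}) `
            {\<mu> \<in> cell n X S p. \<forall>w\<in>walls (Suc n). wall_value w \<mu> \<noteq> \<mu> (Suc n)})
       = 1 + card {w \<in> walls (Suc n). \<exists>\<mu>\<in>cell n X S p. wall_value w \<mu> = \<mu> (Suc n)}"
proof (rule card_cuts[OF finite_walls p])
  show "wall_value v y < wall_value w y"
    if "x \<in> cell n X S p" "y \<in> cell n X S p" "v \<in> walls (Suc n)" "w \<in> walls (Suc n)"
      "wall_value v x < wall_value w x" for x y v w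
    using that walls_order[of n x y v w] by (simp add: cell_def)
  show "v = w"
    if "x \<in> cell n X S p" "v \<in> walls (Suc n)" "w \<in> walls (Suc n)" "wall_value v x = wall_value w x" for x v w
    using that walls_distinct[of n x v w] by (simp add: cell_def)
  show "\<exists>z\<in>cell n X S p. wall_value w z = z (Suc n)"
    if "x \<in> cell n X S p" "y \<in> cell n X S p" "wall_value w x < x (Suc n)" "y (Suc n) < wall_value w y" for x y w
  proof -
    define g where "g = x (Suc n) - wall_value w x"
    define h where "h = wall_value w y - y (Suc n)"
    have gh: "g > 0" "h > 0" using that by (auto simp: g_def h_def)
    \<comment> \<open>The weights are inversely proportional to the distances \<open>g\<close> and
      \<open>h\<close> from the wall, so that \<open>r * g = s * h\<close>.\<close>
    define r where "r = h / (g + h)"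
    define s where "s = g / (g + h)"
    define z where "z = (\<lambda>i. r * x i + s * y i)"
    have "z \<in> cell n X S p"
      unfolding z_def r_def s_def using gh that
      by (intro cell_combination[OF S]) (auto simp: add_divide_distrib[symmetric])
    moreover have "z (Suc n) - wall_value w z = r * g - s * h"
      unfolding z_def wall_value_add g_def h_def by (simp add: algebra_simps)
    then have "wall_value w z = z (Suc n)" by (simp add: r_def s_def)
    ultimately show ?thesis by blast
  qed
  have perturb: "\<exists>e>0. \<forall>t. t \<noteq> 0 \<and> \<bar>t\<bar> < e \<longrightarrow> (\<exists>\<kappa>\<in>cell n X S p. \<kappa> (Suc n) - wall_value w \<kappa> = t \<and>
      (\<forall>v\<in>walls (Suc n) - {w}. wall_value v \<kappa> \<noteq> \<kappa> (Suc n) \<and>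
         (wall_value v \<kappa> < \<kappa> (Suc n) \<longleftrightarrow> wall_value v x < x (Suc n))))"
    if x: "x \<in> cell n X S p" "w \<in> walls (Suc n)" "wall_value w x = x (Suc n)" for x w
    using cell_perturb[OF S x] transversal[OF x(2)] by blast
  show "\<exists>y\<in>cell n X S p. y (Suc n) < wall_value w y \<and> (\<forall>v\<in>walls (Suc n) - {w}.
       wall_value v y \<noteq> y (Suc n) \<and> (wall_value v y < y (Suc n) \<longleftrightarrow> wall_value v x < x (Suc n)))"
    if x: "x \<in> cell n X S p" "w \<in> walls (Suc n)" "wall_value w x = x (Suc n)" for x w
  proof -
    obtain e where e: "e > 0" and ex: "\<And>t. t \<noteq> 0 \<Longrightarrow> \<bar>t\<bar> < e \<Longrightarrow>
      \<exists>\<kappa>\<in>cell n X S p. \<kappa> (Suc n) - wall_value w \<kappa> = t \<and>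
      (\<forall>v\<in>walls (Suc n) - {w}. wall_value v \<kappa> \<noteq> \<kappa> (Suc n) \<and>
         (wall_value v \<kappa> < \<kappa> (Suc n) \<longleftrightarrow> wall_value v x < x (Suc n)))"
      using perturb[OF x] by blast
    \<comment> \<open>The form of \<open>w\<close> equals the parameter, so a negative parameter
      within the radius lands below the wall.\<close>
    obtain \<kappa> where \<kappa>: "\<kappa> \<in> cell n X S p" "\<kappa> (Suc n) - wall_value w \<kappa> = - (e / 2)"
      "\<forall>v\<in>walls (Suc n) - {w}. wall_value v \<kappa> \<noteq> \<kappa> (Suc n) \<and>
         (wall_value v \<kappa> < \<kappa> (Suc n) \<longleftrightarrow> wall_value v x < x (Suc n))"
      using ex[of "- (e / 2)"] e by auto
    show ?thesis
      by (rule bexI[OF _ \<kappa>(1)], rule conjI[OF _ \<kappa>(3)]) (use \<kappa>(2) e in linarith)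
  qed
  show "\<exists>y\<in>cell n X S p. wall_value w y < y (Suc n) \<and> (\<forall>v\<in>walls (Suc n) - {w}.
       wall_value v y \<noteq> y (Suc n) \<and> (wall_value v y < y (Suc n) \<longleftrightarrow> wall_value v x < x (Suc n)))"
    if x: "x \<in> cell n X S p" "w \<in> walls (Suc n)" "wall_value w x = x (Suc n)" for x w
  proof -
    obtain e where e: "e > 0" and ex: "\<And>t. t \<noteq> 0 \<Longrightarrow> \<bar>t\<bar> < e \<Longrightarrow>
      \<exists>\<kappa>\<in>cell n X S p. \<kappa> (Suc n) - wall_value w \<kappa> = t \<and>
      (\<forall>v\<in>walls (Suc n) - {w}. wall_value v \<kappa> \<noteq> \<kappa> (Suc n) \<and>
         (wall_value v \<kappa> < \<kappa> (Suc n) \<longleftrightarrow> wall_value v x < x (Suc n)))"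
      using perturb[OF x] by blast
    obtain \<kappa> where \<kappa>: "\<kappa> \<in> cell n X S p" "\<kappa> (Suc n) - wall_value w \<kappa> = e / 2"
      "\<forall>v\<in>walls (Suc n) - {w}. wall_value v \<kappa> \<noteq> \<kappa> (Suc n) \<and>
         (wall_value v \<kappa> < \<kappa> (Suc n) \<longleftrightarrow> wall_value v x < x (Suc n))"
      using ex[of "e / 2"] e by auto
    show ?thesis
      by (rule bexI[OF _ \<kappa>(1)], rule conjI[OF _ \<kappa>(3)]) (use \<kappa>(2) e in linarith)
  qed
qed

section \<open>The recursion for the number of chambers met\<close>

lemma patterns_span_insert:
  assumes "subspace S"
  shows "patterns walls n X (span (insert (X (Suc n)) S)) = {p. cell n X S p \<noteq> {}}"
proof -
  have "p \<in> patterns walls n X (span (insert (X (Suc n)) S)) \<longleftrightarrow> cell n X S p \<noteq> {}" for p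
  proof
    assume "p \<in> patterns walls n X (span (insert (X (Suc n)) S))"
    then obtain \<mu> t where \<mu>: "generic walls n \<mu>" "p = pattern walls n \<mu>"
      "relation_mod (Suc n) X S (\<mu>(Suc n := t))"
      unfolding patterns_def relation_mod_span_insert[OF assms] by blast
    have "\<mu>(Suc n := t) \<in> cell n X S p"
      using \<mu> pattern_cong'[of n "\<mu>(Suc n := t)" \<mu>] by (simp add: cell_def)
    then show "cell n X S p \<noteq> {}" by blast
  next
    assume "cell n X S p \<noteq> {}"
    then obtain \<mu> where \<mu>: "generic walls n \<mu>" "relation_mod (Suc n) X S \<mu>" "pattern walls n \<mu> = p"
      unfolding cell_def by blast
    have "\<mu>(Suc n := \<mu> (Suc n)) = \<mu>" by simp
    then have "relation_mod n X (span (insert (X (Suc n)) S)) \<mu>"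
      using \<mu>(2) unfolding relation_mod_span_insert[OF assms] by metis
    then show "p \<in> patterns walls n X (span (insert (X (Suc n)) S))"
      using \<mu> unfolding patterns_def by blast
  qed
  then show ?thesis by blast
qed

text \<open>On \<open>w\<close> the last coordinate is a function of the earlier ones, so a point of
  the cell on this wall amounts to a relation of the merged columns with pattern
  \<open>p\<close>.\<close>

lemma patterns_merge:
  assumes w: "w \<in> walls (Suc n)"
  shows "patterns walls n (merge_vector w (Suc n) X) S
     = {p. \<exists>\<mu>\<in>cell n X S p. wall_value w \<mu> = \<mu> (Suc n)}"
proof -
  have "p \<in> patterns walls n (merge_vector w (Suc n) X) S
     \<longleftrightarrow> (\<exists>\<mu>\<in>cell n X S p. wall_value w \<mu> = \<mu> (Suc n))" for p
  proof
    assume "p \<in> patterns walls n (merge_vector w (Suc n) X) S"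
    then obtain \<mu> where \<mu>: "generic walls n \<mu>" "p = pattern walls n \<mu>"
      "relation_mod (Suc n) X S (\<mu>(Suc n := wall_value w \<mu>))"
      unfolding patterns_def relation_mod_merge_wall[OF w] by blast
    define \<mu>' where "\<mu>' = \<mu>(Suc n := wall_value w \<mu>)"
    have "wall_value w \<mu>' = \<mu>' (Suc n)"
      using snd_wall[OF w] by (simp add: \<mu>'_def wall_value_def)
    moreover have "\<mu>' \<in> cell n X S p"
      using \<mu> pattern_cong'[of n \<mu>' \<mu>] by (simp add: cell_def \<mu>'_def)
    ultimately show "\<exists>\<mu>\<in>cell n X S p. wall_value w \<mu> = \<mu> (Suc n)" by blast
  next
    assume "\<exists>\<mu>\<in>cell n X S p. wall_value w \<mu> = \<mu> (Suc n)"
    then obtain \<mu> where \<mu>: "generic walls n \<mu>" "relation_mod (Suc n) X S \<mu>" "pattern walls n \<mu> = p"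
      and hit: "wall_value w \<mu> = \<mu> (Suc n)"
      unfolding cell_def by blast
    have "\<mu>(Suc n := wall_value w \<mu>) = \<mu>" using hit by simp
    then show "p \<in> patterns walls n (merge_vector w (Suc n) X) S"
      using \<mu> unfolding patterns_def relation_mod_merge_wall[OF w] by auto
  qed
  then show ?thesis by blast
qed

text \<open>A pattern on \<open>n + 1\<close> coordinates is a cell together with a cut of it. The
  number of cuts is one plus the number of walls met; summing over the cells and exchanging the sums
  counts, for each wall, the cells that it meets.\<close>

lemma card_patterns_Suc:
  assumes S: "subspace S"
    and transversal: "\<And>w. w \<in> walls (Suc n) \<Longrightarrow>
      \<exists>\<nu>. relation_mod (Suc n) X S \<nu> \<and> \<nu> (Suc n) - wall_value w \<nu> = 1"
  shows "card (patterns walls (Suc n) X S) =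
     card (patterns walls n X (span (insert (X (Suc n)) S)))
     + (\<Sum>w\<in>walls (Suc n). card (patterns walls n (merge_vector w (Suc n) X) S))"
proof -
  define P where "P = patterns walls n X (span (insert (X (Suc n)) S))"
  define cuts where "cuts p = (\<lambda>\<mu>. {w \<in> walls (Suc n). wall_value w \<mu> < \<mu> (Suc n)}) `
            {\<mu> \<in> cell n X S p. \<forall>w\<in>walls (Suc n). wall_value w \<mu> \<noteq> \<mu> (Suc n)}" for p
  have P: "P = {p. cell n X S p \<noteq> {}}"
    unfolding P_def by (rule patterns_span_insert[OF S])
  have finP: "finite P" unfolding P_def by (rule finite_patterns)
  have finc: "finite (cuts p)" for p
    by (rule finite_subset[of _ "Pow (walls (Suc n))"]) (auto simp: cuts_def finite_walls)
  have P_sub: "p \<subseteq> {1..n} \<times> UNIV" if "p \<in> P" for p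
    using that pattern_subset[of walls n] unfolding P_def patterns_def by blast
  have "patterns walls (Suc n) X S = (\<lambda>(p, c). p \<union> {Suc n} \<times> c) ` (SIGMA p:P. cuts p)" (is "?l = ?r")
  proof
    show "?l \<subseteq> ?r"
    proof
      fix q assume "q \<in> ?l"
      then obtain \<mu> where \<mu>: "generic walls (Suc n) \<mu>" "relation_mod (Suc n) X S \<mu>" "q = pattern walls (Suc n) \<mu>"
        unfolding patterns_def by blast
      have "\<mu> \<in> cell n X S (pattern walls n \<mu>)"
        using \<mu> by (simp add: cell_def generic_Suc)
      moreover from this have "{w \<in> walls (Suc n). wall_value w \<mu> < \<mu> (Suc n)} \<in> cuts (pattern walls n \<mu>)"
        using \<mu>(1) unfolding cuts_def generic_Suc by blast
      ultimately show "q \<in> ?r"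
        unfolding \<mu>(3) pattern_Suc P by (intro image_eqI[where x = "(_, _)"]) auto
    qed
    show "?r \<subseteq> ?l"
    proof clarify
      fix p c assume "c \<in> cuts p"
      then obtain \<mu> where \<mu>: "\<mu> \<in> cell n X S p" "\<forall>w\<in>walls (Suc n). wall_value w \<mu> \<noteq> \<mu> (Suc n)"
        "c = {w \<in> walls (Suc n). wall_value w \<mu> < \<mu> (Suc n)}"
        unfolding cuts_def by blast
      then have "p \<union> {Suc n} \<times> c = pattern walls (Suc n) \<mu>"
        by (simp add: pattern_Suc cell_def)
      moreover have "generic walls (Suc n) \<mu>" "relation_mod (Suc n) X S \<mu>"
        using \<mu> by (auto simp: generic_Suc cell_def)
      ultimately show "p \<union> {Suc n} \<times> c \<in> patterns walls (Suc n) X S"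
        unfolding patterns_def by blast
    qed
  qed
  moreover have "inj_on (\<lambda>(p, c). p \<union> {Suc n} \<times> c) (SIGMA p:P. cuts p)"
  proof (rule inj_onI, clarify)
    fix p c p' c' assume *: "p \<in> P" "p' \<in> P" and eq: "p \<union> {Suc n} \<times> c = p' \<union> {Suc n} \<times> c'"
    \<comment> \<open>The first component tells old walls from new ones, so \<open>p\<close> and
      \<open>c\<close> can be read off the union.\<close>
    have "p = (p \<union> {Suc n} \<times> c) \<inter> {1..n} \<times> UNIV" "p' = (p' \<union> {Suc n} \<times> c') \<inter> {1..n} \<times> UNIV"
      using P_sub[OF *(1)] P_sub[OF *(2)] by auto
    moreover have "c = {w. (Suc n, w) \<in> p \<union> {Suc n} \<times> c}" "c' = {w. (Suc n, w) \<in> p' \<union> {Suc n} \<times> c'}"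
      using P_sub[OF *(1)] P_sub[OF *(2)] by auto
    ultimately show "p = p' \<and> c = c'" unfolding eq by metis
  qed
  ultimately have "card (patterns walls (Suc n) X S) = (\<Sum>p\<in>P. card (cuts p))"
    using finP finc by (simp add: card_image)
  also have "\<dots> = (\<Sum>p\<in>P. 1 + card {w \<in> walls (Suc n). \<exists>\<mu>\<in>cell n X S p. wall_value w \<mu> = \<mu> (Suc n)})"
    unfolding cuts_def by (intro sum.cong refl card_cell_cuts[OF S _ transversal]) (auto simp: P)
  also have "\<dots> = card P + (\<Sum>p\<in>P. card {w \<in> walls (Suc n). \<exists>\<mu>\<in>cell n X S p. wall_value w \<mu> = \<mu> (Suc n)})"
    by (subst sum.distrib) simp
  also have "(\<Sum>p\<in>P. card {w \<in> walls (Suc n). \<exists>\<mu>\<in>cell n X S p. wall_value w \<mu> = \<mu> (Suc n)})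
      = (\<Sum>w\<in>walls (Suc n). card {p \<in> P. \<exists>\<mu>\<in>cell n X S p. wall_value w \<mu> = \<mu> (Suc n)})"
    using sum.swap_restrict[where g = "\<lambda>_ _. 1 :: nat"
        and R = "\<lambda>p w. \<exists>\<mu>\<in>cell n X S p. wall_value w \<mu> = \<mu> (Suc n)", OF finP finite_walls[of "Suc n"]]
    by simp
  also have "\<dots> = (\<Sum>w\<in>walls (Suc n). card (patterns walls n (merge_vector w (Suc n) X) S))"
  proof (intro sum.cong refl arg_cong[where f = card])
    fix w assume w: "w \<in> walls (Suc n)"
    show "{p \<in> P. \<exists>\<mu>\<in>cell n X S p. wall_value w \<mu> = \<mu> (Suc n)}
      = patterns walls n (merge_vector w (Suc n) X) S"
      unfolding P patterns_merge[OF w] by blast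
  qed
  finally show ?thesis by (simp add: P_def)
qed

text \<open>\<open>d\<close>, \<open>X\<close> and \<open>S\<close> vary in the induction because
  both reductions replace them. The factor for \<open>m = b + 1\<close> occurs in the product but
  not in the tail: with one essential coordinate all chambers are met for \<open>d = 0\<close> and
  none for \<open>d = 1\<close>.\<close>

theorem card_patterns:
  fixes X :: "nat \<Rightarrow> 'v::euclidean_space"
  assumes "subspace S" "dim S + d = DIM('v)" "regular_mod deg n d X S" "b \<le> n" "d \<le> n - b"
  shows "real (card (patterns walls n X S)) = (\<Prod>m = b + 1..n. real (card (walls m) + 1))
     * bernoulli_tail (\<lambda>m. 1 / real (card (walls m) + 1)) (b + 2) (n - (b + 1)) d"
  using \<open>b \<le> n\<close> assms(1-3,5)
proof (induction n arbitrary: d X S rule: dec_induct)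
  case base
  have "pattern walls b \<mu> = {}" "generic walls b \<mu>" for \<mu>
    using walls_le by (auto simp: pattern_def generic_def)
  moreover have "relation_mod b X S (\<lambda>_. 0)"
    using base by (simp add: relation_mod_def subspace_0)
  ultimately have "patterns walls b X S = {{}}"
    unfolding patterns_def by auto
  then show ?case using base by simp
next
  case (step n)
  let ?T = "\<lambda>m. real (card (walls m) + 1)"
  let ?t = "\<lambda>d. bernoulli_tail (\<lambda>m. 1 / ?T m) (b + 2) (n - (b + 1)) d"
  let ?S = "span (insert (X (Suc n)) S)"
  show ?case
  proof (cases "d = Suc n - b")
    case True
    \<comment> \<open>The degree bound in regularity is now the full essential dimension, so it
      covers every relation and leaves none generic.\<close>
    have "deg (Suc n) \<mu> = 0" if "relation_mod (Suc n) X S \<mu>" for \<mu>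
      using step.prems that deg_le[of "Suc n" \<mu>] step.hyps True by (simp add: regular_mod_def)
    then have "patterns walls (Suc n) X S = {}"
      using deg_generic step.hyps unfolding patterns_def by fastforce
    moreover have "bernoulli_tail (\<lambda>m. 1 / ?T m) (b + 2) (Suc n - (b + 1)) d = 0"
      by (rule tail_eq_0) (use True step.hyps in auto)
    ultimately show ?thesis by simp
  next
    case False
    then have d: "d \<le> n - b" using step by auto
    have reg: "regular_mod deg n d (merge_vector w (Suc n) X) S" if "w \<in> walls (Suc n)" for w
      using step.prems that by (intro regular_mod_merge) auto
    have dim: "dim ?S + (d - 1) = DIM('v) \<and> regular_mod deg n (d - 1) X ?S"
    proof (cases "d = 0")
      case True
      \<comment> \<open>\<open>S\<close> is already the whole space, and the truncated
        \<open>d - 1\<close> is again 0, in step with \<open>bernoulli_tail\<close>.\<close>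
      then have "S = UNIV"
        using step.prems dim_eq_full[of S] span_eq_iff[of S] by simp
      then have "?S = UNIV" "S = UNIV" by auto
      moreover have "relation_mod (Suc n) X UNIV (\<mu>)" "relation_mod n X UNIV \<mu>" for \<mu>
        by (auto simp: relation_mod_def)
      moreover have "deg n \<mu> = 0" if "deg n \<mu> \<le> 0" for \<mu>
        using that by simp
      ultimately show ?thesis using True step.prems by (simp add: regular_mod_def)
    next
      case False
      then show ?thesis
        using dim_span_insert[of n d X S] regular_mod_span_insert[of n d X S] step by auto
    qed
    have transversal: "\<exists>\<nu>. relation_mod (Suc n) X S \<nu> \<and> \<nu> (Suc n) - wall_value w \<nu> = 1"
      if w: "w \<in> walls (Suc n)" for w
    proof -
      obtain a where a: "X (Suc n) - (\<Sum>i = 1..n. a i *\<^sub>R merge_vector w (Suc n) X i) \<in> S"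
        using regular_mod_spans[OF reg[OF w]] step d by blast
      \<comment> \<open>The last coefficient gives the form of \<open>w\<close> the value 1; the
        correction \<open>wall_value w a\<close> is the share of the last column contained in the
        merged column.\<close>
      define \<nu> where "\<nu> = (\<lambda>i. - a i)(Suc n := 1 - wall_value w a)"
      have "(\<Sum>i = 1..n. \<nu> i *\<^sub>R X i) = - (\<Sum>i = 1..n. a i *\<^sub>R X i)"
        unfolding sum_negf[symmetric] by (intro sum.cong) (auto simp: \<nu>_def)
      then have "(\<Sum>i = 1..Suc n. \<nu> i *\<^sub>R X i)
          = X (Suc n) - (\<Sum>i = 1..n. a i *\<^sub>R merge_vector w (Suc n) X i)"
        using sum_merge[of w n a X] snd_wall[OF w] fst_wall[OF w]
        by (simp add: \<nu>_def algebra_simps)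
      then have "relation_mod (Suc n) X S \<nu>"
        using a by (simp add: relation_mod_def)
      moreover have "\<nu> (Suc n) - wall_value w \<nu> = 1"
        using snd_wall[OF w] by (simp add: \<nu>_def wall_value_def)
      ultimately show ?thesis by blast
    qed
    let ?Q = "\<Prod>m = b + 1..n. ?T m"
    have "real (card (patterns walls (Suc n) X S)) = real (card (patterns walls n X ?S))
       + (\<Sum>w\<in>walls (Suc n). real (card (patterns walls n (merge_vector w (Suc n) X) S)))"
      using card_patterns_Suc[OF \<open>subspace S\<close> transversal] by simp
    also have "real (card (patterns walls n X ?S)) = ?Q * ?t (d - 1)"
      by (rule step.IH) (use dim d in \<open>auto simp: subspace_span\<close>)
    also have "(\<Sum>w\<in>walls (Suc n). real (card (patterns walls n (merge_vector w (Suc n) X) S)))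
        = (\<Sum>w\<in>walls (Suc n). ?Q * ?t d)"
      by (intro sum.cong refl step.IH) (use step.prems reg d in auto)
    also have "?Q * ?t (d - 1) + (\<Sum>w\<in>walls (Suc n). ?Q * ?t d) = ?Q * ?T (Suc n) *
        ((1 - 1 / ?T (Suc n)) * ?t d + 1 / ?T (Suc n) * ?t (d - 1))"
    proof -
      have "q * y + (u - 1) * (q * x) = q * u * ((1 - 1 / u) * x + 1 / u * y)"
        if "u \<noteq> 0" for q u x y :: real
        using that by (simp add: field_simps)
      from this[of "?T (Suc n)"] show ?thesis by simp
    qed
    also have "(1 - 1 / ?T (Suc n)) * ?t d + 1 / ?T (Suc n) * ?t (d - 1)
        = bernoulli_tail (\<lambda>m. 1 / ?T m) (b + 2) (Suc n - (b + 1)) d"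
    proof (cases "n = b")
      case True
      \<comment> \<open>In the first step both tails are empty, and \<open>d = 0\<close> makes the
        two weights add up to 1.\<close>
      then have "d = 0" using d by simp
      then show ?thesis using True by (simp add: field_simps)
    next
      case False
      then have k: "Suc n - (b + 1) = Suc (n - (b + 1))" "b + 2 + (n - (b + 1)) = Suc n"
        using step.hyps by auto
      show ?thesis unfolding k(1) bernoulli_tail.simps k(2) ..
    qed
    also have "?Q * ?T (Suc n) = (\<Prod>m = b + 1..Suc n. ?T m)"
      using step.hyps by simp
    finally show ?thesis .
  qed
qed

end

section \<open>Convex hulls, sorting and chambers\<close>

text \<open>Independence is wanted for families, in which a repeated vector is a dependence. The
  coefficient form can be rescaled and padded with zeros directly on indices.\<close>

lemma independent_family_iff:
  fixes v :: "nat \<Rightarrow> 'v::real_vector"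
  assumes fin: "finite J"
  shows "inj_on v J \<and> independent (v ` J) \<longleftrightarrow>
    (\<forall>a. (\<Sum>k\<in>J. a k *\<^sub>R v k) = 0 \<longrightarrow> (\<forall>k\<in>J. a k = 0))" (is "?l \<longleftrightarrow> ?r")
proof
  assume l: ?l
  show ?r
  proof (intro allI impI ballI)
    fix a k assume zero: "(\<Sum>k\<in>J. a k *\<^sub>R v k) = 0" and k: "k \<in> J"
    have "(\<Sum>x\<in>v ` J. a (inv_into J v x) *\<^sub>R x) = 0"
      using l zero by (simp add: sum.reindex)
    then have "a (inv_into J v (v k)) = 0"
      using independentD[of "v ` J" "v ` J" "\<lambda>x. a (inv_into J v x)" "v k"] l fin k by auto
    then show "a k = 0" using l k by simp
  qed
next
  assume r: ?r
  have inj: "inj_on v J"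
  proof (rule inj_onI, rule ccontr)
    fix i j assume ij: "i \<in> J" "j \<in> J" "v i = v j" "i \<noteq> j"
    have "(\<Sum>k\<in>J. (of_bool (k = i) - of_bool (k = j)) *\<^sub>R v k) = v i - v j"
      using fin ij by (simp add: scaleR_diff_left sum_subtractf if_distrib[of "\<lambda>c. c *\<^sub>R _"] of_bool_def
          cong: if_cong)
    then have "(\<Sum>k\<in>J. (of_bool (k = i) - of_bool (k = j)) *\<^sub>R v k) = 0"
      using ij(3) by simp
    then have "of_bool (i = i) - of_bool (i = j) = (0 :: real)"
      using r[rule_format, of "\<lambda>k. of_bool (k = i) - of_bool (k = j)" i] ij(1) by blast
    then show False using ij(4) by simp
  qed
  moreover have "independent (v ` J)"
  proof (subst dependent_finite, simp add: fin, safe)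
    fix u k assume "(\<Sum>x\<in>v ` J. u x *\<^sub>R x) = 0" "k \<in> J" "u (v k) \<noteq> 0"
    then show False using r inj by (auto simp: sum.reindex)
  qed
  ultimately show ?l ..
qed

text \<open>The support is enlarged to exactly \<open>CARD('d)\<close> indices, the size that
  \<open>general_position\<close> speaks about.\<close>

lemma general_position_zero:
  fixes v :: "nat \<Rightarrow> real ^ 'd"
  assumes gp: "general_position n v" and n: "CARD('d) \<le> n"
    and few: "card {k \<in> {1..n}. a k \<noteq> 0} \<le> CARD('d)"
    and zero: "(\<Sum>k = 1..n. a k *\<^sub>R v k) = 0" and k: "k \<in> {1..n}"
  shows "a k = 0"
proof (rule ccontr)
  assume ak: "a k \<noteq> 0"
  have "\<exists>J. {k \<in> {1..n}. a k \<noteq> 0} \<subseteq> J \<and> J \<subseteq> {1..n} \<and> card J = CARD('d)"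
    by (rule exists_subset_between[OF few]) (use n in auto)
  then obtain J where J: "{k \<in> {1..n}. a k \<noteq> 0} \<subseteq> J" "J \<subseteq> {1..n}" "card J = CARD('d)"
    by blast
  have fin: "finite J" using J(2) finite_subset by blast
  have "(\<Sum>k\<in>J. a k *\<^sub>R v k) = (\<Sum>k = 1..n. a k *\<^sub>R v k)"
    by (rule sum.mono_neutral_left) (use J in auto)
  then have "(\<Sum>k\<in>J. a k *\<^sub>R v k) = 0" using zero by simp
  moreover have "inj_on v J \<and> independent (v ` J)"
    using gp J by (simp add: general_position_def)
  ultimately have "\<forall>k\<in>J. a k = 0"
    using independent_family_iff[OF fin, of v] by blast
  then show False using J(1) k ak by blast
qed

text \<open>Different indices may carry the same vector: the weights go to one representative of
  each value, the other indices get weight zero.\<close>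

lemma convex_hull_image_index:
  assumes "x \<in> convex hull (v ` I)" "finite I"
  obtains a :: "'i \<Rightarrow> real" where "\<And>i. i \<in> I \<Longrightarrow> 0 \<le> a i" "sum a I = 1" "(\<Sum>i\<in>I. a i *\<^sub>R v i) = x"
proof -
  obtain R where R: "R \<subseteq> I" "inj_on v R" "v ` I = v ` R"
    by (metis subset_image_inj order_refl)
  have "finite R" using R assms finite_subset by blast
  then obtain u where u: "\<forall>y\<in>v ` R. 0 \<le> u y" "sum u (v ` R) = 1" "(\<Sum>y\<in>v ` R. u y *\<^sub>R y) = x"
    using assms R convex_hull_finite[of "v ` R"] by auto
  define a where "a i = (if i \<in> R then u (v i) else 0)" for i
  show thesis
  proof
    show "0 \<le> a i" for i using u by (simp add: a_def)
    have "sum a I = (\<Sum>i\<in>R. u (v i))"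
      by (rule sum.mono_neutral_cong_right) (use R assms in \<open>auto simp: a_def\<close>)
    then show "sum a I = 1" using u(2) R(2) by (simp add: sum.reindex)
    have "(\<Sum>i\<in>I. a i *\<^sub>R v i) = (\<Sum>i\<in>R. u (v i) *\<^sub>R v i)"
      by (rule sum.mono_neutral_cong_right) (use R assms in \<open>auto simp: a_def\<close>)
    then show "(\<Sum>i\<in>I. a i *\<^sub>R v i) = x" using u(3) R(2) by (simp add: sum.reindex)
  qed
qed

text \<open>Turns absorption into an open condition on the coefficients. By general position a
  nonnegative relation has more than \<open>CARD('d)\<close> positive coefficients, so some of its
  active vectors span the space. They balance the inactive ones, and a small multiple of that
  relation makes all coefficients positive.\<close>

lemma zero_in_hull_iff:
  fixes v :: "nat \<Rightarrow> real ^ 'd"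
  assumes gp: "general_position n v" and n: "CARD('d) + 1 \<le> n"
  shows "0 \<in> convex hull (v ` {1..n}) \<longleftrightarrow>
    (\<exists>a. (\<forall>k\<in>{1..n}. 0 < a k) \<and> (\<Sum>k = 1..n. a k *\<^sub>R v k) = 0)"
proof
  assume "0 \<in> convex hull (v ` {1..n})"
  then obtain a where a: "\<And>k. k \<in> {1..n} \<Longrightarrow> 0 \<le> a k" "sum a {1..n} = 1"
    "(\<Sum>k = 1..n. a k *\<^sub>R v k) = 0"
    by (rule convex_hull_image_index) auto
  define Z where "Z = {k \<in> {1..n}. a k \<noteq> 0}"
  have "CARD('d) < card Z"
  proof (rule ccontr)
    assume "\<not> CARD('d) < card Z"
    then have "a k = 0" if "k \<in> {1..n}" for k
      using general_position_zero[OF gp _ _ a(3) that] n by (simp add: Z_def)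
    then show False using a(2) by simp
  qed
  then obtain J where J: "J \<subseteq> Z" "card J = CARD('d)"
    by (meson nat_less_le obtain_subset_with_card_n)
  have JZ: "J \<subseteq> {1..n}" using J by (auto simp: Z_def)
  have finJ: "finite J" by (rule finite_subset[OF JZ]) simp
  have inj: "inj_on v J" and ind: "independent (v ` J)"
    using gp J JZ by (auto simp: general_position_def)
  have "card (v ` J) = DIM(real ^ 'd)"
    using inj J by (simp add: card_image)
  then have "span (v ` J) = UNIV"
    using card_ge_dim_independent[of "v ` J" UNIV] ind by auto
  then have "- (\<Sum>j\<in>{1..n} - Z. v j) \<in> span (v ` J)" by simp
  then obtain u where u: "(\<Sum>x\<in>v ` J. u x *\<^sub>R x) = - (\<Sum>j\<in>{1..n} - Z. v j)"
    using span_finite[of "v ` J"] finJ by auto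
  \<comment> \<open>A relation with coefficient 1 off the support of \<open>a\<close>; the
    coefficients on \<open>J\<close> compensate.\<close>
  define c where "c k = (if k \<in> Z then (if k \<in> J then u (v k) else 0) else 1)" for k
  have "(\<Sum>k = 1..n. c k *\<^sub>R v k) = (\<Sum>k\<in>{1..n} - Z. c k *\<^sub>R v k) + (\<Sum>k\<in>Z. c k *\<^sub>R v k)"
    by (rule sum.subset_diff) (auto simp: Z_def)
  also have "(\<Sum>k\<in>{1..n} - Z. c k *\<^sub>R v k) = (\<Sum>j\<in>{1..n} - Z. v j)"
    by (rule sum.cong) (auto simp: c_def)
  also have "(\<Sum>k\<in>Z. c k *\<^sub>R v k) = (\<Sum>k\<in>J. u (v k) *\<^sub>R v k)"
    by (rule sum.mono_neutral_cong_right) (use J in \<open>auto simp: c_def Z_def\<close>)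
  also have "\<dots> = - (\<Sum>j\<in>{1..n} - Z. v j)"
    using u inj by (simp add: sum.reindex)
  finally have c: "(\<Sum>k = 1..n. c k *\<^sub>R v k) = 0" by simp
  \<comment> \<open>On the support \<open>c\<close> may be negative, but finitely many positive
    coefficients survive a small multiple of it.\<close>
  have "\<forall>\<^sub>F e in at_right 0. \<forall>k\<in>Z. 0 < a k + e * c k"
  proof (rule eventually_ball_finite)
    show "\<forall>k\<in>Z. \<forall>\<^sub>F e in at_right 0. 0 < a k + e * c k"
    proof
      fix k assume "k \<in> Z"
      then have "0 < a k" using a(1)[of k] by (auto simp: Z_def less_le)
      moreover have "((\<lambda>e. a k + e * c k) \<longlongrightarrow> a k) (at_right 0)"
        by (auto intro!: tendsto_eq_intros)
      ultimately show "\<forall>\<^sub>F e in at_right 0. 0 < a k + e * c k"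
        by (rule order_tendstoD(1)[rotated])
    qed
  qed (simp add: Z_def)
  moreover have "\<forall>\<^sub>F e in at_right 0. (0::real) < e"
    by (rule eventually_at_right_less)
  ultimately have "\<forall>\<^sub>F e in at_right 0. 0 < e \<and> (\<forall>k\<in>Z. 0 < a k + e * c k)"
    by eventually_elim auto
  then obtain e where e: "0 < e" "\<forall>k\<in>Z. 0 < a k + e * c k"
    using eventually_happens[of _ "at_right (0::real)"] trivial_limit_at_right_real by blast
  have "(\<Sum>k = 1..n. (a k + e * c k) *\<^sub>R v k) = (\<Sum>k = 1..n. a k *\<^sub>R v k) + e *\<^sub>R (\<Sum>k = 1..n. c k *\<^sub>R v k)"
    by (simp add: scaleR_add_left sum.distrib scaleR_sum_right)
  then have "(\<Sum>k = 1..n. (a k + e * c k) *\<^sub>R v k) = 0"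
    using a(3) c by simp
  moreover have "0 < a k + e * c k" if "k \<in> {1..n}" for k
    using e that a(1)[OF that] by (cases "k \<in> Z") (auto simp: c_def)
  ultimately show "\<exists>a. (\<forall>k\<in>{1..n}. 0 < a k) \<and> (\<Sum>k = 1..n. a k *\<^sub>R v k) = 0"
    by (intro exI[of _ "\<lambda>k. a k + e * c k"]) simp
next
  assume "\<exists>a. (\<forall>k\<in>{1..n}. 0 < a k) \<and> (\<Sum>k = 1..n. a k *\<^sub>R v k) = 0"
  then obtain a where a: "\<And>k. k \<in> {1..n} \<Longrightarrow> 0 < a k" "(\<Sum>k = 1..n. a k *\<^sub>R v k) = 0" by blast
  define A where "A = sum a {1..n}"
  have "0 < A" unfolding A_def using a n by (intro sum_pos) auto
  have "(\<Sum>k = 1..n. (a k / A) *\<^sub>R v k) \<in> convex hull (v ` {1..n})"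
  proof (rule convex_sum)
    show "(\<Sum>k = 1..n. a k / A) = 1"
      using \<open>0 < A\<close> by (simp add: A_def flip: sum_divide_distrib)
    show "0 \<le> a k / A" if "k \<in> {1..n}" for k
      using a(1)[OF that] \<open>0 < A\<close> by simp
  qed (auto intro: hull_inc)
  also have "(\<Sum>k = 1..n. (a k / A) *\<^sub>R v k) = (1 / A) *\<^sub>R (\<Sum>k = 1..n. a k *\<^sub>R v k)"
    by (simp add: scaleR_sum_right)
  finally show "0 \<in> convex hull (v ` {1..n})" using a(2) by simp
qed

text \<open>Positive weights on partial sums are the gaps of a decreasing sequence of weights on the
  steps. The boundary term disappears for the walk by \<open>a (Suc n) = 0\<close>, for the bridge
  because the columns sum to zero.\<close>

lemma summation_by_parts_partial_sum:
  "(\<Sum>k = 1..n. (a k - a (Suc k)) *\<^sub>R partial_sum y k)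
     = (\<Sum>i = 1..n. a i *\<^sub>R y i) - a (Suc n) *\<^sub>R partial_sum y n"
  by (induction n) (auto simp: partial_sum_def algebra_simps)

section \<open>Sorting permutations and the chambers that they index\<close>

lemma ex_sorting_permutation:
  fixes f :: "nat \<Rightarrow> 'b::linorder"
  shows "\<exists>\<sigma>. \<sigma> permutes {1..n} \<and> (\<forall>k\<in>{1..n}. \<forall>l\<in>{1..n}. k \<le> l \<longrightarrow> f (\<sigma> l) \<le> f (\<sigma> k))"
proof (induction n arbitrary: f)
  case 0
  then show ?case by (intro exI[of _ id]) auto
next
  case (Suc n)
  \<comment> \<open>Selection sort: a minimum is swapped to the last position, and the induction
    hypothesis sorts the rest.\<close>
  obtain m where m: "m \<in> {1..Suc n}" "\<And>i. i \<in> {1..Suc n} \<Longrightarrow> f m \<le> f i"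
    using ex_is_arg_min_if_finite[of "{1..Suc n}" f] unfolding is_arg_min_linorder by auto
  define t where "t = Transposition.transpose m (Suc n)"
  have t: "t permutes {1..Suc n}"
    unfolding t_def using m by (intro permutes_swap_id) auto
  obtain \<sigma> where \<sigma>: "\<sigma> permutes {1..n}"
    "\<And>k l. \<lbrakk>k \<in> {1..n}; l \<in> {1..n}; k \<le> l\<rbrakk> \<Longrightarrow> f (t (\<sigma> l)) \<le> f (t (\<sigma> k))"
    using Suc[of "f \<circ> t"] by auto
  have \<sigma>': "\<sigma> permutes {1..Suc n}"
    using \<sigma>(1) by (rule permutes_subset) auto
  have "f ((t \<circ> \<sigma>) l) \<le> f ((t \<circ> \<sigma>) k)" if "k \<in> {1..Suc n}" "l \<in> {1..Suc n}" "k \<le> l" for k l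
  proof (cases "l = Suc n")
    case True
    have "(t \<circ> \<sigma>) l = m"
      using True permutes_not_in[OF \<sigma>(1), of "Suc n"] by (simp add: t_def)
    moreover have "(t \<circ> \<sigma>) k \<in> {1..Suc n}"
      using permutes_in_image[OF permutes_compose[OF \<sigma>' t]] that by blast
    ultimately show ?thesis using m by simp
  next
    case False
    then show ?thesis using \<sigma>(2)[of k l] that by simp
  qed
  then show ?case using permutes_compose[OF \<sigma>' t] by blast
qed

text \<open>Recovers the position of an index from the order of the values alone; uniqueness of the
  sorting permutation follows from this.\<close>

lemma sorting_permutation_rank:
  fixes f :: "nat \<Rightarrow> 'b::linorder"
  assumes \<sigma>: "\<sigma> permutes {1..n}" and dec: "\<And>k l. \<lbrakk>k \<in> {1..n}; l \<in> {1..n}; k < l\<rbrakk> \<Longrightarrow> f (\<sigma> l) < f (\<sigma> k)"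
    and k: "k \<in> {1..n}"
  shows "card {j \<in> {1..n}. f (\<sigma> k) \<le> f j} = k"
proof -
  have "{j \<in> {1..n}. f (\<sigma> k) \<le> f j} = \<sigma> ` {1..k}"
  proof (intro set_eqI iffI)
    fix j assume j: "j \<in> {j \<in> {1..n}. f (\<sigma> k) \<le> f j}"
    then have "j \<in> \<sigma> ` {1..n}" using permutes_image[OF \<sigma>] by simp
    then obtain l where l: "l \<in> {1..n}" "j = \<sigma> l" by blast
    then have "\<not> k < l" using dec[OF k, of l] j by auto
    then show "j \<in> \<sigma> ` {1..k}" using l by auto
  next
    fix j assume "j \<in> \<sigma> ` {1..k}"
    then obtain l where l: "l \<in> {1..n}" "l \<le> k" "j = \<sigma> l" using k by auto
    then have "f (\<sigma> k) \<le> f (\<sigma> l)" using dec[OF l(1) k] by (cases "l = k") auto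
    then show "j \<in> {j \<in> {1..n}. f (\<sigma> k) \<le> f j}"
      using l permutes_in_image[OF \<sigma>, of l] by auto
  qed
  then show ?thesis
    using card_image[OF permutes_inj_on[OF \<sigma>], of "{1..k}"] by simp
qed

lemma sorting_permutation_unique:
  fixes f :: "nat \<Rightarrow> 'b::linorder" and g :: "nat \<Rightarrow> 'c::linorder"
  assumes \<sigma>: "\<sigma> permutes {1..n}" and \<tau>: "\<tau> permutes {1..n}"
    and f: "\<And>k l. \<lbrakk>k \<in> {1..n}; l \<in> {1..n}; k < l\<rbrakk> \<Longrightarrow> f (\<sigma> l) < f (\<sigma> k)"
    and g: "\<And>k l. \<lbrakk>k \<in> {1..n}; l \<in> {1..n}; k < l\<rbrakk> \<Longrightarrow> g (\<tau> l) < g (\<tau> k)"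
    and same: "\<And>i j. \<lbrakk>i \<in> {1..n}; j \<in> {1..n}\<rbrakk> \<Longrightarrow> f i < f j \<longleftrightarrow> g i < g j"
  shows "\<sigma> = \<tau>"
proof
  fix k
  show "\<sigma> k = \<tau> k"
  proof (cases "k \<in> {1..n}")
    case True
    then obtain l where l: "l \<in> {1..n}" "\<sigma> k = \<tau> l"
      using permutes_image[OF \<tau>] permutes_in_image[OF \<sigma>, of k] by (metis imageE)
    have "{j \<in> {1..n}. f (\<sigma> k) \<le> f j} = {j \<in> {1..n}. g (\<tau> l) \<le> g j}"
      using same[of _ "\<tau> l"] permutes_in_image[OF \<tau>, of l] l by (auto simp: not_less[symmetric])
    then have "k = l"
      using sorting_permutation_rank[of \<sigma> n f k, OF \<sigma> f True]
        sorting_permutation_rank[of \<tau> n g l, OF \<tau> g l(1)] by simp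
    then show ?thesis using l by simp
  next
    case False
    then show ?thesis using permutes_not_in[OF \<sigma>] permutes_not_in[OF \<tau>] by simp
  qed
qed

text \<open>The chambers \<open>Ch g\<close> partition the generic vectors, and patterns distinguish
  them. Any relation chosen in a chamber therefore has the pattern of that chamber, and the choice
  \<open>pick\<close> does not affect the bijection.\<close>

lemma card_hit_chambers:
  assumes gen: "\<And>g \<mu>. \<lbrakk>g \<in> G; \<mu> \<in> Ch g\<rbrakk> \<Longrightarrow> generic walls n \<mu>"
    and cover: "\<And>\<mu>. generic walls n \<mu> \<Longrightarrow> \<exists>g\<in>G. \<mu> \<in> Ch g"
    and same: "\<And>g h \<mu> \<nu>. \<lbrakk>g \<in> G; h \<in> G; \<mu> \<in> Ch g; \<nu> \<in> Ch h\<rbrakk>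
        \<Longrightarrow> pattern walls n \<mu> = pattern walls n \<nu> \<longleftrightarrow> g = h"
  shows "card {g \<in> G. \<exists>\<mu>\<in>Ch g. relation_mod n X S \<mu>} = card (patterns walls n X S)"
proof -
  define H where "H = {g \<in> G. \<exists>\<mu>\<in>Ch g. relation_mod n X S \<mu>}"
  define pick where "pick g = (SOME \<mu>. \<mu> \<in> Ch g \<and> relation_mod n X S \<mu>)" for g
  have pick: "pick g \<in> Ch g" "relation_mod n X S (pick g)" if "g \<in> H" for g
    using that someI_ex[of "\<lambda>\<mu>. \<mu> \<in> Ch g \<and> relation_mod n X S \<mu>"]
    unfolding H_def pick_def by blast+
  have HG: "g \<in> G" if "g \<in> H" for g using that by (simp add: H_def)
  have "bij_betw (\<lambda>g. pattern walls n (pick g)) H (patterns walls n X S)"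
    unfolding bij_betw_def
  proof
    show "inj_on (\<lambda>g. pattern walls n (pick g)) H"
      using same HG pick(1) by (intro inj_onI) blast
    show "(\<lambda>g. pattern walls n (pick g)) ` H = patterns walls n X S"
    proof
      show "(\<lambda>g. pattern walls n (pick g)) ` H \<subseteq> patterns walls n X S"
        using gen HG pick unfolding patterns_def by blast
      show "patterns walls n X S \<subseteq> (\<lambda>g. pattern walls n (pick g)) ` H"
      proof
        fix p assume "p \<in> patterns walls n X S"
        then obtain \<mu> where \<mu>: "generic walls n \<mu>" "relation_mod n X S \<mu>" "p = pattern walls n \<mu>"
          unfolding patterns_def by blast
        obtain g where g: "g \<in> G" "\<mu> \<in> Ch g" using cover[OF \<mu>(1)] by blast
        then have "g \<in> H" using \<mu> unfolding H_def by blast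
        then show "p \<in> (\<lambda>g. pattern walls n (pick g)) ` H"
          using same[OF g(1) g(1) g(2) pick(1)] \<mu>(3) by blast
      qed
    qed
  qed
  then show ?thesis unfolding H_def by (rule bij_betw_same_card)
qed

section \<open>The three arrangements\<close>

text \<open>The coordinate hyperplanes. The guard keeps the index 0 of the encoded zero wall below
  \<open>m\<close>.\<close>

definition wendel_walls :: "nat \<Rightarrow> (real \<times> nat) set" where
  "wendel_walls m = (if m = 0 then {} else {(0, 0)})"

text \<open>The reflection arrangement of type B, each hyperplane listed at its largest index;
  \<open>\<mu> m = 0\<close> is adjoined once, which gives \<open>2 * m - 1\<close> walls.\<close>

definition walk_walls :: "nat \<Rightarrow> (real \<times> nat) set" where
  "walk_walls m = (if m = 0 then {} else insert (0, 0) ({- 1, 1} \<times> {1..<m}))"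

text \<open>The braid arrangement. Only differences of coordinates matter, so the first coordinate
  has no wall and the constant vectors form the lineality space.\<close>

definition bridge_walls :: "nat \<Rightarrow> (real \<times> nat) set" where
  "bridge_walls m = {1} \<times> {1..<m}"

text \<open>On a face of the type B arrangement each class of equal nonzero absolute values is one
  free parameter.\<close>

definition walk_deg :: "nat \<Rightarrow> (nat \<Rightarrow> real) \<Rightarrow> nat" where
  "walk_deg n \<mu> = card ((\<lambda>i. \<bar>\<mu> i\<bar>) ` {1..n} - {0})"

text \<open>Each class of equal values is one parameter, and the direction of the constants is
  subtracted. Truncation only matters for \<open>n = 0\<close>.\<close>

definition bridge_deg :: "nat \<Rightarrow> (nat \<Rightarrow> real) \<Rightarrow> nat" where
  "bridge_deg n \<mu> = card (\<mu> ` {1..n}) - 1"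

lemma card_wendel_walls: "1 \<le> m \<Longrightarrow> card (wendel_walls m) + 1 = 2"
  by (simp add: wendel_walls_def)

lemma card_walk_walls: "1 \<le> m \<Longrightarrow> card (walk_walls m) + 1 = 2 * m"
proof -
  assume "1 \<le> m"
  have "card (insert (0, 0) ({- 1, 1 :: real} \<times> {1..<m})) = 1 + 2 * (m - 1)"
    by (subst card_insert_disjoint) (auto simp: card_cartesian_product)
  then show ?thesis using \<open>1 \<le> m\<close> by (simp add: walk_walls_def)
qed

lemma card_bridge_walls: "1 \<le> m \<Longrightarrow> card (bridge_walls m) + 1 = m"
  by (simp add: bridge_walls_def card_cartesian_product)

lemma nonzero_count_Suc: "nonzero_count (Suc n) \<mu> = nonzero_count n \<mu> + of_bool (\<mu> (Suc n) \<noteq> 0)"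
proof -
  have "{i \<in> {1..Suc n}. \<mu> i \<noteq> 0} = {i \<in> {1..n}. \<mu> i \<noteq> 0} \<union> (if \<mu> (Suc n) \<noteq> 0 then {Suc n} else {})"
    by (auto simp: le_Suc_eq)
  then show ?thesis by (simp add: nonzero_count_def)
qed

lemma nonzero_count_le: "nonzero_count n \<mu> \<le> n"
proof -
  have "nonzero_count n \<mu> \<le> card {1..n}" unfolding nonzero_count_def by (rule card_mono) auto
  then show ?thesis by simp
qed

lemma nonzero_count_cong:
  "(\<And>i. i \<in> {1..n} \<Longrightarrow> \<mu> i = \<nu> i) \<Longrightarrow> nonzero_count n \<mu> = nonzero_count n \<nu>"
  unfolding nonzero_count_def by (rule arg_cong[where f = card]) auto

lemma nonzero_count_eq_0: "nonzero_count n \<mu> = 0 \<longleftrightarrow> (\<forall>i\<in>{1..n}. \<mu> i = 0)"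
  by (auto simp: nonzero_count_def)

section \<open>The coordinate arrangement of the Wendel model\<close>

lemma generic_wendel: "generic wendel_walls n \<mu> \<longleftrightarrow> (\<forall>i\<in>{1..n}. \<mu> i \<noteq> 0)"
  by (force simp: generic_def wendel_walls_def wall_value_def)

lemma pattern_wendel:
  "pattern wendel_walls n \<mu> = pattern wendel_walls n \<nu> \<longleftrightarrow> (\<forall>i\<in>{1..n}. 0 < \<mu> i \<longleftrightarrow> 0 < \<nu> i)"
proof -
  have "pattern wendel_walls n \<kappa> = {i \<in> {1..n}. 0 < \<kappa> i} \<times> {(0, 0)}" for \<kappa>
    by (auto simp: pattern_def wendel_walls_def wall_value_def split: if_splits)
  then have "pattern wendel_walls n \<mu> = pattern wendel_walls n \<nu>
      \<longleftrightarrow> {i \<in> {1..n}. 0 < \<mu> i} = {i \<in> {1..n}. 0 < \<nu> i}"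
    by (simp add: times_eq_iff) blast
  then show ?thesis by blast
qed

interpretation wendel: wall_model wendel_walls nonzero_count 0
proof
  show "nonzero_count n \<mu> = nonzero_count n \<nu>" if "\<And>i. i \<in> {1..n} \<Longrightarrow> \<mu> i = \<nu> i" for n \<mu> \<nu>
    using that by (rule nonzero_count_cong)
  show "nonzero_count n \<mu> \<noteq> 0" if "generic wendel_walls n \<mu>" "0 < n" for n \<mu>
  proof -
    have "1 \<in> {1..n}" using that(2) by simp
    then show ?thesis using that(1) unfolding generic_wendel nonzero_count_eq_0 by blast
  qed
qed (auto simp: wendel_walls_def wall_value_def nonzero_count_Suc nonzero_count_le
      nonzero_count_eq_0 generic_wendel[unfolded wendel_walls_def] split: if_splits)

section \<open>The type B arrangement of the walk\<close>

lemma walk_deg_eq_0: "walk_deg n \<mu> = 0 \<longleftrightarrow> (\<forall>i\<in>{1..n}. \<mu> i = 0)"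
proof -
  have "walk_deg n \<mu> = 0 \<longleftrightarrow> (\<lambda>i. \<bar>\<mu> i\<bar>) ` {1..n} - {0} = {}"
    by (simp add: walk_deg_def)
  also have "\<dots> \<longleftrightarrow> (\<forall>i\<in>{1..n}. \<mu> i = 0)" by fastforce
  finally show ?thesis .
qed

lemma walk_deg_le_nonzero: "walk_deg n \<mu> \<le> nonzero_count n \<mu>"
proof -
  have "(\<lambda>i. \<bar>\<mu> i\<bar>) ` {1..n} - {0} = (\<lambda>i. \<bar>\<mu> i\<bar>) ` {i \<in> {1..n}. \<mu> i \<noteq> 0}" by auto
  then show ?thesis unfolding walk_deg_def nonzero_count_def by (simp add: card_image_le)
qed

lemma generic_walk:
  "generic walk_walls n \<mu> \<longleftrightarrow>
     (\<forall>i\<in>{1..n}. \<mu> i \<noteq> 0) \<and> (\<forall>i\<in>{1..n}. \<forall>j\<in>{1..n}. i \<noteq> j \<longrightarrow> \<bar>\<mu> i\<bar> \<noteq> \<bar>\<mu> j\<bar>)"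
  (is "_ \<longleftrightarrow> ?r")
proof -
  have "generic walk_walls n \<mu> \<longleftrightarrow> (\<forall>m\<in>{1..n}. \<mu> m \<noteq> 0 \<and> (\<forall>i\<in>{1..<m}. \<bar>\<mu> i\<bar> \<noteq> \<bar>\<mu> m\<bar>))"
    unfolding generic_def walk_walls_def wall_value_def
    by (intro ball_cong refl) (auto simp: abs_eq_iff)
  also have "\<dots> \<longleftrightarrow> ?r"
  proof
    assume l: "\<forall>m\<in>{1..n}. \<mu> m \<noteq> 0 \<and> (\<forall>i\<in>{1..<m}. \<bar>\<mu> i\<bar> \<noteq> \<bar>\<mu> m\<bar>)"
    have "\<bar>\<mu> i\<bar> \<noteq> \<bar>\<mu> j\<bar>" if "i \<in> {1..n}" "j \<in> {1..n}" "i \<noteq> j" for i j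
      using l that by (cases "i < j") (force, metis atLeastAtMost_iff atLeastLessThan_iff linorder_neqE_nat)
    then show ?r using l by blast
  qed auto
  finally show ?thesis .
qed

lemma less_iff_sign_abs:
  fixes x y :: real
  assumes "x \<noteq> 0" "y \<noteq> 0"
  shows "x < y \<longleftrightarrow> (if 0 < y then 0 < x \<longrightarrow> \<bar>x\<bar> < \<bar>y\<bar> else \<not> 0 < x \<and> \<bar>y\<bar> < \<bar>x\<bar>)"
  using assms by auto

text \<open>Signs and the order of absolute values decide every comparison of signed coordinates.
  This is what makes the new walls of the walk linearly ordered on a chamber.\<close>

lemma signed_less_transfer:
  fixes x y x' y' c e :: real
  assumes nz: "x \<noteq> 0" "y \<noteq> 0" "x' \<noteq> 0" "y' \<noteq> 0" and ce: "c = 1 \<or> c = - 1" "e = 1 \<or> e = - 1"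
    and same: "0 < x \<longleftrightarrow> 0 < x'" "0 < y \<longleftrightarrow> 0 < y'" "\<bar>x\<bar> < \<bar>y\<bar> \<longleftrightarrow> \<bar>x'\<bar> < \<bar>y'\<bar>" "\<bar>y\<bar> < \<bar>x\<bar> \<longleftrightarrow> \<bar>y'\<bar> < \<bar>x'\<bar>"
  shows "c * x < e * y \<longleftrightarrow> c * x' < e * y'"
proof -
  have sgn: "0 < c * z \<longleftrightarrow> (if c = 1 then 0 < z else \<not> 0 < z)" "\<bar>c * z\<bar> = \<bar>z\<bar>" "c * z \<noteq> 0"
    if "c = 1 \<or> c = - 1" "z \<noteq> 0" for c z :: real
    using that by auto
  show ?thesis
    unfolding less_iff_sign_abs[OF sgn(3)[OF ce(1) nz(1)] sgn(3)[OF ce(2) nz(2)]]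
      less_iff_sign_abs[OF sgn(3)[OF ce(1) nz(3)] sgn(3)[OF ce(2) nz(4)]]
      sgn(1)[OF ce(1) nz(1)] sgn(1)[OF ce(2) nz(2)] sgn(1)[OF ce(1) nz(3)] sgn(1)[OF ce(2) nz(4)]
      sgn(2)[OF ce(1) nz(1)] sgn(2)[OF ce(2) nz(2)] sgn(2)[OF ce(1) nz(3)] sgn(2)[OF ce(2) nz(4)] same ..
qed

text \<open>Describes a type B chamber symmetrically in the indices, whereas the walls compare a
  coordinate with earlier ones only.\<close>

definition same_signed_order :: "nat \<Rightarrow> (nat \<Rightarrow> real) \<Rightarrow> (nat \<Rightarrow> real) \<Rightarrow> bool" where
  "same_signed_order n \<mu> \<nu> \<longleftrightarrow> (\<forall>i\<in>{1..n}. 0 < \<mu> i \<longleftrightarrow> 0 < \<nu> i) \<and>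
     (\<forall>i\<in>{1..n}. \<forall>j\<in>{1..n}. \<bar>\<mu> i\<bar> < \<bar>\<mu> j\<bar> \<longleftrightarrow> \<bar>\<nu> i\<bar> < \<bar>\<nu> j\<bar>)"

text \<open>Once the signs are known, comparing \<open>\<mu> m\<close> with \<open>\<mu> i\<close>
  and \<open>- \<mu> i\<close> amounts to comparing absolute values. Genericity excludes ties, so
  comparisons with earlier indices determine all of them.\<close>

lemma pattern_walk:
  assumes \<mu>: "generic walk_walls n \<mu>" and \<nu>: "generic walk_walls n \<nu>"
  shows "pattern walk_walls n \<mu> = pattern walk_walls n \<nu> \<longleftrightarrow> same_signed_order n \<mu> \<nu>"
proof -
  have "pattern walk_walls n \<mu> = pattern walk_walls n \<nu> \<longleftrightarrow>
      (\<forall>m\<in>{1..n}. \<forall>w\<in>walk_walls m. wall_value w \<mu> < \<mu> m \<longleftrightarrow> wall_value w \<nu> < \<nu> m)"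
    unfolding pattern_def by blast
  also have "\<dots> \<longleftrightarrow> (\<forall>m\<in>{1..n}. (0 < \<mu> m \<longleftrightarrow> 0 < \<nu> m) \<and>
      (\<forall>i\<in>{1..<m}. (\<mu> i < \<mu> m \<longleftrightarrow> \<nu> i < \<nu> m) \<and> (- \<mu> i < \<mu> m \<longleftrightarrow> - \<nu> i < \<nu> m)))"
    unfolding walk_walls_def wall_value_def by (intro ball_cong refl) auto
  also have "\<dots> \<longleftrightarrow> (\<forall>i\<in>{1..n}. 0 < \<mu> i \<longleftrightarrow> 0 < \<nu> i) \<and>
      (\<forall>m\<in>{1..n}. \<forall>i\<in>{1..<m}. \<bar>\<mu> i\<bar> < \<bar>\<mu> m\<bar> \<longleftrightarrow> \<bar>\<nu> i\<bar> < \<bar>\<nu> m\<bar>)" (is "?a \<longleftrightarrow> ?b")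
  proof -
    have "(\<mu> i < \<mu> m \<longleftrightarrow> \<nu> i < \<nu> m) \<and> (- \<mu> i < \<mu> m \<longleftrightarrow> - \<nu> i < \<nu> m)
        \<longleftrightarrow> (\<bar>\<mu> i\<bar> < \<bar>\<mu> m\<bar> \<longleftrightarrow> \<bar>\<nu> i\<bar> < \<bar>\<nu> m\<bar>)"
      if "m \<in> {1..n}" "i \<in> {1..<m}" and signs: "\<forall>i\<in>{1..n}. 0 < \<mu> i \<longleftrightarrow> 0 < \<nu> i" for m i
    proof -
      have im: "i \<in> {1..n}" "i \<noteq> m" using that by auto
      have ne: "\<bar>\<mu> i\<bar> \<noteq> \<bar>\<mu> m\<bar>" "\<bar>\<nu> i\<bar> \<noteq> \<bar>\<nu> m\<bar>"
        and nz: "\<mu> i \<noteq> 0" "\<mu> m \<noteq> 0" "\<nu> i \<noteq> 0" "\<nu> m \<noteq> 0"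
        using \<mu> \<nu> im that(1) unfolding generic_walk by blast+
      have sgn: "0 < \<mu> i \<longleftrightarrow> 0 < \<nu> i" "0 < \<mu> m \<longleftrightarrow> 0 < \<nu> m"
        using signs im(1) that(1) by blast+
      show ?thesis
      proof
        assume abs: "\<bar>\<mu> i\<bar> < \<bar>\<mu> m\<bar> \<longleftrightarrow> \<bar>\<nu> i\<bar> < \<bar>\<nu> m\<bar>"
        then have abs': "\<bar>\<mu> m\<bar> < \<bar>\<mu> i\<bar> \<longleftrightarrow> \<bar>\<nu> m\<bar> < \<bar>\<nu> i\<bar>" using ne by auto
        show "(\<mu> i < \<mu> m \<longleftrightarrow> \<nu> i < \<nu> m) \<and> (- \<mu> i < \<mu> m \<longleftrightarrow> - \<nu> i < \<nu> m)"
          using signed_less_transfer[OF nz _ _ sgn abs abs', of 1 1]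
            signed_less_transfer[OF nz _ _ sgn abs abs', of "- 1" 1] by simp
      next
        assume "(\<mu> i < \<mu> m \<longleftrightarrow> \<nu> i < \<nu> m) \<and> (- \<mu> i < \<mu> m \<longleftrightarrow> - \<nu> i < \<nu> m)"
        moreover have "\<bar>x\<bar> < \<bar>y\<bar> \<longleftrightarrow> (if 0 < y then x < y \<and> - x < y else \<not> x < y \<and> \<not> - x < y)"
          if "y \<noteq> 0" "\<bar>x\<bar> \<noteq> \<bar>y\<bar>" for x y :: real
          using that by auto
        ultimately show "\<bar>\<mu> i\<bar> < \<bar>\<mu> m\<bar> \<longleftrightarrow> \<bar>\<nu> i\<bar> < \<bar>\<nu> m\<bar>"
          using ne nz sgn by presburger
      qed
    qed
    then show ?thesis by blast
  qed
  also have "?b \<longleftrightarrow> same_signed_order n \<mu> \<nu>"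
  proof
    assume b: ?b
    have "\<bar>\<mu> i\<bar> < \<bar>\<mu> j\<bar> \<longleftrightarrow> \<bar>\<nu> i\<bar> < \<bar>\<nu> j\<bar>" if ij: "i \<in> {1..n}" "j \<in> {1..n}" for i j
    proof (cases i j rule: linorder_cases)
      case less
      then show ?thesis using b ij by auto
    next
      case greater
      have "\<bar>\<mu> i\<bar> \<noteq> \<bar>\<mu> j\<bar>" "\<bar>\<nu> i\<bar> \<noteq> \<bar>\<nu> j\<bar>"
        using \<mu> \<nu> ij greater by (auto simp: generic_walk)
      moreover have "\<bar>\<mu> j\<bar> < \<bar>\<mu> i\<bar> \<longleftrightarrow> \<bar>\<nu> j\<bar> < \<bar>\<nu> i\<bar>"
        using b ij greater by auto
      ultimately show ?thesis by linarith
    qed simp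
    then show "same_signed_order n \<mu> \<nu>" using b by (simp add: same_signed_order_def)
  qed (auto simp: same_signed_order_def)
  finally show ?thesis .
qed

lemma walk_walls_pair_cases:
  assumes "v \<in> walk_walls (Suc n)" "w \<in> walk_walls (Suc n)"
  obtains (zero_zero) "v = (0, 0)" "w = (0, 0)"
    | (unit_zero) c i where "i \<in> {1..n}" "c = 1 \<or> c = - 1" "v = (c, i)" "w = (0, 0)"
    | (zero_unit) e j where "j \<in> {1..n}" "e = 1 \<or> e = - 1" "v = (0, 0)" "w = (e, j)"
    | (unit_unit) c i e j where "i \<in> {1..n}" "c = 1 \<or> c = - 1" "v = (c, i)"
        "j \<in> {1..n}" "e = 1 \<or> e = - 1" "w = (e, j)"
proof -
  have "u = (0, 0) \<or> (\<exists>i\<in>{1..n}. u = (1, i) \<or> u = (- 1, i))" if "u \<in> walk_walls (Suc n)" for u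
    using that by (auto simp: walk_walls_def)
  from this[OF assms(1)] this[OF assms(2)] show thesis using that by blast
qed

interpretation walk: wall_model walk_walls walk_deg 0
proof
  show "finite (walk_walls m)" for m by (simp add: walk_walls_def)
  show "walk_walls m = {}" if "m \<le> 0" for m using that by (simp add: walk_walls_def)
  show "snd w < m" "fst w = 0 \<or> 1 \<le> snd w" if "w \<in> walk_walls m" for w m
    using that by (auto simp: walk_walls_def split: if_splits)
  show "v = w" if "generic walk_walls n \<mu>" "v \<in> walk_walls (Suc n)" "w \<in> walk_walls (Suc n)"
    "wall_value v \<mu> = wall_value w \<mu>" for n \<mu> v w
  proof -
    have nz: "\<mu> i \<noteq> 0" if "i \<in> {1..n}" for i using that \<open>generic walk_walls n \<mu>\<close> by (auto simp: generic_walk)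
    have inj: "i = j" if "i \<in> {1..n}" "j \<in> {1..n}" "\<bar>\<mu> i\<bar> = \<bar>\<mu> j\<bar>" for i j
      using that \<open>generic walk_walls n \<mu>\<close> unfolding generic_walk by blast
    note eq = \<open>wall_value v \<mu> = wall_value w \<mu>\<close>
    from that(2,3) show ?thesis
    proof (cases rule: walk_walls_pair_cases)
      case zero_zero
      then show ?thesis by simp
    next
      case (unit_zero c i)
      then show ?thesis using eq nz[of i] by (auto simp: wall_value_def)
    next
      case (zero_unit e j)
      then show ?thesis using eq nz[of j] by (auto simp: wall_value_def)
    next
      case (unit_unit c i e j)
      \<comment> \<open>Equal absolute values force the same index; cancelling the nonzero
        coordinate then forces the same sign.\<close>
      have ce: "c * \<mu> i = e * \<mu> j" using eq unit_unit by (simp add: wall_value_def)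
      then have "\<bar>\<mu> i\<bar> = \<bar>\<mu> j\<bar>" using unit_unit(2,5) by (elim disjE; simp)
      then have "i = j" using inj unit_unit by blast
      then show ?thesis using ce nz[of i] unit_unit by simp
    qed
  qed
  show "wall_value v \<nu> < wall_value w \<nu>"
    if "generic walk_walls n \<mu>" "generic walk_walls n \<nu>" "pattern walk_walls n \<mu> = pattern walk_walls n \<nu>"
      "v \<in> walk_walls (Suc n)" "w \<in> walk_walls (Suc n)" "wall_value v \<mu> < wall_value w \<mu>" for n \<mu> \<nu> v w
  proof -
    have nz: "\<mu> i \<noteq> 0" "\<nu> i \<noteq> 0" if "i \<in> {1..n}" for i
      using that \<open>generic walk_walls n \<mu>\<close> \<open>generic walk_walls n \<nu>\<close> by (auto simp: generic_walk)
    have same: "0 < \<mu> i \<longleftrightarrow> 0 < \<nu> i" "\<bar>\<mu> i\<bar> < \<bar>\<mu> j\<bar> \<longleftrightarrow> \<bar>\<nu> i\<bar> < \<bar>\<nu> j\<bar>"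
      if "i \<in> {1..n}" "j \<in> {1..n}" for i j
      using that \<open>pattern walk_walls n \<mu> = _\<close> pattern_walk[OF \<open>generic walk_walls n \<mu>\<close> \<open>generic walk_walls n \<nu>\<close>]
      by (auto simp: same_signed_order_def)
    note lt = \<open>wall_value v \<mu> < wall_value w \<mu>\<close>
    from that(4,5) show ?thesis
    proof (cases rule: walk_walls_pair_cases)
      case zero_zero
      then show ?thesis using lt by simp
    next
      case (unit_zero c i)
      then show ?thesis using lt nz[of i] same(1)[of i i] by (auto simp: wall_value_def)
    next
      case (zero_unit e j)
      then show ?thesis using lt nz[of j] same(1)[of j j] by (auto simp: wall_value_def)
    next
      case (unit_unit c i e j)
      then have i: "i \<in> {1..n}" and j: "j \<in> {1..n}" by auto
      have "c * \<mu> i < e * \<mu> j" using lt unit_unit by (simp add: wall_value_def)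
      then have "c * \<nu> i < e * \<nu> j"
        using signed_less_transfer[OF nz(1)[OF i] nz(1)[OF j] nz(2)[OF i] nz(2)[OF j] unit_unit(2,5)
            same(1)[OF i i] same(1)[OF j j] same(2)[OF i j] same(2)[OF j i]] by blast
      then show ?thesis using unit_unit by (simp add: wall_value_def)
    qed
  qed
  show "walk_deg (Suc n) \<mu> \<le> walk_deg n \<mu>"
    if "w \<in> walk_walls (Suc n)" "\<mu> (Suc n) = wall_value w \<mu>" for w n \<mu>
  proof -
    \<comment> \<open>On a wall the new absolute value is zero or already present.\<close>
    have "\<bar>\<mu> (Suc n)\<bar> \<in> insert 0 ((\<lambda>i. \<bar>\<mu> i\<bar>) ` {1..n})"
      using that by (cases rule: walk_walls_pair_cases[OF that(1) that(1)]) (auto simp: wall_value_def)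
    then have "(\<lambda>i. \<bar>\<mu> i\<bar>) ` {1..Suc n} - {0} = (\<lambda>i. \<bar>\<mu> i\<bar>) ` {1..n} - {0}"
      by (auto simp: atLeastAtMostSuc_conv)
    then show ?thesis by (simp add: walk_deg_def)
  qed
  show "walk_deg n \<mu> \<le> walk_deg (Suc n) \<mu>" for n \<mu>
    unfolding walk_deg_def by (intro card_mono) auto
  show "walk_deg (Suc n) \<mu> \<le> walk_deg n \<mu> + 1" for n \<mu>
  proof -
    have "(\<lambda>i. \<bar>\<mu> i\<bar>) ` {1..Suc n} - {0} \<subseteq> insert \<bar>\<mu> (Suc n)\<bar> ((\<lambda>i. \<bar>\<mu> i\<bar>) ` {1..n} - {0})"
      by (auto simp: atLeastAtMostSuc_conv)
    then have "walk_deg (Suc n) \<mu> \<le> card (insert \<bar>\<mu> (Suc n)\<bar> ((\<lambda>i. \<bar>\<mu> i\<bar>) ` {1..n} - {0}))"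
      unfolding walk_deg_def by (intro card_mono) auto
    also have "\<dots> \<le> walk_deg n \<mu> + 1"
      unfolding walk_deg_def by (simp add: card_insert_if)
    finally show ?thesis .
  qed
  show "walk_deg n \<mu> = walk_deg n \<nu>" if "\<And>i. i \<in> {1..n} \<Longrightarrow> \<mu> i = \<nu> i" for n \<mu> \<nu>
  proof -
    have "(\<lambda>i. \<bar>\<mu> i\<bar>) ` {1..n} = (\<lambda>i. \<bar>\<nu> i\<bar>) ` {1..n}" using that by (intro image_cong) auto
    then show ?thesis by (simp add: walk_deg_def)
  qed
  show "walk_deg n \<mu> \<le> nonzero_count n \<mu>" for n \<mu> by (rule walk_deg_le_nonzero)
  show "\<mu> i = 0" if "walk_deg n \<mu> = 0" "i \<in> {1..n}" for n \<mu> i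
    using that walk_deg_eq_0 by blast
  show "walk_deg n \<mu> \<le> n - 0" for n \<mu>
    using walk_deg_le_nonzero[of n \<mu>] nonzero_count_le[of n \<mu>] by simp
  show "walk_deg n \<mu> \<noteq> 0" if "generic walk_walls n \<mu>" "0 < n" for n \<mu>
  proof -
    have "1 \<in> {1..n}" using that(2) by simp
    then show ?thesis using that(1) unfolding generic_walk walk_deg_eq_0 by blast
  qed
qed

section \<open>The braid arrangement of the bridge\<close>

lemma generic_bridge: "generic bridge_walls n \<mu> \<longleftrightarrow> inj_on \<mu> {1..n}"
proof
  assume g: "generic bridge_walls n \<mu>"
  have "\<mu> i \<noteq> \<mu> j" if "i \<in> {1..n}" "j \<in> {1..n}" "i < j" for i j
    using g that by (fastforce simp: generic_def bridge_walls_def wall_value_def)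
  then show "inj_on \<mu> {1..n}" by (metis inj_onI linorder_neqE_nat)
next
  assume "inj_on \<mu> {1..n}"
  then show "generic bridge_walls n \<mu>"
    by (fastforce simp: generic_def bridge_walls_def wall_value_def inj_on_def)
qed

lemma pattern_bridge:
  assumes \<mu>: "generic bridge_walls n \<mu>" and \<nu>: "generic bridge_walls n \<nu>"
  shows "pattern bridge_walls n \<mu> = pattern bridge_walls n \<nu> \<longleftrightarrow>
    (\<forall>i\<in>{1..n}. \<forall>j\<in>{1..n}. \<mu> i < \<mu> j \<longleftrightarrow> \<nu> i < \<nu> j)" (is "?l \<longleftrightarrow> ?r")
proof -
  have "?l \<longleftrightarrow> (\<forall>m\<in>{1..n}. \<forall>w\<in>bridge_walls m. wall_value w \<mu> < \<mu> m \<longleftrightarrow> wall_value w \<nu> < \<nu> m)"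
    unfolding pattern_def by blast
  also have "\<dots> \<longleftrightarrow> (\<forall>m\<in>{1..n}. \<forall>i\<in>{1..<m}. \<mu> i < \<mu> m \<longleftrightarrow> \<nu> i < \<nu> m)"
    unfolding bridge_walls_def wall_value_def by (intro ball_cong refl) auto
  also have "\<dots> \<longleftrightarrow> ?r"
  proof
    assume b: "\<forall>m\<in>{1..n}. \<forall>i\<in>{1..<m}. \<mu> i < \<mu> m \<longleftrightarrow> \<nu> i < \<nu> m"
    have "\<mu> i < \<mu> j \<longleftrightarrow> \<nu> i < \<nu> j" if ij: "i \<in> {1..n}" "j \<in> {1..n}" for i j
    proof (cases i j rule: linorder_cases)
      case less
      then show ?thesis using b ij by auto
    next
      case greater
      have "\<mu> i \<noteq> \<mu> j" "\<nu> i \<noteq> \<nu> j"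
        using \<mu> \<nu> ij greater by (auto simp: generic_bridge inj_on_eq_iff)
      moreover have "\<mu> j < \<mu> i \<longleftrightarrow> \<nu> j < \<nu> i"
        using b ij greater by auto
      ultimately show ?thesis by linarith
    qed simp
    then show ?r by blast
  qed auto
  finally show ?thesis .
qed

lemma bridge_deg_eq_0: "bridge_deg n \<mu> = 0 \<longleftrightarrow> (\<forall>i\<in>{1..n}. \<forall>j\<in>{1..n}. \<mu> i = \<mu> j)"
proof -
  have "bridge_deg n \<mu> = 0 \<longleftrightarrow> card (\<mu> ` {1..n}) \<le> Suc 0" by (auto simp: bridge_deg_def)
  also have "\<dots> \<longleftrightarrow> (\<forall>i\<in>{1..n}. \<forall>j\<in>{1..n}. \<mu> i = \<mu> j)"
    by (subst card_le_Suc0_iff_eq) auto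
  finally show ?thesis .
qed

lemma bridge_deg_le_nonzero: "bridge_deg n \<mu> \<le> nonzero_count n \<mu>"
proof -
  have "\<mu> ` {1..n} \<subseteq> insert 0 (\<mu> ` {i \<in> {1..n}. \<mu> i \<noteq> 0})" by auto
  then have "card (\<mu> ` {1..n}) \<le> card (insert 0 (\<mu> ` {i \<in> {1..n}. \<mu> i \<noteq> 0}))"
    by (intro card_mono) auto
  also have "\<dots> \<le> Suc (card (\<mu> ` {i \<in> {1..n}. \<mu> i \<noteq> 0}))" by (simp add: card_insert_if)
  also have "\<dots> \<le> Suc (nonzero_count n \<mu>)" by (simp add: nonzero_count_def card_image_le)
  finally show ?thesis by (simp add: bridge_deg_def)
qed

interpretation bridge: wall_model bridge_walls bridge_deg 1
proof
  show "finite (bridge_walls m)" for m by (simp add: bridge_walls_def)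
  show "bridge_walls m = {}" if "m \<le> 1" for m using that by (simp add: bridge_walls_def)
  show "snd w < m" "fst w = 0 \<or> 1 \<le> snd w" if "w \<in> bridge_walls m" for w m
    using that by (auto simp: bridge_walls_def)
  show "v = w" if "generic bridge_walls n \<mu>" "v \<in> bridge_walls (Suc n)" "w \<in> bridge_walls (Suc n)"
    "wall_value v \<mu> = wall_value w \<mu>" for n \<mu> v w
    using that by (auto simp: bridge_walls_def wall_value_def generic_bridge inj_on_eq_iff)
  show "wall_value v \<nu> < wall_value w \<nu>"
    if "generic bridge_walls n \<mu>" "generic bridge_walls n \<nu>" "pattern bridge_walls n \<mu> = pattern bridge_walls n \<nu>"
      "v \<in> bridge_walls (Suc n)" "w \<in> bridge_walls (Suc n)" "wall_value v \<mu> < wall_value w \<mu>" for n \<mu> \<nu> v w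
    using that pattern_bridge[OF that(1,2)] by (auto simp: bridge_walls_def wall_value_def)
  show "bridge_deg (Suc n) \<mu> \<le> bridge_deg n \<mu>"
    if "w \<in> bridge_walls (Suc n)" "\<mu> (Suc n) = wall_value w \<mu>" for w n \<mu>
  proof -
    have "\<mu> (Suc n) \<in> \<mu> ` {1..n}"
      using that by (auto simp: wall_value_def bridge_walls_def)
    then have "\<mu> ` {1..Suc n} = \<mu> ` {1..n}"
      by (auto simp: atLeastAtMostSuc_conv)
    then show ?thesis by (simp add: bridge_deg_def)
  qed
  show "bridge_deg n \<mu> \<le> bridge_deg (Suc n) \<mu>" for n \<mu>
    unfolding bridge_deg_def by (intro diff_le_mono card_mono) auto
  show "bridge_deg (Suc n) \<mu> \<le> bridge_deg n \<mu> + 1" for n \<mu>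
    using card_insert_le_m1[of "card (\<mu> ` {1..n}) + 1" "\<mu> ` {1..n}" "\<mu> (Suc n)"]
    by (simp add: bridge_deg_def atLeastAtMostSuc_conv)
  show "bridge_deg n \<mu> = bridge_deg n \<nu>" if "\<And>i. i \<in> {1..n} \<Longrightarrow> \<mu> i = \<nu> i" for n \<mu> \<nu>
  proof -
    have "\<mu> ` {1..n} = \<nu> ` {1..n}" using that by (intro image_cong) auto
    then show ?thesis by (simp add: bridge_deg_def)
  qed
  show "bridge_deg n \<mu> \<le> nonzero_count n \<mu>" for n \<mu> by (rule bridge_deg_le_nonzero)
  show "\<mu> i = 0" if "bridge_deg n \<mu> = 0" "nonzero_count n \<mu> \<le> n - 1" "1 \<le> n" "i \<in> {1..n}" for n \<mu> i
  proof (rule ccontr)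
    \<comment> \<open>A nonzero constant vector has \<open>n\<close> nonzero entries, one too
      many.\<close>
    assume "\<mu> i \<noteq> 0"
    moreover have "\<forall>j\<in>{1..n}. \<mu> j = \<mu> i"
      using that(1,4) unfolding bridge_deg_eq_0 by blast
    ultimately have "{j \<in> {1..n}. \<mu> j \<noteq> 0} = {1..n}" by auto
    then have "nonzero_count n \<mu> = n" by (simp add: nonzero_count_def)
    then show False using that by simp
  qed
  show "bridge_deg n \<mu> \<le> n - 1" for n \<mu>
    using card_image_le[of "{1..n}" \<mu>] by (simp add: bridge_deg_def diff_le_mono)
  show "bridge_deg n \<mu> \<noteq> 0" if "generic bridge_walls n \<mu>" "1 < n" for n \<mu>
  proof -
    have mem: "1 \<in> {1..n}" "2 \<in> {1..n}" using that(2) by auto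
    then have "\<mu> 1 \<noteq> \<mu> 2" using that(1) by (simp add: generic_bridge inj_on_eq_iff del: One_nat_def)
    then show ?thesis using mem unfolding bridge_deg_eq_0 by blast
  qed
qed

section \<open>Regular configurations\<close>

lemma general_position_sign_act:
  fixes X :: "nat \<Rightarrow> real ^ 'd"
  assumes gp: "general_position n X" and \<epsilon>: "\<epsilon> \<in> sign_vectors n"
  shows "general_position n (sign_act \<epsilon> X)"
  unfolding general_position_def
proof (intro allI impI, elim conjE)
  fix J assume J: "J \<subseteq> {1..n}" "card J = CARD('d)"
  have fin: "finite J" using J(1) finite_subset by blast
  have ne: "\<epsilon> k \<noteq> 0" if "k \<in> J" for k
    using \<epsilon> J(1) that by (fastforce simp: sign_vectors_def PiE_iff)
  have X: "\<forall>k\<in>J. a k = 0" if "(\<Sum>k\<in>J. a k *\<^sub>R X k) = 0" for a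
    using gp J that independent_family_iff[OF fin, of X] unfolding general_position_def by blast
  show "inj_on (sign_act \<epsilon> X) J \<and> independent (sign_act \<epsilon> X ` J)"
    unfolding independent_family_iff[OF fin]
  proof (intro allI impI ballI)
    fix a k assume "(\<Sum>k\<in>J. a k *\<^sub>R sign_act \<epsilon> X k) = 0" "k \<in> J"
    then have "a k * \<epsilon> k = 0"
      using X[of "\<lambda>k. a k * \<epsilon> k"] by (simp add: sign_act_def)
    then show "a k = 0" using ne \<open>k \<in> J\<close> by simp
  qed
qed

lemma relation_mod_0: "relation_mod n X {0} \<mu> \<longleftrightarrow> (\<Sum>i = 1..n. \<mu> i *\<^sub>R X i) = 0"
  by (simp add: relation_mod_def)

lemma sum_permuted:
  assumes "\<sigma> permutes {1..n}"
  shows "(\<Sum>i = 1..n. \<mu> (\<sigma> i) *\<^sub>R X (\<sigma> i)) = (\<Sum>i = 1..n. \<mu> i *\<^sub>R X i)"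
  using sum.permute[OF assms, of "\<lambda>i. \<mu> i *\<^sub>R X i"] by (simp add: o_def)

lemma sign_eq: "\<epsilon> \<in> sign_vectors n \<Longrightarrow> k \<in> {1..n} \<Longrightarrow> \<epsilon> k = 1 \<or> \<epsilon> k = - 1"
  by (auto simp: sign_vectors_def PiE_iff)

lemma sign_vectors_eqI:
  assumes "\<epsilon> \<in> sign_vectors n" "\<delta> \<in> sign_vectors n" "\<And>k. k \<in> {1..n} \<Longrightarrow> \<epsilon> k = \<delta> k"
  shows "\<epsilon> = \<delta>"
  using assms unfolding sign_vectors_def by (intro PiE_ext) auto

lemma wendel_regular_mod:
  fixes X :: "nat \<Rightarrow> real ^ 'd"
  assumes "wendel_regular n X" "CARD('d) \<le> n"
  shows "regular_mod nonzero_count n CARD('d) X {0}"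
  unfolding regular_mod_def relation_mod_0
proof (intro allI impI, elim conjE)
  fix \<mu> assume "(\<Sum>i = 1..n. \<mu> i *\<^sub>R X i) = 0" "nonzero_count n \<mu> \<le> CARD('d)"
  then show "nonzero_count n \<mu> = 0"
    using general_position_zero[of n X \<mu>] assms
    unfolding nonzero_count_eq_0 by (simp add: nonzero_count_def wendel_regular_def)
qed

text \<open>Sorting by absolute value and adjusting signs turns a relation of columns into one of
  partial sums, whose coefficients vanish except where the sorted absolute values drop. There are at
  most \<open>walk_deg n \<mu>\<close> drops, so general position rules them all out.\<close>

lemma walk_regular_mod:
  fixes X :: "nat \<Rightarrow> real ^ 'd"
  assumes reg: "walk_regular n X" and n: "CARD('d) \<le> n"
  shows "regular_mod walk_deg n CARD('d) X {0}"
  unfolding regular_mod_def relation_mod_0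
proof (intro allI impI, elim conjE)
  fix \<mu> assume rel: "(\<Sum>i = 1..n. \<mu> i *\<^sub>R X i) = 0" and deg: "walk_deg n \<mu> \<le> CARD('d)"
  obtain \<sigma> where \<sigma>: "\<sigma> permutes {1..n}"
    and dec: "\<And>k l. \<lbrakk>k \<in> {1..n}; l \<in> {1..n}; k \<le> l\<rbrakk> \<Longrightarrow> \<bar>\<mu> (\<sigma> l)\<bar> \<le> \<bar>\<mu> (\<sigma> k)\<bar>"
    using ex_sorting_permutation[of n "\<lambda>i. \<bar>\<mu> i\<bar>"] by blast
  define \<epsilon> where "\<epsilon> = restrict (\<lambda>k. if 0 \<le> \<mu> (\<sigma> k) then 1 else - 1 :: real) {1..n}"
  \<comment> \<open>Extended by zero past \<open>n\<close>: the last gap is then \<open>A n\<close>,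
    and the boundary term of summation by parts disappears.\<close>
  define A where "A k = (if k \<in> {1..n} then \<bar>\<mu> (\<sigma> k)\<bar> else 0)" for k
  define y where "y = signed_perm_act (\<sigma>, \<epsilon>) X"
  have "(\<sigma>, \<epsilon>) \<in> signed_perms n"
    using \<sigma> by (auto simp: signed_perms_def perms_def sign_vectors_def \<epsilon>_def)
  then have gp: "general_position n (partial_sum y)"
    using reg unfolding walk_regular_def y_def by blast
  have dec': "A (Suc k) \<le> A k" if "k \<in> {1..n}" for k
    using dec[of k "Suc k"] that by (auto simp: A_def)
  have A_mono: "A l \<le> A k" if "k \<in> {1..n}" "k \<le> l" for k l
    using dec[of k l] that by (auto simp: A_def)
  define Z where "Z = {k \<in> {1..n}. A k - A (Suc k) \<noteq> 0}"
  \<comment> \<open>A later drop starts at a strictly smaller value, so each drop has its own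
    absolute value.\<close>
  have "inj_on A Z"
  proof (rule linorder_inj_onI)
    fix k l assume "k < l" "k \<in> Z" "l \<in> Z"
    then have "A l \<le> A (Suc k)" "A (Suc k) < A k"
      using A_mono[of "Suc k" l] dec'[of k] by (auto simp: Z_def)
    then show "A k \<noteq> A l" by simp
  qed auto
  moreover have "A ` Z \<subseteq> (\<lambda>i. \<bar>\<mu> i\<bar>) ` {1..n} - {0}"
  proof
    fix x assume "x \<in> A ` Z"
    then obtain k where k: "k \<in> {1..n}" "A k \<noteq> A (Suc k)" "x = A k" by (auto simp: Z_def)
    moreover have "0 \<le> A (Suc k)" by (simp add: A_def)
    ultimately have "x \<noteq> 0" using dec'[of k] by auto
    moreover have "x = \<bar>\<mu> (\<sigma> k)\<bar>" "\<sigma> k \<in> {1..n}"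
      using k permutes_in_image[OF \<sigma>, of k] by (auto simp: A_def)
    ultimately show "x \<in> (\<lambda>i. \<bar>\<mu> i\<bar>) ` {1..n} - {0}" by blast
  qed
  ultimately have "card Z \<le> walk_deg n \<mu>"
    unfolding walk_deg_def by (intro card_inj_on_le[of A]) auto
  then have "card Z \<le> CARD('d)" using deg by simp
  moreover have "(\<Sum>k = 1..n. (A k - A (Suc k)) *\<^sub>R partial_sum y k) = 0"
  proof -
    have "A (Suc n) = 0" by (simp add: A_def)
    then have "(\<Sum>k = 1..n. (A k - A (Suc k)) *\<^sub>R partial_sum y k) = (\<Sum>i = 1..n. A i *\<^sub>R y i)"
      using summation_by_parts_partial_sum[of A y n] by simp
    also have "\<dots> = (\<Sum>i = 1..n. \<mu> (\<sigma> i) *\<^sub>R X (\<sigma> i))"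
      by (intro sum.cong) (auto simp: A_def y_def signed_perm_act_def \<epsilon>_def)
    finally show ?thesis using rel sum_permuted[OF \<sigma>, of \<mu> X] by simp
  qed
  ultimately have zero: "A k - A (Suc k) = 0" if "k \<in> {1..n}" for k
    using general_position_zero[OF gp n, of "\<lambda>k. A k - A (Suc k)" k] that by (simp add: Z_def)
  have A0: "A k = 0" if "k \<le> Suc n" "1 \<le> k" for k
    using that(1)
  proof (induction rule: inc_induct)
    case base
    then show ?case by (simp add: A_def)
  next
    case (step m)
    then show ?case using zero[of m] that(2) by auto
  qed
  have "\<mu> i = 0" if i: "i \<in> {1..n}" for i
  proof -
    have "i \<in> \<sigma> ` {1..n}" using permutes_image[OF \<sigma>] i by simp
    then obtain k where "k \<in> {1..n}" "i = \<sigma> k" by blast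
    then show ?thesis using A0[of k] by (simp add: A_def)
  qed
  then show "walk_deg n \<mu> = 0" by (simp add: walk_deg_eq_0)
qed

text \<open>As for the walk, but only the gaps between consecutive values enter. Their vanishing
  makes the relation constant, which is the lineality space here.\<close>

lemma bridge_regular_mod:
  fixes X :: "nat \<Rightarrow> real ^ 'd"
  assumes conf: "bridge_configuration n X" and reg: "bridge_regular n X" and n: "CARD('d) + 1 \<le> n"
  shows "regular_mod bridge_deg n CARD('d) X {0}"
  unfolding regular_mod_def relation_mod_0
proof (intro allI impI, elim conjE)
  fix \<mu> assume rel: "(\<Sum>i = 1..n. \<mu> i *\<^sub>R X i) = 0" and deg: "bridge_deg n \<mu> \<le> CARD('d)"
  obtain \<sigma> where \<sigma>: "\<sigma> permutes {1..n}"
    and dec: "\<And>k l. \<lbrakk>k \<in> {1..n}; l \<in> {1..n}; k \<le> l\<rbrakk> \<Longrightarrow> \<mu> (\<sigma> l) \<le> \<mu> (\<sigma> k)"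
    using ex_sorting_permutation[of n \<mu>] by blast
  define A where "A k = \<mu> (\<sigma> k)" for k
  define y where "y = perm_act \<sigma> X"
  have gp: "general_position (n - 1) (partial_sum y)"
    using reg \<sigma> unfolding bridge_regular_def y_def perms_def by blast
  define Z where "Z = {k \<in> {1..n - 1}. A k - A (Suc k) \<noteq> 0}"
  \<comment> \<open>The drops and the final position carry distinct values; the extra value accounts
    for the \<open>- 1\<close> in \<open>bridge_deg\<close>.\<close>
  have "inj_on A (insert n Z)"
  proof (rule linorder_inj_onI)
    fix k l assume "k < l" "k \<in> insert n Z" "l \<in> insert n Z"
    then have "A l \<le> A (Suc k)" "A (Suc k) \<le> A k" "A k \<noteq> A (Suc k)"
      using dec[of "Suc k" l] dec[of k "Suc k"] by (auto simp: Z_def A_def)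
    then show "A k \<noteq> A l" by simp
  qed auto
  moreover have "A ` insert n Z \<subseteq> \<mu> ` {1..n}"
    using permutes_in_image[OF \<sigma>] n by (auto simp: A_def Z_def)
  ultimately have "card (insert n Z) \<le> card (\<mu> ` {1..n})"
    by (intro card_inj_on_le[of A]) auto
  moreover have "card (insert n Z) = card Z + 1"
    using n by (subst card_insert_disjoint) (auto simp: Z_def)
  ultimately have "card Z \<le> CARD('d)" using deg by (simp add: bridge_deg_def)
  moreover have "(\<Sum>k = 1..n - 1. (A k - A (Suc k)) *\<^sub>R partial_sum y k) = 0"
  proof -
    have nn: "Suc (n - 1) = n" using n by simp
    have "partial_sum y n = 0"
      using conf sum_permuted[OF \<sigma>, of "\<lambda>_. 1" X]
      by (simp add: partial_sum_def bridge_configuration_def y_def perm_act_def)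
    moreover have "(\<Sum>i = 1..n. A i *\<^sub>R y i) = (\<Sum>i = 1..n. \<mu> i *\<^sub>R X i)"
      using sum_permuted[OF \<sigma>, of \<mu> X] by (simp add: A_def y_def perm_act_def)
    then have "(\<Sum>k = 1..n. (A k - A (Suc k)) *\<^sub>R partial_sum y k)
        = (\<Sum>i = 1..n. \<mu> i *\<^sub>R X i) - A (Suc n) *\<^sub>R partial_sum y n"
      using summation_by_parts_partial_sum[of A y n] by simp
    moreover have "(\<Sum>k = 1..n. (A k - A (Suc k)) *\<^sub>R partial_sum y k) =
       (\<Sum>k = 1..n - 1. (A k - A (Suc k)) *\<^sub>R partial_sum y k) + (A n - A (Suc n)) *\<^sub>R partial_sum y n"
      using sum.cl_ivl_Suc[of "\<lambda>k. (A k - A (Suc k)) *\<^sub>R partial_sum y k" 1 "n - 1"] nn by simp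
    ultimately show ?thesis using rel by simp
  qed
  ultimately have zero: "A k - A (Suc k) = 0" if "k \<in> {1..n - 1}" for k
    using general_position_zero[OF gp, of "\<lambda>k. A k - A (Suc k)" k] that n by (simp add: Z_def)
  have An: "A k = A n" if "k \<le> n" "1 \<le> k" for k
    using that(1)
  proof (induction rule: inc_induct)
    case (step m)
    then show ?case using zero[of m] that(2) by auto
  qed simp
  have "\<mu> i = A n" if i: "i \<in> {1..n}" for i
  proof -
    have "i \<in> \<sigma> ` {1..n}" using permutes_image[OF \<sigma>] i by simp
    then obtain k where "k \<in> {1..n}" "i = \<sigma> k" by blast
    then show ?thesis using An[of k] by (simp add: A_def)
  qed
  then show "bridge_deg n \<mu> = 0" by (simp add: bridge_deg_eq_0)
qed

section \<open>Absorption as meeting a chamber\<close>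

definition wendel_chamber :: "nat \<Rightarrow> (nat \<Rightarrow> real) \<Rightarrow> (nat \<Rightarrow> real) set" where
  "wendel_chamber n \<epsilon> = {\<mu>. \<forall>i\<in>{1..n}. 0 < \<epsilon> i * \<mu> i}"

text \<open>The open Weyl chamber of \<open>g\<close>: for signs \<plusminus> 1, the sequence
  \<open>snd g k * \<mu> (fst g k)\<close> is positive and strictly decreasing in
  \<open>k\<close>.\<close>

definition walk_chamber :: "nat \<Rightarrow> (nat \<Rightarrow> nat) \<times> (nat \<Rightarrow> real) \<Rightarrow> (nat \<Rightarrow> real) set" where
  "walk_chamber n g = {\<mu>. (\<forall>k\<in>{1..n}. 0 < snd g k * \<mu> (fst g k)) \<and>
     (\<forall>k\<in>{1..n}. \<forall>l\<in>{1..n}. k < l \<longrightarrow> \<bar>\<mu> (fst g l)\<bar> < \<bar>\<mu> (fst g k)\<bar>)}"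

definition bridge_chamber :: "nat \<Rightarrow> (nat \<Rightarrow> nat) \<Rightarrow> (nat \<Rightarrow> real) set" where
  "bridge_chamber n \<sigma> = {\<mu>. \<forall>k\<in>{1..n}. \<forall>l\<in>{1..n}. k < l \<longrightarrow> \<mu> (\<sigma> l) < \<mu> (\<sigma> k)}"

lemma permutes_preimage:
  assumes "\<sigma> permutes {1..n}" "i \<in> {1..n}"
  obtains k where "k \<in> {1..n}" "i = \<sigma> k"
proof -
  have "i \<in> \<sigma> ` {1..n}" using permutes_image[OF assms(1)] assms(2) by simp
  then show thesis using that by blast
qed

lemma sign_pos_iff:
  fixes e x :: real
  assumes "e = 1 \<or> e = - 1" "0 < e * x"
  shows "0 < x \<longleftrightarrow> e = 1"
  using assms by auto

lemma card_hit_wendel: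
  "card {\<epsilon> \<in> sign_vectors n. \<exists>\<mu>\<in>wendel_chamber n \<epsilon>. relation_mod n X S \<mu>}
     = card (patterns wendel_walls n X S)"
proof (rule card_hit_chambers)
  show "generic wendel_walls n \<mu>" if "\<mu> \<in> wendel_chamber n \<epsilon>" for \<epsilon> \<mu>
    using that by (force simp: generic_wendel wendel_chamber_def)
  show "\<exists>\<epsilon>\<in>sign_vectors n. \<mu> \<in> wendel_chamber n \<epsilon>" if "generic wendel_walls n \<mu>" for \<mu>
  proof
    let ?\<epsilon> = "restrict (\<lambda>i. if 0 < \<mu> i then 1 else - 1 :: real) {1..n}"
    show "?\<epsilon> \<in> sign_vectors n" by (auto simp: sign_vectors_def)
    show "\<mu> \<in> wendel_chamber n ?\<epsilon>"
      using that by (auto simp: generic_wendel wendel_chamber_def not_less less_le)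
  qed
  show "pattern wendel_walls n \<mu> = pattern wendel_walls n \<nu> \<longleftrightarrow> \<epsilon> = \<delta>"
    if \<epsilon>: "\<epsilon> \<in> sign_vectors n" and \<delta>: "\<delta> \<in> sign_vectors n"
      and \<mu>: "\<mu> \<in> wendel_chamber n \<epsilon>" and \<nu>: "\<nu> \<in> wendel_chamber n \<delta>" for \<epsilon> \<delta> \<mu> \<nu>
  proof -
    have sgn: "0 < \<mu> i \<longleftrightarrow> \<epsilon> i = 1" "0 < \<nu> i \<longleftrightarrow> \<delta> i = 1" if "i \<in> {1..n}" for i
      using sign_pos_iff[OF sign_eq[OF \<epsilon> that], of "\<mu> i"] sign_pos_iff[OF sign_eq[OF \<delta> that], of "\<nu> i"]
        \<mu> \<nu> that by (auto simp: wendel_chamber_def)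
    show ?thesis unfolding pattern_wendel
    proof
      assume *: "\<forall>i\<in>{1..n}. 0 < \<mu> i \<longleftrightarrow> 0 < \<nu> i"
      show "\<epsilon> = \<delta>"
      proof (rule sign_vectors_eqI[OF \<epsilon> \<delta>])
        fix k assume k: "k \<in> {1..n}"
        then have "\<epsilon> k = 1 \<longleftrightarrow> \<delta> k = 1" using * sgn[OF k] by blast
        then show "\<epsilon> k = \<delta> k" using sign_eq[OF \<epsilon> k] sign_eq[OF \<delta> k] by auto
      qed
    next
      assume "\<epsilon> = \<delta>"
      then show "\<forall>i\<in>{1..n}. 0 < \<mu> i \<longleftrightarrow> 0 < \<nu> i" using sgn by blast
    qed
  qed
qed

text \<open>Sorting a generic vector finds a group element whose chamber contains it; signs and
  ranks of absolute values recover that element, so it is unique.\<close>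

lemma card_hit_walk:
  "card {g \<in> signed_perms n. \<exists>\<mu>\<in>walk_chamber n g. relation_mod n X S \<mu>}
     = card (patterns walk_walls n X S)"
proof (rule card_hit_chambers)
  have ne: "\<bar>\<mu> (fst g k)\<bar> \<noteq> \<bar>\<mu> (fst g l)\<bar>"
    if "\<mu> \<in> walk_chamber n g" "k \<in> {1..n}" "l \<in> {1..n}" "k \<noteq> l" for \<mu> g k l
  proof (cases k l rule: linorder_cases)
    case less
    then have "\<bar>\<mu> (fst g l)\<bar> < \<bar>\<mu> (fst g k)\<bar>" using that(1-3) unfolding walk_chamber_def by blast
    then show ?thesis by simp
  next
    case greater
    then have "\<bar>\<mu> (fst g k)\<bar> < \<bar>\<mu> (fst g l)\<bar>" using that(1-3) unfolding walk_chamber_def by blast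
    then show ?thesis by simp
  qed (use that(4) in simp)
  show gen: "generic walk_walls n \<mu>" if g: "g \<in> signed_perms n" and \<mu>: "\<mu> \<in> walk_chamber n g" for g \<mu>
  proof -
    have \<sigma>: "fst g permutes {1..n}" using g by (auto simp: signed_perms_def perms_def)
    have "\<mu> i \<noteq> 0" if i: "i \<in> {1..n}" for i
    proof -
      obtain k where k: "k \<in> {1..n}" "i = fst g k" by (rule permutes_preimage[OF \<sigma> i])
      then have "0 < snd g k * \<mu> i" using \<mu> unfolding walk_chamber_def by blast
      then show ?thesis by auto
    qed
    moreover have "\<bar>\<mu> i\<bar> \<noteq> \<bar>\<mu> j\<bar>" if ij: "i \<in> {1..n}" "j \<in> {1..n}" "i \<noteq> j" for i j
    proof -
      obtain k where k: "k \<in> {1..n}" "i = fst g k" by (rule permutes_preimage[OF \<sigma> ij(1)])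
      obtain l where l: "l \<in> {1..n}" "j = fst g l" by (rule permutes_preimage[OF \<sigma> ij(2)])
      show ?thesis using ne[OF \<mu> k(1) l(1)] k l ij by auto
    qed
    ultimately show ?thesis by (simp add: generic_walk)
  qed
  show "\<exists>g\<in>signed_perms n. \<mu> \<in> walk_chamber n g" if gen: "generic walk_walls n \<mu>" for \<mu>
  proof -
    obtain \<sigma> where \<sigma>: "\<sigma> permutes {1..n}"
      and dec: "\<And>k l. \<lbrakk>k \<in> {1..n}; l \<in> {1..n}; k \<le> l\<rbrakk> \<Longrightarrow> \<bar>\<mu> (\<sigma> l)\<bar> \<le> \<bar>\<mu> (\<sigma> k)\<bar>"
      using ex_sorting_permutation[of n "\<lambda>i. \<bar>\<mu> i\<bar>"] by blast
    define \<epsilon> where "\<epsilon> = restrict (\<lambda>k. if 0 < \<mu> (\<sigma> k) then 1 else - 1 :: real) {1..n}"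
    have "(\<sigma>, \<epsilon>) \<in> signed_perms n"
      using \<sigma> by (auto simp: signed_perms_def perms_def sign_vectors_def \<epsilon>_def)
    moreover have "0 < \<epsilon> k * \<mu> (\<sigma> k)" if "k \<in> {1..n}" for k
    proof -
      have "\<mu> (\<sigma> k) \<noteq> 0"
        using gen permutes_in_image[OF \<sigma>, of k] that unfolding generic_walk by blast
      then show ?thesis using that by (auto simp: \<epsilon>_def)
    qed
    moreover have "\<bar>\<mu> (\<sigma> l)\<bar> < \<bar>\<mu> (\<sigma> k)\<bar>" if kl: "k \<in> {1..n}" "l \<in> {1..n}" "k < l" for k l
    proof -
      have "\<sigma> l \<noteq> \<sigma> k" using kl permutes_inj[OF \<sigma>] by (auto simp: inj_eq)
      moreover have "\<sigma> k \<in> {1..n}" "\<sigma> l \<in> {1..n}"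
        using permutes_in_image[OF \<sigma>] kl by blast+
      ultimately have "\<bar>\<mu> (\<sigma> l)\<bar> \<noteq> \<bar>\<mu> (\<sigma> k)\<bar>"
        using gen unfolding generic_walk by blast
      then show ?thesis using dec[of k l] kl by simp
    qed
    ultimately show ?thesis
      by (intro bexI[of _ "(\<sigma>, \<epsilon>)"]) (auto simp: walk_chamber_def)
  qed
  show "pattern walk_walls n \<mu> = pattern walk_walls n \<nu> \<longleftrightarrow> g = h"
    if g: "g \<in> signed_perms n" and h: "h \<in> signed_perms n"
      and \<mu>: "\<mu> \<in> walk_chamber n g" and \<nu>: "\<nu> \<in> walk_chamber n h" for g h \<mu> \<nu>
  proof -
    obtain \<sigma> \<epsilon> where g_eq: "g = (\<sigma>, \<epsilon>)" by (cases g)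
    obtain \<tau> \<delta> where h_eq: "h = (\<tau>, \<delta>)" by (cases h)
    have \<sigma>: "\<sigma> permutes {1..n}" and \<tau>: "\<tau> permutes {1..n}"
      and \<epsilon>: "\<epsilon> \<in> sign_vectors n" and \<delta>: "\<delta> \<in> sign_vectors n"
      using g h by (auto simp: signed_perms_def perms_def g_eq h_eq)
    have \<mu>_dec: "\<bar>\<mu> (\<sigma> l)\<bar> < \<bar>\<mu> (\<sigma> k)\<bar>" and \<nu>_dec: "\<bar>\<nu> (\<tau> l)\<bar> < \<bar>\<nu> (\<tau> k)\<bar>"
      if "k \<in> {1..n}" "l \<in> {1..n}" "k < l" for k l
      using \<mu> \<nu> that by (auto simp: walk_chamber_def g_eq h_eq)
    have sgn: "0 < \<mu> (\<sigma> k) \<longleftrightarrow> \<epsilon> k = 1" "0 < \<nu> (\<tau> k) \<longleftrightarrow> \<delta> k = 1" if "k \<in> {1..n}" for k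
      using sign_pos_iff[OF sign_eq[OF \<epsilon> that], of "\<mu> (\<sigma> k)"]
        sign_pos_iff[OF sign_eq[OF \<delta> that], of "\<nu> (\<tau> k)"] \<mu> \<nu> that
      by (auto simp: walk_chamber_def g_eq h_eq)
    have "same_signed_order n \<mu> \<nu> \<longleftrightarrow> g = h"
    proof
      assume same: "same_signed_order n \<mu> \<nu>"
      have "\<sigma> = \<tau>"
        by (rule sorting_permutation_unique[OF \<sigma> \<tau>, of "\<lambda>i. \<bar>\<mu> i\<bar>" "\<lambda>i. \<bar>\<nu> i\<bar>"])
          (use \<mu>_dec \<nu>_dec same in \<open>auto simp: same_signed_order_def\<close>)
      moreover have "\<epsilon> = \<delta>"
      proof (rule sign_vectors_eqI[OF \<epsilon> \<delta>])
        fix k assume k: "k \<in> {1..n}"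
        have "\<sigma> k \<in> {1..n}" using permutes_in_image[OF \<sigma>] k by blast
        then have "0 < \<mu> (\<sigma> k) \<longleftrightarrow> 0 < \<nu> (\<sigma> k)"
          using same unfolding same_signed_order_def by blast
        then have "\<epsilon> k = 1 \<longleftrightarrow> \<delta> k = 1" using sgn[OF k] \<open>\<sigma> = \<tau>\<close> by simp
        then show "\<epsilon> k = \<delta> k" using sign_eq[OF \<epsilon> k] sign_eq[OF \<delta> k] by auto
      qed
      ultimately show "g = h" by (simp add: g_eq h_eq)
    next
      assume "g = h"
      then have eq: "\<tau> = \<sigma>" "\<delta> = \<epsilon>" by (auto simp: g_eq h_eq)
      \<comment> \<open>Inside one chamber absolute values are ordered oppositely to positions, so
        both vectors order the indices alike.\<close>
      have iff: "\<bar>\<kappa> (\<sigma> k)\<bar> < \<bar>\<kappa> (\<sigma> l)\<bar> \<longleftrightarrow> l < k"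
        if kl: "k \<in> {1..n}" "l \<in> {1..n}"
          and dec: "\<And>k l. \<lbrakk>k \<in> {1..n}; l \<in> {1..n}; k < l\<rbrakk> \<Longrightarrow> \<bar>\<kappa> (\<sigma> l)\<bar> < \<bar>\<kappa> (\<sigma> k)\<bar>"
        for \<kappa> :: "nat \<Rightarrow> real" and k l
        using dec[of k l] dec[of l k] kl by (cases k l rule: linorder_cases) auto
      show "same_signed_order n \<mu> \<nu>"
        unfolding same_signed_order_def
      proof (intro conjI ballI)
        fix i assume i: "i \<in> {1..n}"
        obtain k where k: "k \<in> {1..n}" "i = \<sigma> k" by (rule permutes_preimage[OF \<sigma> i])
        show "0 < \<mu> i \<longleftrightarrow> 0 < \<nu> i" using sgn[OF k(1)] by (simp add: k(2) eq)
        fix j assume j: "j \<in> {1..n}"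
        obtain l where l: "l \<in> {1..n}" "j = \<sigma> l" by (rule permutes_preimage[OF \<sigma> j])
        show "\<bar>\<mu> i\<bar> < \<bar>\<mu> j\<bar> \<longleftrightarrow> \<bar>\<nu> i\<bar> < \<bar>\<nu> j\<bar>"
          using iff[where \<kappa> = \<mu>, OF k(1) l(1) \<mu>_dec] iff[where \<kappa> = \<nu>, OF k(1) l(1) \<nu>_dec[unfolded eq]] by (simp add: k(2) l(2))
      qed
    qed
    then show ?thesis using pattern_walk[OF gen[OF g \<mu>] gen[OF h \<nu>]] by simp
  qed
qed

lemma card_hit_bridge:
  "card {\<sigma> \<in> perms n. \<exists>\<mu>\<in>bridge_chamber n \<sigma>. relation_mod n X S \<mu>}
     = card (patterns bridge_walls n X S)"
proof (rule card_hit_chambers)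
  have ne: "\<mu> (\<sigma> k) \<noteq> \<mu> (\<sigma> l)"
    if "\<mu> \<in> bridge_chamber n \<sigma>" "k \<in> {1..n}" "l \<in> {1..n}" "k \<noteq> l" for \<mu> \<sigma> k l
  proof (cases k l rule: linorder_cases)
    case less
    then have "\<mu> (\<sigma> l) < \<mu> (\<sigma> k)" using that(1-3) unfolding bridge_chamber_def by blast
    then show ?thesis by simp
  next
    case greater
    then have "\<mu> (\<sigma> k) < \<mu> (\<sigma> l)" using that(1-3) unfolding bridge_chamber_def by blast
    then show ?thesis by simp
  qed (use that(4) in simp)
  show gen: "generic bridge_walls n \<mu>" if "\<sigma> \<in> perms n" and \<mu>: "\<mu> \<in> bridge_chamber n \<sigma>" for \<sigma> \<mu>
  proof -
    have \<sigma>: "\<sigma> permutes {1..n}" using that by (auto simp: perms_def)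
    have "\<mu> i \<noteq> \<mu> j" if ij: "i \<in> {1..n}" "j \<in> {1..n}" "i \<noteq> j" for i j
    proof -
      obtain k where k: "k \<in> {1..n}" "i = \<sigma> k" by (rule permutes_preimage[OF \<sigma> ij(1)])
      obtain l where l: "l \<in> {1..n}" "j = \<sigma> l" by (rule permutes_preimage[OF \<sigma> ij(2)])
      show ?thesis using ne[OF \<mu> k(1) l(1)] k l ij by auto
    qed
    then show ?thesis unfolding generic_bridge inj_on_def by blast
  qed
  show "\<exists>\<sigma>\<in>perms n. \<mu> \<in> bridge_chamber n \<sigma>" if gen: "generic bridge_walls n \<mu>" for \<mu>
  proof -
    obtain \<sigma> where \<sigma>: "\<sigma> permutes {1..n}"
      and dec: "\<And>k l. \<lbrakk>k \<in> {1..n}; l \<in> {1..n}; k \<le> l\<rbrakk> \<Longrightarrow> \<mu> (\<sigma> l) \<le> \<mu> (\<sigma> k)"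
      using ex_sorting_permutation[of n \<mu>] by blast
    have "\<mu> (\<sigma> l) < \<mu> (\<sigma> k)" if kl: "k \<in> {1..n}" "l \<in> {1..n}" "k < l" for k l
    proof -
      have "\<sigma> l \<noteq> \<sigma> k" using kl permutes_inj[OF \<sigma>] by (auto simp: inj_eq)
      moreover have "\<sigma> k \<in> {1..n}" "\<sigma> l \<in> {1..n}"
        using permutes_in_image[OF \<sigma>] kl by blast+
      ultimately have "\<mu> (\<sigma> l) \<noteq> \<mu> (\<sigma> k)"
        using gen unfolding generic_bridge inj_on_def by blast
      then show ?thesis using dec[of k l] kl by simp
    qed
    then show ?thesis using \<sigma> by (auto simp: bridge_chamber_def perms_def)
  qed
  show "pattern bridge_walls n \<mu> = pattern bridge_walls n \<nu> \<longleftrightarrow> \<sigma> = \<tau>"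
    if \<sigma>': "\<sigma> \<in> perms n" and \<tau>': "\<tau> \<in> perms n"
      and \<mu>: "\<mu> \<in> bridge_chamber n \<sigma>" and \<nu>: "\<nu> \<in> bridge_chamber n \<tau>" for \<sigma> \<tau> \<mu> \<nu>
  proof -
    have \<sigma>: "\<sigma> permutes {1..n}" and \<tau>: "\<tau> permutes {1..n}"
      using \<sigma>' \<tau>' by (auto simp: perms_def)
    have \<mu>_dec: "\<mu> (\<sigma> l) < \<mu> (\<sigma> k)" and \<nu>_dec: "\<nu> (\<tau> l) < \<nu> (\<tau> k)"
      if "k \<in> {1..n}" "l \<in> {1..n}" "k < l" for k l
      using \<mu> \<nu> that by (auto simp: bridge_chamber_def)
    have "(\<forall>i\<in>{1..n}. \<forall>j\<in>{1..n}. \<mu> i < \<mu> j \<longleftrightarrow> \<nu> i < \<nu> j) \<longleftrightarrow> \<sigma> = \<tau>"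
    proof
      assume same: "\<forall>i\<in>{1..n}. \<forall>j\<in>{1..n}. \<mu> i < \<mu> j \<longleftrightarrow> \<nu> i < \<nu> j"
      show "\<sigma> = \<tau>"
        by (rule sorting_permutation_unique[OF \<sigma> \<tau>, of \<mu> \<nu>]) (use \<mu>_dec \<nu>_dec same in auto)
    next
      assume eq: "\<sigma> = \<tau>"
      have iff: "\<kappa> (\<sigma> k) < \<kappa> (\<sigma> l) \<longleftrightarrow> l < k"
        if kl: "k \<in> {1..n}" "l \<in> {1..n}"
          and dec: "\<And>k l. \<lbrakk>k \<in> {1..n}; l \<in> {1..n}; k < l\<rbrakk> \<Longrightarrow> \<kappa> (\<sigma> l) < \<kappa> (\<sigma> k)"
        for \<kappa> :: "nat \<Rightarrow> real" and k l
        using dec[of k l] dec[of l k] kl by (cases k l rule: linorder_cases) auto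
      show "\<forall>i\<in>{1..n}. \<forall>j\<in>{1..n}. \<mu> i < \<mu> j \<longleftrightarrow> \<nu> i < \<nu> j"
      proof (intro ballI)
        fix i j assume i: "i \<in> {1..n}" and j: "j \<in> {1..n}"
        obtain k where k: "k \<in> {1..n}" "i = \<sigma> k" by (rule permutes_preimage[OF \<sigma> i])
        obtain l where l: "l \<in> {1..n}" "j = \<sigma> l" by (rule permutes_preimage[OF \<sigma> j])
        show "\<mu> i < \<mu> j \<longleftrightarrow> \<nu> i < \<nu> j"
          using iff[where \<kappa> = \<mu>, OF k(1) l(1) \<mu>_dec] iff[where \<kappa> = \<nu>, OF k(1) l(1) \<nu>_dec[folded eq]] by (simp add: k(2) l(2))
      qed
    qed
    then show ?thesis using pattern_bridge[OF gen[OF \<sigma>' \<mu>] gen[OF \<tau>' \<nu>]] by simp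
  qed
qed

section \<open>Positive relations of partial sums as points of chambers\<close>

lemma wendel_hit_iff:
  fixes X :: "nat \<Rightarrow> real ^ 'd"
  assumes reg: "wendel_regular n X" and n: "CARD('d) + 1 \<le> n" and \<epsilon>: "\<epsilon> \<in> sign_vectors n"
  shows "0 \<in> convex hull (sign_act \<epsilon> X ` {1..n}) \<longleftrightarrow> (\<exists>\<mu>\<in>wendel_chamber n \<epsilon>. relation_mod n X {0} \<mu>)"
proof -
  have gp: "general_position n (sign_act \<epsilon> X)"
    using general_position_sign_act[OF _ \<epsilon>] reg by (simp add: wendel_regular_def)
  have sq: "\<epsilon> k * \<epsilon> k = 1" if "k \<in> {1..n}" for k
    using sign_eq[OF \<epsilon> that] by auto
  show ?thesis
    unfolding zero_in_hull_iff[OF gp n] relation_mod_0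
  proof
    assume "\<exists>a. (\<forall>k\<in>{1..n}. 0 < a k) \<and> (\<Sum>k = 1..n. a k *\<^sub>R sign_act \<epsilon> X k) = 0"
    then obtain a where a: "\<forall>k\<in>{1..n}. 0 < a k" "(\<Sum>k = 1..n. a k *\<^sub>R sign_act \<epsilon> X k) = 0" by blast
    have "(\<lambda>k. \<epsilon> k * a k) \<in> wendel_chamber n \<epsilon>"
      using a(1) sq by (simp add: wendel_chamber_def mult.assoc[symmetric])
    moreover have "(\<Sum>k = 1..n. (\<epsilon> k * a k) *\<^sub>R X k) = 0"
      using a(2) by (simp add: sign_act_def mult.commute)
    ultimately show "\<exists>\<mu>\<in>wendel_chamber n \<epsilon>. (\<Sum>i = 1..n. \<mu> i *\<^sub>R X i) = 0"
      by (intro bexI[of _ "\<lambda>k. \<epsilon> k * a k"])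
  next
    assume "\<exists>\<mu>\<in>wendel_chamber n \<epsilon>. (\<Sum>i = 1..n. \<mu> i *\<^sub>R X i) = 0"
    then obtain \<mu> where \<mu>: "\<mu> \<in> wendel_chamber n \<epsilon>" "(\<Sum>i = 1..n. \<mu> i *\<^sub>R X i) = 0" by blast
    have "(\<Sum>k = 1..n. (\<epsilon> k * \<mu> k) *\<^sub>R sign_act \<epsilon> X k) = (\<Sum>i = 1..n. \<mu> i *\<^sub>R X i)"
      using sq by (intro sum.cong) (simp_all add: sign_act_def mult.commute mult.left_commute)
    then show "\<exists>a. (\<forall>k\<in>{1..n}. 0 < a k) \<and> (\<Sum>k = 1..n. a k *\<^sub>R sign_act \<epsilon> X k) = 0"
      using \<mu> by (intro exI[of _ "\<lambda>k. \<epsilon> k * \<mu> k"]) (simp add: wendel_chamber_def)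
  qed
qed

text \<open>Inverts the passage to gaps: tail sums have the given positive gaps and end in
  zero.\<close>

lemma decreasing_tail_sums:
  fixes a :: "nat \<Rightarrow> real"
  assumes a: "\<forall>k\<in>{1..n}. 0 < a k"
  obtains A where "\<And>k. k \<in> {1..n} \<Longrightarrow> A k - A (Suc k) = a k" "A (Suc n) = 0"
    "\<And>k l. \<lbrakk>1 \<le> k; k < l; l \<le> Suc n\<rbrakk> \<Longrightarrow> A l < A k"
proof
  define A where "A k = (\<Sum>j = k..n. a j)" for k
  show "A k - A (Suc k) = a k" if "k \<in> {1..n}" for k
    using that by (simp add: A_def sum.atLeast_Suc_atMost)
  show "A (Suc n) = 0" by (simp add: A_def)
  show "A l < A k" if "1 \<le> k" "k < l" "l \<le> Suc n" for k l
  proof -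
    have "A k = sum a ({k..n} - {l..n}) + A l"
      unfolding A_def by (rule sum.subset_diff) (use that in auto)
    moreover have "0 < sum a ({k..n} - {l..n})"
    proof (rule sum_pos)
      show "{k..n} - {l..n} \<noteq> {}" using that by (auto intro!: exI[of _ k])
      show "0 < a i" if "i \<in> {k..n} - {l..n}" for i
        using that a \<open>1 \<le> k\<close> by auto
    qed auto
    ultimately show ?thesis by simp
  qed
qed

text \<open>Positive weights on partial sums are the gaps of a positive strictly decreasing sequence
  \<open>A\<close>. Undoing \<open>g\<close>, by the inverse permutation and the signs, makes
  \<open>A\<close> a point of the chamber of \<open>g\<close>.\<close>

lemma walk_hit_iff:
  fixes X :: "nat \<Rightarrow> real ^ 'd"
  assumes reg: "walk_regular n X" and n: "CARD('d) + 1 \<le> n" and g: "g \<in> signed_perms n"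
  shows "0 \<in> convex hull (partial_sum (signed_perm_act g X) ` {1..n})
    \<longleftrightarrow> (\<exists>\<mu>\<in>walk_chamber n g. relation_mod n X {0} \<mu>)"
proof -
  obtain \<sigma> \<epsilon> where g_eq: "g = (\<sigma>, \<epsilon>)" by (cases g)
  have \<sigma>: "\<sigma> permutes {1..n}" and \<epsilon>: "\<epsilon> \<in> sign_vectors n"
    using g by (auto simp: signed_perms_def perms_def g_eq)
  define y where "y = signed_perm_act g X"
  have gp: "general_position n (partial_sum y)"
    using reg g unfolding walk_regular_def y_def by blast
  have sq: "\<epsilon> k * \<epsilon> k = 1" and sgn_abs: "\<bar>\<epsilon> k\<bar> = 1" if "k \<in> {1..n}" for k
    using sign_eq[OF \<epsilon> that] by auto
  show ?thesis
    unfolding y_def[symmetric] zero_in_hull_iff[OF gp n] relation_mod_0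
  proof
    assume "\<exists>a. (\<forall>k\<in>{1..n}. 0 < a k) \<and> (\<Sum>k = 1..n. a k *\<^sub>R partial_sum y k) = 0"
    then obtain a where a: "\<forall>k\<in>{1..n}. 0 < a k" "(\<Sum>k = 1..n. a k *\<^sub>R partial_sum y k) = 0" by blast
    obtain A where gap: "\<And>k. k \<in> {1..n} \<Longrightarrow> A k - A (Suc k) = a k" and A0: "A (Suc n) = 0"
      and dec: "\<And>k l. \<lbrakk>1 \<le> k; k < l; l \<le> Suc n\<rbrakk> \<Longrightarrow> A l < A k"
      using decreasing_tail_sums[OF a(1)] by metis
    have pos: "0 < A k" if "k \<in> {1..n}" for k
      using dec[of k "Suc n"] that A0 by simp
    define \<mu> where "\<mu> i = \<epsilon> (inv \<sigma> i) * A (inv \<sigma> i)" for i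
    have \<mu>: "\<mu> (\<sigma> k) = \<epsilon> k * A k" for k
      by (simp add: \<mu>_def permutes_inverses(2)[OF \<sigma>])
    have "\<mu> \<in> walk_chamber n g"
      using pos dec sq sgn_abs
      by (auto simp: walk_chamber_def g_eq \<mu> mult.assoc[symmetric] abs_mult abs_of_pos)
    moreover have "(\<Sum>i = 1..n. \<mu> i *\<^sub>R X i) = 0"
    proof -
      have "(\<Sum>i = 1..n. A i *\<^sub>R y i) = (\<Sum>k = 1..n. (A k - A (Suc k)) *\<^sub>R partial_sum y k)"
        using summation_by_parts_partial_sum[of A y n] A0 by simp
      also have "\<dots> = (\<Sum>k = 1..n. a k *\<^sub>R partial_sum y k)"
        using gap by (intro sum.cong) auto
      finally have "(\<Sum>i = 1..n. A i *\<^sub>R y i) = 0" using a(2) by simp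
      moreover have "(\<Sum>i = 1..n. A i *\<^sub>R y i) = (\<Sum>i = 1..n. \<mu> (\<sigma> i) *\<^sub>R X (\<sigma> i))"
        by (intro sum.cong) (simp_all add: y_def signed_perm_act_def g_eq \<mu> mult.commute)
      ultimately show ?thesis using sum_permuted[OF \<sigma>, of \<mu> X] by simp
    qed
    ultimately show "\<exists>\<mu>\<in>walk_chamber n g. (\<Sum>i = 1..n. \<mu> i *\<^sub>R X i) = 0" by blast
  next
    assume "\<exists>\<mu>\<in>walk_chamber n g. (\<Sum>i = 1..n. \<mu> i *\<^sub>R X i) = 0"
    then obtain \<mu> where \<mu>: "\<mu> \<in> walk_chamber n g" "(\<Sum>i = 1..n. \<mu> i *\<^sub>R X i) = 0" by blast
    define A where "A k = (if k \<in> {1..n} then \<epsilon> k * \<mu> (\<sigma> k) else 0)" for k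
    have A_abs: "A k = \<bar>\<mu> (\<sigma> k)\<bar>" if "k \<in> {1..n}" for k
    proof -
      have "0 < A k" using \<mu>(1) that by (simp add: A_def walk_chamber_def g_eq)
      then have "A k = \<bar>A k\<bar>" by simp
      also have "\<dots> = \<bar>\<mu> (\<sigma> k)\<bar>" using that sgn_abs[OF that] by (simp add: A_def abs_mult)
      finally show ?thesis .
    qed
    have "0 < A k - A (Suc k)" if k: "k \<in> {1..n}" for k
    proof (cases "k = n")
      case True
      \<comment> \<open>The last gap is the smallest absolute value, positive by the sign condition
        of the chamber.\<close>
      then have "A (Suc k) = 0" by (simp add: A_def)
      moreover have "0 < A k" using \<mu>(1) k by (simp add: A_def walk_chamber_def g_eq)
      ultimately show ?thesis by simp
    next
      case False
      then have "Suc k \<in> {1..n}" using k by auto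
      moreover from this have "\<bar>\<mu> (\<sigma> (Suc k))\<bar> < \<bar>\<mu> (\<sigma> k)\<bar>"
        using \<mu>(1) k by (simp add: walk_chamber_def g_eq)
      ultimately show ?thesis using A_abs k by simp
    qed
    moreover have "(\<Sum>k = 1..n. (A k - A (Suc k)) *\<^sub>R partial_sum y k) = 0"
    proof -
      have "A (Suc n) = 0" by (simp add: A_def)
      then have "(\<Sum>k = 1..n. (A k - A (Suc k)) *\<^sub>R partial_sum y k) = (\<Sum>i = 1..n. A i *\<^sub>R y i)"
        using summation_by_parts_partial_sum[of A y n] by simp
      also have "\<dots> = (\<Sum>i = 1..n. \<mu> (\<sigma> i) *\<^sub>R X (\<sigma> i))"
        using sq by (intro sum.cong)
          (simp_all add: y_def signed_perm_act_def g_eq A_def mult.commute mult.left_commute)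
      finally show ?thesis using \<mu>(2) sum_permuted[OF \<sigma>, of \<mu> X] by simp
    qed
    ultimately show "\<exists>a. (\<forall>k\<in>{1..n}. 0 < a k) \<and> (\<Sum>k = 1..n. a k *\<^sub>R partial_sum y k) = 0"
      by (intro exI[of _ "\<lambda>k. A k - A (Suc k)"]) blast
  qed
qed

text \<open>There are only \<open>n - 1\<close> gaps between \<open>n\<close> coefficients, so the
  chamber prescribes an order but no signs. The hull criterion is applied to \<open>n - 1\<close>
  vectors, which is where \<open>CARD('d) + 2 \<le> n\<close> comes from.\<close>

lemma bridge_hit_iff:
  fixes X :: "nat \<Rightarrow> real ^ 'd"
  assumes conf: "bridge_configuration n X" and reg: "bridge_regular n X"
    and n: "CARD('d) + 2 \<le> n" and \<sigma>': "\<sigma> \<in> perms n"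
  shows "0 \<in> convex hull (partial_sum (perm_act \<sigma> X) ` {1..n - 1})
    \<longleftrightarrow> (\<exists>\<mu>\<in>bridge_chamber n \<sigma>. relation_mod n X {0} \<mu>)"
proof -
  have \<sigma>: "\<sigma> permutes {1..n}" using \<sigma>' by (simp add: perms_def)
  define y where "y = perm_act \<sigma> X"
  have gp: "general_position (n - 1) (partial_sum y)"
    using reg \<sigma>' unfolding bridge_regular_def y_def by blast
  have nn: "Suc (n - 1) = n" and n': "CARD('d) + 1 \<le> n - 1" using n by auto
  have "partial_sum y n = 0"
    using conf sum_permuted[OF \<sigma>, of "\<lambda>_. 1" X]
    by (simp add: partial_sum_def bridge_configuration_def y_def perm_act_def)
  moreover have "partial_sum y n = partial_sum y (n - 1) + y n"
    using sum.cl_ivl_Suc[of y 1 "n - 1"] nn by (simp add: partial_sum_def)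
  \<comment> \<open>This turns the boundary term of summation by parts over \<open>n - 1\<close>
    indices into the missing summand with coefficient \<open>A n\<close>.\<close>
  ultimately have last: "partial_sum y (n - 1) = - y n"
    by (metis add.commute minus_unique)
  have parts: "(\<Sum>k = 1..n - 1. (A k - A (Suc k)) *\<^sub>R partial_sum y k) = (\<Sum>i = 1..n. A i *\<^sub>R y i)" for A
    using summation_by_parts_partial_sum[of A y "n - 1"] sum.cl_ivl_Suc[of "\<lambda>i. A i *\<^sub>R y i" 1 "n - 1"] nn
    by (simp add: last del: One_nat_def)
  show ?thesis
    unfolding y_def[symmetric] zero_in_hull_iff[OF gp n'] relation_mod_0
  proof
    assume "\<exists>a. (\<forall>k\<in>{1..n - 1}. 0 < a k) \<and> (\<Sum>k = 1..n - 1. a k *\<^sub>R partial_sum y k) = 0"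
    then obtain a where a: "\<forall>k\<in>{1..n - 1}. 0 < a k" "(\<Sum>k = 1..n - 1. a k *\<^sub>R partial_sum y k) = 0" by blast
    obtain A where gap: "\<And>k. k \<in> {1..n - 1} \<Longrightarrow> A k - A (Suc k) = a k"
      and dec: "\<And>k l. \<lbrakk>1 \<le> k; k < l; l \<le> Suc (n - 1)\<rbrakk> \<Longrightarrow> A l < A k"
      using decreasing_tail_sums[OF a(1)] by metis
    define \<mu> where "\<mu> i = A (inv \<sigma> i)" for i
    have \<mu>: "\<mu> (\<sigma> k) = A k" for k
      by (simp add: \<mu>_def permutes_inverses(2)[OF \<sigma>])
    have "\<mu> \<in> bridge_chamber n \<sigma>"
      using dec nn by (auto simp: bridge_chamber_def \<mu>)
    moreover have "(\<Sum>i = 1..n. \<mu> i *\<^sub>R X i) = 0"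
    proof -
      have "(\<Sum>i = 1..n. A i *\<^sub>R y i) = (\<Sum>k = 1..n - 1. a k *\<^sub>R partial_sum y k)"
        unfolding parts[symmetric] using gap by (intro sum.cong) auto
      then have "(\<Sum>i = 1..n. A i *\<^sub>R y i) = 0" using a(2) by simp
      moreover have "(\<Sum>i = 1..n. A i *\<^sub>R y i) = (\<Sum>i = 1..n. \<mu> (\<sigma> i) *\<^sub>R X (\<sigma> i))"
        by (intro sum.cong) (simp_all add: y_def perm_act_def \<mu>)
      ultimately show ?thesis using sum_permuted[OF \<sigma>, of \<mu> X] by simp
    qed
    ultimately show "\<exists>\<mu>\<in>bridge_chamber n \<sigma>. (\<Sum>i = 1..n. \<mu> i *\<^sub>R X i) = 0" by blast
  next
    assume "\<exists>\<mu>\<in>bridge_chamber n \<sigma>. (\<Sum>i = 1..n. \<mu> i *\<^sub>R X i) = 0"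
    then obtain \<mu> where \<mu>: "\<mu> \<in> bridge_chamber n \<sigma>" "(\<Sum>i = 1..n. \<mu> i *\<^sub>R X i) = 0" by blast
    define A where "A k = \<mu> (\<sigma> k)" for k
    have "0 < A k - A (Suc k)" if k: "k \<in> {1..n - 1}" for k
      using \<mu>(1) k by (auto simp: A_def bridge_chamber_def)
    moreover have "(\<Sum>k = 1..n - 1. (A k - A (Suc k)) *\<^sub>R partial_sum y k) = 0"
    proof -
      have "(\<Sum>i = 1..n. A i *\<^sub>R y i) = (\<Sum>i = 1..n. \<mu> (\<sigma> i) *\<^sub>R X (\<sigma> i))"
        by (intro sum.cong) (simp_all add: y_def perm_act_def A_def)
      then show ?thesis unfolding parts using \<mu>(2) sum_permuted[OF \<sigma>, of \<mu> X] by simp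
    qed
    ultimately show "\<exists>a. (\<forall>k\<in>{1..n - 1}. 0 < a k) \<and> (\<Sum>k = 1..n - 1. a k *\<^sub>R partial_sum y k) = 0"
      by (intro exI[of _ "\<lambda>k. A k - A (Suc k)"]) blast
  qed
qed

section \<open>Normalization by the number of all chambers\<close>

lemma p_wendel_eq_tail:
  fixes X :: "nat \<Rightarrow> real ^ 'd"
  assumes reg: "wendel_regular n X" and n: "CARD('d) + 1 \<le> n"
  shows "p_wendel n X = bernoulli_tail (\<lambda>_. 1 / 2) 2 (n - 1) CARD('d)"
proof -
  have T: "real (card (wendel_walls m) + 1) = 2" if "1 \<le> m" for m
    using card_wendel_walls[OF that] by simp
  have "{\<epsilon> \<in> sign_vectors n. 0 \<in> convex hull (sign_act \<epsilon> X ` {1..n})}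
      = {\<epsilon> \<in> sign_vectors n. \<exists>\<mu>\<in>wendel_chamber n \<epsilon>. relation_mod n X {0} \<mu>}"
    using wendel_hit_iff[OF reg n] by blast
  then have "p_wendel n X = real (card (patterns wendel_walls n X {0})) / 2 ^ n"
    by (simp add: p_wendel_def card_hit_wendel)
  also have "real (card (patterns wendel_walls n X {0})) =
      (\<Prod>m = 0 + 1..n. real (card (wendel_walls m) + 1))
        * bernoulli_tail (\<lambda>m. 1 / real (card (wendel_walls m) + 1)) (0 + 2) (n - (0 + 1)) CARD('d)"
    by (rule wendel.card_patterns) (use wendel_regular_mod[OF reg] n in \<open>auto simp: subspace_0\<close>)
  also have "(\<Prod>m = 0 + 1..n. real (card (wendel_walls m) + 1)) = (\<Prod>m = 1..n. 2)"
    by (rule prod.cong) (use T in auto)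
  also have "\<dots> = (2 :: real) ^ n" by simp
  also have "bernoulli_tail (\<lambda>m. 1 / real (card (wendel_walls m) + 1)) (0 + 2) (n - (0 + 1)) CARD('d)
      = bernoulli_tail (\<lambda>_. 1 / 2) (0 + 2) (n - (0 + 1)) CARD('d)"
    by (rule tail_cong, subst T) auto
  finally show ?thesis by (simp add: numeral_2_eq_2)
qed

lemma p_walk_eq_tail:
  fixes X :: "nat \<Rightarrow> real ^ 'd"
  assumes reg: "walk_regular n X" and n: "CARD('d) + 1 \<le> n"
  shows "p_walk n X = bernoulli_tail (\<lambda>m. 1 / (2 * real m)) 2 (n - 1) CARD('d)"
proof -
  have T: "real (card (walk_walls m) + 1) = 2 * real m" if "1 \<le> m" for m
    using card_walk_walls[OF that] by simp
  have "{g \<in> signed_perms n. 0 \<in> convex hull (partial_sum (signed_perm_act g X) ` {1..n})}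
      = {g \<in> signed_perms n. \<exists>\<mu>\<in>walk_chamber n g. relation_mod n X {0} \<mu>}"
    using walk_hit_iff[OF reg n] by blast
  then have "p_walk n X = real (card (patterns walk_walls n X {0})) / (2 ^ n * fact n)"
    by (simp add: p_walk_def card_hit_walk)
  also have "real (card (patterns walk_walls n X {0})) =
      (\<Prod>m = 0 + 1..n. real (card (walk_walls m) + 1))
        * bernoulli_tail (\<lambda>m. 1 / real (card (walk_walls m) + 1)) (0 + 2) (n - (0 + 1)) CARD('d)"
    by (rule walk.card_patterns) (use walk_regular_mod[OF reg] n in \<open>auto simp: subspace_0\<close>)
  also have "(\<Prod>m = 0 + 1..n. real (card (walk_walls m) + 1)) = (\<Prod>m = 1..n. 2 * real m)"
    by (rule prod.cong) (use T in auto)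
  \<comment> \<open>The product counts all chambers, and this number is the order of the group of
    signed permutations.\<close>
  also have "\<dots> = 2 ^ n * fact n" by (simp add: prod.distrib fact_prod)
  also have "bernoulli_tail (\<lambda>m. 1 / real (card (walk_walls m) + 1)) (0 + 2) (n - (0 + 1)) CARD('d)
      = bernoulli_tail (\<lambda>m. 1 / (2 * real m)) (0 + 2) (n - (0 + 1)) CARD('d)"
    by (rule tail_cong, subst T) auto
  finally show ?thesis by (simp add: numeral_2_eq_2)
qed

lemma p_bridge_eq_tail:
  fixes X :: "nat \<Rightarrow> real ^ 'd"
  assumes conf: "bridge_configuration n X" and reg: "bridge_regular n X" and n: "CARD('d) + 2 \<le> n"
  shows "p_bridge n X = bernoulli_tail (\<lambda>m. 1 / real m) 3 (n - 2) CARD('d)"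
proof -
  have T: "real (card (bridge_walls m) + 1) = real m" if "1 \<le> m" for m
    using card_bridge_walls[OF that] by simp
  have "{\<sigma> \<in> perms n. 0 \<in> convex hull (partial_sum (perm_act \<sigma> X) ` {1..n - 1})}
      = {\<sigma> \<in> perms n. \<exists>\<mu>\<in>bridge_chamber n \<sigma>. relation_mod n X {0} \<mu>}"
    using bridge_hit_iff[OF conf reg n] by blast
  then have "p_bridge n X = real (card (patterns bridge_walls n X {0})) / fact n"
    by (simp add: p_bridge_def card_hit_bridge)
  also have "real (card (patterns bridge_walls n X {0})) =
      (\<Prod>m = 1 + 1..n. real (card (bridge_walls m) + 1))
        * bernoulli_tail (\<lambda>m. 1 / real (card (bridge_walls m) + 1)) (1 + 2) (n - (1 + 1)) CARD('d)"
    by (rule bridge.card_patterns) (use bridge_regular_mod[OF conf reg] n in \<open>auto simp: subspace_0\<close>)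
  also have "(\<Prod>m = 1 + 1..n. real (card (bridge_walls m) + 1)) = (\<Prod>m = 2..n. real m)"
    by (rule prod.cong) (use T in auto)
  also have "\<dots> = fact n"
  proof -
    \<comment> \<open>The product starts at 2; the factor 1 belongs to the coordinate without
      walls.\<close>
    have "{1..n} = insert 1 {2..n}" using n by auto
    then show ?thesis by (simp add: fact_prod)
  qed
  also have "bernoulli_tail (\<lambda>m. 1 / real (card (bridge_walls m) + 1)) (1 + 2) (n - (1 + 1)) CARD('d)
      = bernoulli_tail (\<lambda>m. 1 / real m) (1 + 2) (n - (1 + 1)) CARD('d)"
    by (rule tail_cong, subst T) auto
  finally show ?thesis by (simp add: numeral_2_eq_2 numeral_3_eq_3)
qed

theorem corollary20:
  fixes M :: "'a measure" and U :: "nat \<Rightarrow> 'a \<Rightarrow> nat"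
    and X :: "nat \<Rightarrow> real ^ 'd" and n :: nat
  shows
    "(indep_bernoulli_seq M (\<lambda>m. 2 * real m) U \<and> n \<ge> CARD('d) + 1 \<and> walk_regular n X \<longrightarrow>
        p_walk n X = \<P>(\<omega> in M. (\<Sum>m = 2..n. U m \<omega>) \<ge> CARD('d)))
     \<and>
     (indep_bernoulli_seq M (\<lambda>m. real m) U \<and> n \<ge> CARD('d) + 2 \<and>
      bridge_configuration n X \<and> bridge_regular n X \<longrightarrow>
        p_bridge n X = \<P>(\<omega> in M. (\<Sum>m = 3..n. U m \<omega>) \<ge> CARD('d)))
     \<and>
     (indep_bernoulli_seq M (\<lambda>m. 2) U \<and> n \<ge> CARD('d) + 1 \<longrightarrow>
        (wendel_regular n X \<longrightarrow>
          p_wendel n X = \<P>(\<omega> in M. (\<Sum>m = 2..n. U m \<omega>) \<ge> CARD('d))) \<and>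
        \<P>(\<omega> in M. (\<Sum>m = 2..n. U m \<omega>) \<ge> CARD('d)) =
          \<P>(k in measure_pmf (binomial_pmf (n - 1) (1 / 2)). k \<ge> CARD('d)))"
proof (intro conjI impI; elim conjE)
  assume U: "indep_bernoulli_seq M (\<lambda>m. 2 * real m) U" and n: "n \<ge> CARD('d) + 1" and X: "walk_regular n X"
  have "{2..<2 + (n - 1)} = {2..n}" using n by auto
  then show "p_walk n X = \<P>(\<omega> in M. (\<Sum>m = 2..n. U m \<omega>) \<ge> CARD('d))"
    using prob_tail[OF U, where a = 2 and k = "n - 1" and d = "CARD('d)"] p_walk_eq_tail[OF X n] by simp
next
  assume U: "indep_bernoulli_seq M (\<lambda>m. real m) U" and n: "n \<ge> CARD('d) + 2"
    and X: "bridge_configuration n X" "bridge_regular n X"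
  have "{3..<3 + (n - 2)} = {3..n}" using n by auto
  then show "p_bridge n X = \<P>(\<omega> in M. (\<Sum>m = 3..n. U m \<omega>) \<ge> CARD('d))"
    using prob_tail[OF U, where a = 3 and k = "n - 2" and d = "CARD('d)"] p_bridge_eq_tail[OF X n] by simp
next
  assume U: "indep_bernoulli_seq M (\<lambda>m. 2) U" and n: "n \<ge> CARD('d) + 1"
  have "{2..<2 + (n - 1)} = {2..n}" using n by auto
  then have M_tail: "\<P>(\<omega> in M. (\<Sum>m = 2..n. U m \<omega>) \<ge> CARD('d)) = bernoulli_tail (\<lambda>_. 1 / 2) 2 (n - 1) CARD('d)"
    using prob_tail[OF U, where a = 2 and k = "n - 1" and d = "CARD('d)"] by simp
  show "p_wendel n X = \<P>(\<omega> in M. (\<Sum>m = 2..n. U m \<omega>) \<ge> CARD('d))" if "wendel_regular n X"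
    using p_wendel_eq_tail[OF that n] M_tail by simp
  show "\<P>(\<omega> in M. (\<Sum>m = 2..n. U m \<omega>) \<ge> CARD('d)) =
          \<P>(k in measure_pmf (binomial_pmf (n - 1) (1 / 2)). k \<ge> CARD('d))"
    using binomial_tail[where p = "1 / 2" and k = "n - 1" and d = "CARD('d)" and a = 2] M_tail by simp
qed

end
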